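(* Let $\alpha\in(0,1)$, let $l\ge1$ be an integer, and let $(\beta_n)_{n\ge1}$ be a sequence of positive numbers with $\beta_n\to\infty$ and $\beta_n/n^{1-\alpha}\to0$. Fix integers $n\ge 1$, $1\le j\le n$ and a frequency vector $(n_1,\dots,n_j)$ for the conditional quantities. 1. For $\theta=0$, the limiting log-Laplace transforms $\psi,\psi_l,\psi^{(n)},\psi_l^{(n)}$ defined in the context (of $K_n$, $M_{l,n}$, $K_m^{(n)}$, $M_{l,m}^{(n)}$ respectively) exist for every $\lambda\in\mathbb{R}$ and $$\psi(\lambda)=\psi^{(n)}(\lambda)=\begin{cases}\lambda^{1/\alpha} & \lambda>0\\ 0&\lambda\leq0\end{cases}$$ and $$\psi_{l}(\lambda)=\psi_{l}^{(n)}(\lambda)=\begin{cases}\left(\frac{\alpha(1-\alpha)_{(l-1)}}{l!}\lambda\right)^{1/\alpha} & \lambda>0\\ 0&\lambda\leq0.\end{cases}$$ 2. For $\theta>-\alpha$, $K_n$, $M_{l,n}$, $K_m^{(n)}$, $M_{l,m}^{(n)}$ satisfy moderate deviation principles with rate functions $I$, $I_l$, $I^{(n)}$, $I^{(n)}_l$ respectively; that is, $K_n/(n^\alpha\beta_n)$ and $M_{l,n}/(n^\alpha\beta_n)$ satisfy large deviation principles on $\mathbb{R}$ as $n\to\infty$ with speed $\beta_n^{1/(1-\alpha)}$ and rate functions $I$ and $I_l$, and, under the conditional law given $K_n=j$, $N_n=(n_1,\dots,n_j)$, $K_m^{(n)}/(m^\alpha\beta_m)$ and $M_{l,m}^{(n)}/(m^\alpha\beta_m)$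 satisfy large deviation principles on $\mathbb{R}$ as $m\to\infty$ with speed $\beta_m^{1/(1-\alpha)}$ and rate functions $I^{(n)}$ and $I_l^{(n)}$, where $$I(x)=I^{(n)}(x)=\begin{cases}(1-\alpha)\alpha^{\alpha/(1-\alpha)}x^{1/(1-\alpha)} & x\geq 0\\ +\infty& x<0\end{cases}$$ and $$I_{l}(x)=I^{(n)}_{l}(x)=\begin{cases}(1-\alpha)\left(\frac{l!}{(1-\alpha)_{(l-1)}}\right)^{\alpha/(1-\alpha)}x^{1/(1-\alpha)} & x\geq 0\\ +\infty & x<0.\end{cases}$$
   Context: Ewens-Pitman sampling model with parameters $\alpha\in(0,1)$, $\theta>-\alpha$: let $\nu$ be a diffuse probability measure on a Polish space. The sequence $(X_i)_{i\ge1}$ satisfies $\mathbb{P}(X_1\in\cdot)=\nu(\cdot)$ and $$\mathbb{P}(X_{n+1}\in\cdot\mid X_1,\dots,X_n)=\frac{\theta+j\alpha}{\theta+n}\nu(\cdot)+\frac{1}{\theta+n}\sum_{r=1}^{j}(n_r-\alpha)\delta_{X_r^*}(\cdot),$$ where $X_1^*,\dots,X_j^*$ are the distinct values among $X_1,\dots,X_n$ and $N_n=(n_1,\dots,n_j)$ are their frequencies. $K_n$ is the number of distinct values (types) in $X_1,\dots,X_n$, and $M_{l,n}$ is the number of types with frequency $l$ in it. For an additional sample $X_{n+1},\dots,X_{n+m}$, $K_m^{(n)}$ is the number of types in it that do not appear in $X_1,\dots,X_n$, and $M_{l,m}^{(n)}$ is the number of such new types with frequency $l$ in the additional sample. Notation: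 $a_{(k)}=\Gamma(a+k)/\Gamma(a)$ is the rising factorial. The limiting log-Laplace transforms are $$\psi(\lambda)=\lim_{n\to\infty}\frac{1}{\beta_{n}^{1/(1-\alpha)}}\log\mathbb{E}\exp\Big\{\lambda \frac{\beta_{n}^{1/(1-\alpha)}K_{n}}{n^\alpha\beta_{n}}\Big\},$$ $$\psi_{l}(\lambda)=\lim_{n\to\infty}\frac{1}{\beta_{n}^{1/(1-\alpha)}}\log\mathbb{E}\exp\Big\{\lambda \frac{\beta_{n}^{1/(1-\alpha)} M_{l,n}}{n^\alpha\beta_{n}}\Big\},$$ $$\psi^{(n)}(\lambda)=\lim_{m\to\infty}\frac{1}{\beta_{m}^{1/(1-\alpha)}}\log\mathbb{E}\Big[\exp\Big\{\lambda \beta_{m}^{1/(1-\alpha)} \frac{K_{m}^{(n)}}{m^\alpha\beta_{m}}\Big\}\,\Big|\, K_{n}=j,\ N_{n}=(n_1,\dots,n_j)\Big],$$ $$\psi_{l}^{(n)}(\lambda)=\lim_{m\to\infty}\frac{1}{\beta_{m}^{1/(1-\alpha)}}\log\mathbb{E}\Big[\exp\Big\{\lambda \beta_{m}^{1/(1-\alpha)}\frac{M_{l,m}^{(n)}}{m^\alpha\beta_{m}}\Big\}\,\Big|\, K_{n}=j,\ N_{n}=(n_1,\dots,n_j)\Big].$$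
   Formalization: The printed constant in I_l = I_l^(n) contradicts psi_l; the formal theorem uses the Legendre transform of psi_l instead: I_l(x) = ((1-α)/α)(l!/(1-α)_(l-1))^{1/(1-α)} x^{1/(1-α)} for x ≥ 0. *)

theory Defs
  imports "HOL-Probability.Probability"
begin

section \<open>Statistics of a finite sample\<close>

text \<open>\<open>types xs\<close> lists the distinct values \<open>X\<^sub>1\<^sup>*, \<dots>, X\<^sub>j\<^sup>*\<close> in order of first appearance; the two
  reversals are needed because \<^const>\<open>remdups\<close> keeps last occurrences.\<close>

definition types :: "'a list \<Rightarrow> 'a list" where
  "types xs = rev (remdups (rev xs))"

definition num_types :: "'a list \<Rightarrow> nat" where
  "num_types xs = card (set xs)"

definition freqs :: "'a list \<Rightarrow> nat list" where
  "freqs xs = map (count_list xs) (types xs)"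

definition num_freq :: "nat \<Rightarrow> 'a list \<Rightarrow> nat" where
  "num_freq l xs = card {x \<in> set xs. count_list xs x = l}"

definition num_new_types :: "'a list \<Rightarrow> 'a list \<Rightarrow> nat" where
  "num_new_types xs ys = card (set ys - set xs)"

definition num_new_freq :: "nat \<Rightarrow> 'a list \<Rightarrow> 'a list \<Rightarrow> nat" where
  "num_new_freq l xs ys = card {y \<in> set ys - set xs. count_list ys y = l}"


section \<open>The Ewens-Pitman sampling model\<close>

text \<open>The sequence is indexed from 1; \<open>X 0\<close> plays no role.\<close>

definition sample :: "(nat \<Rightarrow> 'w \<Rightarrow> 'a) \<Rightarrow> nat \<Rightarrow> 'w \<Rightarrow> 'a list" where
  "sample X n \<omega> = map (\<lambda>i. X i \<omega>) [1..<n + 1]"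

definition add_sample :: "(nat \<Rightarrow> 'w \<Rightarrow> 'a) \<Rightarrow> nat \<Rightarrow> nat \<Rightarrow> 'w \<Rightarrow> 'a list" where
  "add_sample X n m \<omega> = map (\<lambda>i. X i \<omega>) [n + 1..<n + m + 1]"

text \<open>The sigma-algebra generated by \<open>X\<^sub>1, \<dots>, X\<^sub>n\<close>.\<close>

definition past :: "'w measure \<Rightarrow> (nat \<Rightarrow> 'w \<Rightarrow> 'a::topological_space) \<Rightarrow> nat \<Rightarrow> 'w measure" where
  "past M X n =
     vimage_algebra (space M) (\<lambda>\<omega>. \<lambda>i\<in>{1..n}. X i \<omega>) (\<Pi>\<^sub>M i\<in>{1..n}. borel)"

definition predictive ::
    "real \<Rightarrow> real \<Rightarrow> 'a measure \<Rightarrow> 'a list \<Rightarrow> 'a set \<Rightarrow> real" where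
  "predictive \<alpha> \<theta> \<nu> xs A =
     (\<theta> + real (num_types xs) * \<alpha>) / (\<theta> + real (length xs)) * measure \<nu> A
     + 1 / (\<theta> + real (length xs)) *
         (\<Sum>r<num_types xs. (real (freqs xs ! r) - \<alpha>) * indicator A (types xs ! r))"

definition ewens_pitman ::
    "real \<Rightarrow> real \<Rightarrow> 'a::polish_space measure \<Rightarrow> 'w measure \<Rightarrow> (nat \<Rightarrow> 'w \<Rightarrow> 'a) \<Rightarrow> bool" where
  "ewens_pitman \<alpha> \<theta> \<nu> M X \<longleftrightarrow>
     prob_space \<nu> \<and> sets \<nu> = sets borel \<and> (\<forall>x. measure \<nu> {x} = 0) \<and>
     prob_space M \<and> (\<forall>i\<ge>1. X i \<in> borel_measurable M) \<and>
     distr M borel (X 1) = \<nu> \<and>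
     (\<forall>n\<ge>1. \<forall>A\<in>sets borel. AE \<omega> in M.
        real_cond_exp M (past M X n) (indicator (X (n + 1) -` A \<inter> space M)) \<omega>
          = predictive \<alpha> \<theta> \<nu> (sample X n \<omega>) A)"

text \<open>The conditional law given the event \<open>K\<^sub>n = j, N\<^sub>n = ns\<close>, which has positive probability
  for every composition \<open>ns\<close> of \<open>n\<close> into \<open>j\<close> parts.\<close>

definition given_freqs ::
    "'w measure \<Rightarrow> (nat \<Rightarrow> 'w \<Rightarrow> 'a) \<Rightarrow> nat \<Rightarrow> nat \<Rightarrow> nat list \<Rightarrow> 'w measure" where
  "given_freqs M X n j ns =
     uniform_measure M
       {\<omega> \<in> space M. num_types (sample X n \<omega>) = j \<and> freqs (sample X n \<omega>) = ns}"


section \<open>Log-Laplace transforms and large deviation principles\<close>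

definition log_laplace ::
    "'w measure \<Rightarrow> (nat \<Rightarrow> 'w \<Rightarrow> real) \<Rightarrow> (nat \<Rightarrow> real) \<Rightarrow> real \<Rightarrow> nat \<Rightarrow> real" where
  "log_laplace Q Z s t k = 1 / s k * ln (\<integral>\<omega>. exp (t * s k * Z k \<omega>) \<partial>Q)"

definition eln :: "real \<Rightarrow> ereal" where
  "eln p = (if p \<le> 0 then -\<infinity> else ereal (ln p))"

definition rate_function :: "('b::topological_space \<Rightarrow> ereal) \<Rightarrow> bool" where
  "rate_function I \<longleftrightarrow> (\<forall>x. 0 \<le> I x) \<and> (\<forall>c::real. closed {x. I x \<le> ereal c})"

text \<open>\<open>Z k\<close> satisfies, under \<open>Q\<close> and as \<open>k\<close> tends to infinity, a large deviation principle
  with speed \<open>s k\<close> and rate function \<open>I\<close>.\<close>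

definition LDP ::
    "'w measure \<Rightarrow> (nat \<Rightarrow> 'w \<Rightarrow> 'b::topological_space) \<Rightarrow> (nat \<Rightarrow> real) \<Rightarrow> ('b \<Rightarrow> ereal) \<Rightarrow> bool"
  where
  "LDP Q Z s I \<longleftrightarrow>
     (\<forall>k. Z k \<in> borel_measurable Q) \<and> rate_function I \<and>
     (\<forall>F. closed F \<longrightarrow>
        limsup (\<lambda>k. eln (measure Q {\<omega> \<in> space Q. Z k \<omega> \<in> F}) / ereal (s k))
          \<le> - (INF x\<in>F. I x)) \<and>
     (\<forall>G. open G \<longrightarrow>
        - (INF x\<in>G. I x)
          \<le> liminf (\<lambda>k. eln (measure Q {\<omega> \<in> space Q. Z k \<omega> \<in> G}) / ereal (s k)))"


section \<open>Limits and rate functions\<close>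

definition speed :: "real \<Rightarrow> (nat \<Rightarrow> real) \<Rightarrow> nat \<Rightarrow> real" where
  "speed \<alpha> \<beta> k = \<beta> k powr (1 / (1 - \<alpha>))"

definition scaled ::
    "real \<Rightarrow> (nat \<Rightarrow> real) \<Rightarrow> (nat \<Rightarrow> 'w \<Rightarrow> nat) \<Rightarrow> nat \<Rightarrow> 'w \<Rightarrow> real" where
  "scaled \<alpha> \<beta> Y k \<omega> = real (Y k \<omega>) / (real k powr \<alpha> * \<beta> k)"

definition psi :: "real \<Rightarrow> real \<Rightarrow> real" where
  "psi \<alpha> t = (if t > 0 then t powr (1 / \<alpha>) else 0)"

definition psi_freq :: "real \<Rightarrow> nat \<Rightarrow> real \<Rightarrow> real" where
  "psi_freq \<alpha> l t =
     (if t > 0 then (\<alpha> * pochhammer (1 - \<alpha>) (l - 1) / fact l * t) powr (1 / \<alpha>) else 0)"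

definition rate :: "real \<Rightarrow> real \<Rightarrow> ereal" where
  "rate \<alpha> x =
     (if x \<ge> 0
      then ereal ((1 - \<alpha>) * \<alpha> powr (\<alpha> / (1 - \<alpha>)) * x powr (1 / (1 - \<alpha>)))
      else \<infinity>)"

text \<open>The constant is that of the Legendre transform of \<^const>\<open>psi_freq\<close>. It corrects the source,
  which prints \<open>(1 - \<alpha>) * (fact l / pochhammer (1 - \<alpha>) (l - 1)) powr (\<alpha> / (1 - \<alpha>))\<close>: this
  is strictly smaller and contradicts the limiting log-Laplace transform
  \<^const>\<open>psi_freq\<close> through the exponential Markov inequality.\<close>

definition rate_freq :: "real \<Rightarrow> nat \<Rightarrow> real \<Rightarrow> ereal" where
  "rate_freq \<alpha> l x =
     (if x \<ge> 0
      then ereal ((1 - \<alpha>) / \<alpha> * (fact l / pochhammer (1 - \<alpha>) (l - 1)) powr (1 / (1 - \<alpha>))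
                  * x powr (1 / (1 - \<alpha>)))
      else \<infinity>)"

end

theory Submission
  imports Defs
begin

text \<open>All eight claims follow from one limit, which holds for every \<open>\<theta> > - \<alpha>\<close>: if \<open>Y\<close> counts the
  types, or the types of frequency \<open>l\<close>, then the log-Laplace transform of the rescaled \<open>Y\<close> at
  \<open>t > 0\<close> converges to \<open>(p t)\<close> to the power \<open>1/\<alpha>\<close>, where \<open>p = 1\<close> for all types and \<open>p\<close> is the
  asymptotic proportion \<open>block_weight \<alpha> l\<close> of types of frequency \<open>l\<close>. The limit is differentiable
  in \<open>t > 0\<close>, and exponential tilting turns it into a large deviation principle whose rate is its
  Legendre transform; the upper bound at small levels forces the rescaled counts to vanish in
  probability, which gives the limit \<open>0\<close> for \<open>t \<le> 0\<close>. This is the locale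
  \<open>power_laplace_limit\<close>.

  The limit itself comes from exact moments. Only the pattern of coincidences in the sample
  matters; it is encoded by the list of first-occurrence positions (\<open>code\<close>), and the codes form a
  Markov chain with explicit transition probabilities (\<open>code_event_repeat\<close>, \<open>code_event_new\<close>). For
  this chain the expected number of \<open>r\<close>-tuples of distinct new types with prescribed frequencies,
  weighted by a rising factorial of \<open>K + \<theta>/\<alpha>\<close>, satisfies a linear recursion in the sample size
  that is closed within this family and has a product solution (\<open>expectation_moment_fun\<close>).
  Two special cases are needed. Divided by factorials, the rising factorials of \<open>K + \<theta>/\<alpha>\<close> are the
  coefficients of \<open>(1 - u)\<close> to the power \<open>-(K + \<theta>/\<alpha>)\<close>, and the falling factorials of the number \<open>M\<close> of
  new types with frequency \<open>l\<close> those of \<open>(1 + z)\<close> to the power \<open>M\<close>. Hence both exponential moments are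
  power series with explicit nonnegative coefficients. Apart from powers of \<open>p\<close>, these are \<open>gcoeff\<close> and
  \<open>freq_coeff\<close>; the latter is at most the former, and at indices proportional to the speed they agree up to
  subexponential factors.

  With \<open>m\<close> draws, speed \<open>s\<close> and \<open>u\<close> of order \<open>t (s/m)\<close> to the power \<open>\<alpha>\<close>, these series are
  estimated as in the saddle point method. For the upper bound, the coefficients of
  \<open>(1 - (1 - v))\<close> to the power \<open>-a\<close> are bounded by the value of that function, and \<open>v = c s/m\<close> yields
  \<open>exp (c s)\<close> for every \<open>c\<close> above \<open>t\<close> to the power \<open>1/\<alpha>\<close>. For the lower bound a single term, with index
  proportional to \<open>s\<close>, suffices. Because \<open>\<beta>\<close> may grow arbitrarily slowly, factors that are powers
  of \<open>m\<close> are not negligible, only powers of \<open>s\<close> are: this is why the upper bound averages over a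
  window of \<open>m/s\<close> consecutive coefficients (\<open>pochhammer_upper\<close>).

  Finally, the unconditional statements are the conditional ones given the first draw, up to a
  bounded error in the counts.\<close>

section \<open>Placements of marked blocks under one transition\<close>

text \<open>The one-step expectation of the chain of codes: a code of length \<open>N\<close> is extended by \<open>N\<close> when a
  new type appears and by the first position \<open>i\<close> of an old type otherwise. Iterating the operator
  gives the expectation after several draws.\<close>
definition transition :: "real \<Rightarrow> real \<Rightarrow> (nat list \<Rightarrow> real) \<Rightarrow> nat list \<Rightarrow> real" where
  "transition \<alpha> \<theta> g c =
     ((\<theta> + \<alpha> * real (num_types c)) * g (c @ [length c])
      + (\<Sum>i\<in>set c. (real (count_list c i) - \<alpha>) * g (c @ [i]))) / (\<theta> + real (length c))"

text \<open>The marks in \<open>S\<close> are put on distinct types outside \<open>A\<close>, with prescribed frequencies. In the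
  applications \<open>A\<close> is the set of types of the initial sample, and the number of placements is a
  product of falling factorials of the counts of new types by frequency.\<close>
definition placements :: "nat set \<Rightarrow> nat set \<Rightarrow> (nat \<Rightarrow> nat) \<Rightarrow> nat list \<Rightarrow> (nat \<Rightarrow> nat) set" where
  "placements A S k c =
     {t \<in> S \<rightarrow>\<^sub>E (set c - A). inj_on t S \<and> (\<forall>s\<in>S. count_list c (t s) = k s)}"

lemma count_list_snoc_other: "x \<noteq> y \<Longrightarrow> count_list (c @ [y]) x = count_list c x"
  by simp

lemma finite_placements: "finite S \<Longrightarrow> finite (placements A S k c)"
  unfolding placements_def by (rule finite_subset[OF _ finite_PiE[of S "\<lambda>_. set c - A"]]) auto

lemma placements_snoc_old:
  assumes "y \<in> A"
  shows "placements A S k (c @ [y]) = placements A S k c"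
proof -
  have "set (c @ [y]) - A = set c - A" using assms by auto
  moreover have "(\<forall>s\<in>S. count_list (c @ [y]) (t s) = k s) \<longleftrightarrow> (\<forall>s\<in>S. count_list c (t s) = k s)"
    if "t \<in> S \<rightarrow>\<^sub>E (set c - A)" for t
  proof (rule ball_cong[OF refl])
    fix s assume "s \<in> S"
    then have "t s \<noteq> y" using that assms by (auto simp: PiE_iff)
    then show "count_list (c @ [y]) (t s) = k s \<longleftrightarrow> count_list c (t s) = k s" by simp
  qed
  ultimately show ?thesis unfolding placements_def by (intro Collect_cong) (metis (no_types))
qed

lemma card_placements_split:
  assumes "finite S"
  shows "card (placements A S k c') = card {t \<in> placements A S k c'. y \<notin> t ` S}
          + (\<Sum>s\<in>S. card {t \<in> placements A S k c'. t s = y})"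
proof -
  let ?T = "placements A S k c'"
  have fin: "finite ?T" by (rule finite_placements[OF assms])
  have eq: "?T = {t \<in> ?T. y \<notin> t ` S} \<union> (\<Union>s\<in>S. {t \<in> ?T. t s = y})" by auto
  have "card ?T = card {t \<in> ?T. y \<notin> t ` S} + card (\<Union>s\<in>S. {t \<in> ?T. t s = y})"
    by (subst eq, subst card_Un_disjoint) (use fin assms in auto)
  also have "card (\<Union>s\<in>S. {t \<in> ?T. t s = y}) = (\<Sum>s\<in>S. card {t \<in> ?T. t s = y})"
  proof (rule card_UN_disjoint)
    show "\<forall>s\<in>S. \<forall>s'\<in>S. s \<noteq> s' \<longrightarrow> {t \<in> ?T. t s = y} \<inter> {t \<in> ?T. t s' = y} = {}"
      by (auto simp: placements_def inj_on_def)
  qed (use fin assms in auto)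
  finally show ?thesis .
qed

lemma placements_avoid:
  "{t \<in> placements A S k (c @ [y]). y \<notin> t ` S} = {t \<in> placements A S k c. y \<notin> t ` S}"
proof -
  have "t \<in> placements A S k (c @ [y]) \<longleftrightarrow> t \<in> placements A S k c" if y: "y \<notin> t ` S" for t
  proof -
    have "t \<in> S \<rightarrow>\<^sub>E (set (c @ [y]) - A) \<longleftrightarrow> t \<in> S \<rightarrow>\<^sub>E (set c - A)"
      using that by (auto simp: PiE_iff)
    moreover have "(\<forall>s\<in>S. count_list (c @ [y]) (t s) = k s) \<longleftrightarrow> (\<forall>s\<in>S. count_list c (t s) = k s)"
      using y by (intro ball_cong refl) auto
    ultimately show ?thesis by (simp only: placements_def mem_Collect_eq)
  qed
  then show ?thesis by blast
qed

lemma placements_repeat: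
  assumes "y \<in> set c" "y \<notin> A" "s \<in> S" "1 \<le> k s"
  shows "{t \<in> placements A S k (c @ [y]). t s = y} = {t \<in> placements A S (k(s := k s - 1)) c. t s = y}"
proof -
  have set_eq: "set (c @ [y]) = set c" using assms by auto
  have "t \<in> placements A S k (c @ [y]) \<longleftrightarrow> t \<in> placements A S (k(s := k s - 1)) c" if y: "t s = y" for t
  proof (cases "inj_on t S")
    case True
    have "count_list (c @ [y]) (t s') = k s' \<longleftrightarrow> count_list c (t s') = (k(s := k s - 1)) s'"
      if s': "s' \<in> S" for s'
    proof (cases "s' = s")
      case True
      then show ?thesis using assms(4) y by auto
    next
      case False
      then have "t s' \<noteq> y" using y s' assms(3) \<open>inj_on t S\<close> by (auto dest: inj_onD)
      then show ?thesis using False by simp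
    qed
    then have "(\<forall>s'\<in>S. count_list (c @ [y]) (t s') = k s')
        \<longleftrightarrow> (\<forall>s'\<in>S. count_list c (t s') = (k(s := k s - 1)) s')"
      by (intro ball_cong refl)
    then show ?thesis by (simp only: placements_def mem_Collect_eq set_eq)
  next
    case False
    then show ?thesis by (simp add: placements_def)
  qed
  then show ?thesis by blast
qed

lemma placements_fresh:
  assumes "finite S" "y \<notin> set c" "y \<notin> A" "s \<in> S"
  shows "card {t \<in> placements A S k (c @ [y]). t s = y}
       = (if k s = 1 then card (placements A (S - {s}) k c) else 0)"
proof (cases "k s = 1")
  case True
  have c0: "count_list c y = 0" using assms by (simp add: count_list_0_iff)
  have "bij_betw (\<lambda>t. t(s := undefined)) {t \<in> placements A S k (c @ [y]). t s = y}
          (placements A (S - {s}) k c)"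
  proof (rule bij_betw_byWitness[where f' = "\<lambda>t. t(s := y)"])
    show "\<forall>t\<in>{t \<in> placements A S k (c @ [y]). t s = y}. t(s := undefined, s := y) = t" by auto
    show "\<forall>t\<in>placements A (S - {s}) k c. t(s := y, s := undefined) = t"
      by (auto simp: placements_def PiE_iff extensional_def)
    show "(\<lambda>t. t(s := undefined)) ` {t \<in> placements A S k (c @ [y]). t s = y} \<subseteq> placements A (S - {s}) k c"
    proof (rule image_subsetI)
      fix t assume "t \<in> {t \<in> placements A S k (c @ [y]). t s = y}"
      then have t: "t \<in> placements A S k (c @ [y])" and y: "t s = y" by auto
      have ne: "t s' \<noteq> y" if "s' \<in> S" "s' \<noteq> s" for s'
        using t that y assms(4) by (auto simp: placements_def inj_on_def)
      have cs: "count_list c (t s') = k s'" if "s' \<in> S" "s' \<noteq> s" for s'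
      proof -
        have "count_list (c @ [y]) (t s') = k s'" using t that unfolding placements_def by blast
        then show ?thesis using count_list_snoc_other[OF ne[OF that]] by metis
      qed
      have "t s' \<in> set c - A" if "s' \<in> S" "s' \<noteq> s" for s'
        using t ne[OF that] that by (auto simp: placements_def PiE_iff)
      moreover have "t s' = undefined" if "s' \<notin> S" for s'
        using t that by (auto simp: placements_def PiE_iff extensional_def)
      moreover have "inj_on t S" using t by (simp add: placements_def)
      ultimately show "t(s := undefined) \<in> placements A (S - {s}) k c"
        using cs by (auto simp: placements_def PiE_iff extensional_def inj_on_def)
    qed
    show "(\<lambda>t. t(s := y)) ` placements A (S - {s}) k c \<subseteq> {t \<in> placements A S k (c @ [y]). t s = y}"
    proof (rule image_subsetI)
      fix t assume t: "t \<in> placements A (S - {s}) k c"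
      have mem: "t s' \<in> set c - A" "t s' \<noteq> y" "count_list c (t s') = k s'" if "s' \<in> S - {s}" for s'
        using t that assms(2) by (auto simp: placements_def PiE_iff)
      have "count_list (c @ [y]) ((t(s := y)) s') = k s'" if "s' \<in> S" for s'
      proof (cases "s' = s")
        case True
        then show ?thesis using \<open>k s = 1\<close> c0 by simp
      next
        case False
        then show ?thesis using mem[of s'] that by simp
      qed
      moreover have "inj_on (t(s := y)) S"
        using t mem(2) by (auto simp: placements_def inj_on_def)
      moreover have "t(s := y) \<in> S \<rightarrow>\<^sub>E (set (c @ [y]) - A)"
        using t mem(1) assms by (auto simp: placements_def PiE_iff extensional_def)
      ultimately show "t(s := y) \<in> {t \<in> placements A S k (c @ [y]). t s = y}"
        by (simp only: placements_def mem_Collect_eq fun_upd_same) blast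
    qed
  qed
  then show ?thesis using True by (simp add: bij_betw_same_card)
next
  case False
  have c0: "count_list c y = 0" using assms by (simp add: count_list_0_iff)
  have "{t \<in> placements A S k (c @ [y]). t s = y} = {}"
    using assms False c0 by (force simp: placements_def)
  then have "card {t \<in> placements A S k (c @ [y]). t s = y} = 0" by (simp only: card.empty)
  then show ?thesis using False by simp
qed

text \<open>A new type creates exactly the placements that put some mark \<open>s\<close> with \<open>k s = 1\<close> on it; removing that
  mark leaves a placement of the others before the draw.\<close>
lemma card_placements_fresh:
  assumes "finite S" "y \<notin> set c" "y \<notin> A"
  shows "card (placements A S k (c @ [y])) = card (placements A S k c)
          + (\<Sum>s\<in>S. if k s = 1 then card (placements A (S - {s}) k c) else 0)"
proof -
  have "{t \<in> placements A S k c. y \<notin> t ` S} = placements A S k c"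
    using assms by (force simp: placements_def PiE_iff)
  then show ?thesis
    using card_placements_split[OF assms(1), of A k "c @ [y]" y] assms
    by (simp add: placements_avoid placements_fresh)
qed

lemma sum_swap_card:
  assumes "finite Y" "finite T"
  shows "(\<Sum>y\<in>Y. f y * real (card {t \<in> T. P y t})) = (\<Sum>t\<in>T. \<Sum>y\<in>{y \<in> Y. P y t}. f y :: real)"
proof -
  have "(\<Sum>y\<in>Y. f y * real (card {t \<in> T. P y t})) = (\<Sum>y\<in>Y. \<Sum>t\<in>{t \<in> T. P y t}. f y)"
    by (simp add: mult.commute)
  also have "\<dots> = (\<Sum>t\<in>T. \<Sum>y\<in>{y \<in> Y. P y t}. f y)"
    by (rule sum.swap_restrict[OF assms])
  finally show ?thesis .
qed

text \<open>When an old type is drawn, a placement survives if the type is unmarked; these types carry the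
  total weight \<open>N - \<alpha> K\<close> minus the weights of the marked ones. Otherwise the mark \<open>s\<close> on the drawn type
  had frequency \<open>k s - 1\<close> before, which is drawn with weight \<open>k s - 1 - \<alpha>\<close>.\<close>
lemma sum_placements_repeat:
  fixes \<alpha> :: real
  assumes S: "finite S" and k: "\<forall>s\<in>S. 1 \<le> k s"
  shows "(\<Sum>y\<in>set c. (real (count_list c y) - \<alpha>) * real (card (placements A S k (c @ [y]))))
       = (real (length c) - \<alpha> * real (num_types c) - real (sum k S) + \<alpha> * real (card S))
           * real (card (placements A S k c))
         + (\<Sum>s\<in>S. (real (k s) - 1 - \<alpha>) * real (card (placements A S (k(s := k s - 1)) c)))"
proof -
  let ?f = "\<lambda>y. real (count_list c y) - \<alpha>"
  let ?T = "placements A S k c"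
  let ?R = "\<lambda>s. placements A S (k(s := k s - 1)) c"
  have one: "card (placements A S k (c @ [y])) = card {t \<in> ?T. y \<notin> t ` S}
           + (\<Sum>s\<in>S. card {t \<in> ?R s. t s = y})" if y: "y \<in> set c" for y
  proof (cases "y \<in> A")
    case True
    have "{t \<in> ?T. y \<notin> t ` S} = ?T" "\<And>s. s \<in> S \<Longrightarrow> {t \<in> ?R s. t s = y} = {}"
      using True by (auto simp: placements_def PiE_iff)
    moreover have "(\<Sum>s\<in>S. card {t \<in> ?R s. t s = y}) = 0"
      by (intro sum.neutral ballI) (simp only: calculation(2) card.empty)
    ultimately show ?thesis using True by (simp only: placements_snoc_old)
  next
    case False
    then show ?thesis
      using card_placements_split[OF S, of A k "c @ [y]" y] y k
      by (simp add: placements_avoid placements_repeat)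
  qed
  have "(\<Sum>y\<in>set c. ?f y * real (card (placements A S k (c @ [y]))))
      = (\<Sum>y\<in>set c. ?f y * real (card {t \<in> ?T. y \<notin> t ` S}))
        + (\<Sum>y\<in>set c. \<Sum>s\<in>S. ?f y * real (card {t \<in> ?R s. t s = y}))"
    by (simp add: one ring_distribs sum.distrib sum_distrib_left)
  also have "(\<Sum>y\<in>set c. ?f y * real (card {t \<in> ?T. y \<notin> t ` S}))
      = (\<Sum>t\<in>?T. \<Sum>y\<in>{y \<in> set c. y \<notin> t ` S}. ?f y)"
    by (rule sum_swap_card) (auto simp: finite_placements S)
  also have "\<dots> = (\<Sum>t\<in>?T. real (length c) - \<alpha> * real (num_types c) - real (sum k S) + \<alpha> * real (card S))"
  proof (rule sum.cong[OF refl])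
    fix t assume t: "t \<in> ?T"
    have sub: "t ` S \<subseteq> set c" and inj: "inj_on t S" using t by (auto simp: placements_def PiE_iff)
    have "{y \<in> set c. y \<notin> t ` S} = set c - t ` S" by auto
    then have "(\<Sum>y\<in>{y \<in> set c. y \<notin> t ` S}. ?f y) = (\<Sum>y\<in>set c. ?f y) - (\<Sum>y\<in>t ` S. ?f y)"
      by (simp add: sum_diff sub)
    also have "(\<Sum>y\<in>set c. ?f y) = real (length c) - \<alpha> * real (num_types c)"
    proof -
      have "(\<Sum>y\<in>set c. count_list c y) = length c" by (simp add: sum_count_set)
      then show ?thesis by (simp add: sum_subtractf num_types_def flip: of_nat_sum)
    qed
    also have "(\<Sum>y\<in>t ` S. ?f y) = (\<Sum>s\<in>S. real (k s) - \<alpha>)"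
      using t by (subst sum.reindex[OF inj]) (auto simp: placements_def intro!: sum.cong)
    also have "\<dots> = real (sum k S) - \<alpha> * real (card S)" by (simp add: sum_subtractf)
    finally show "(\<Sum>y\<in>{y \<in> set c. y \<notin> t ` S}. ?f y)
      = real (length c) - \<alpha> * real (num_types c) - real (sum k S) + \<alpha> * real (card S)" by simp
  qed
  also have "(\<Sum>y\<in>set c. \<Sum>s\<in>S. ?f y * real (card {t \<in> ?R s. t s = y}))
      = (\<Sum>s\<in>S. \<Sum>t\<in>?R s. \<Sum>y\<in>{y \<in> set c. t s = y}. ?f y)"
    by (subst sum.swap, rule sum.cong[OF refl], rule sum_swap_card) (auto simp: finite_placements S)
  also have "\<dots> = (\<Sum>s\<in>S. \<Sum>t\<in>?R s. real (k s) - 1 - \<alpha>)"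
  proof (intro sum.cong refl)
    fix s t assume s: "s \<in> S" and t: "t \<in> ?R s"
    have "{y \<in> set c. t s = y} = {t s}" using s t by (auto simp: placements_def PiE_iff)
    then show "(\<Sum>y\<in>{y \<in> set c. t s = y}. ?f y) = real (k s) - 1 - \<alpha>"
      using s t k by (force simp: placements_def of_nat_diff)
  qed
  finally show ?thesis by (simp add: mult.commute)
qed

lemma placements_zero_count:
  assumes "s \<in> S" "k s = 0"
  shows "placements A S k c = {}"
  using assms by (force simp: placements_def PiE_iff count_list_0_iff)

text \<open>The rising factorial is the weight that absorbs the probability \<open>\<theta> + \<alpha> K\<close> of a new type: up to the
  factor \<open>\<alpha>\<close> it raises \<open>q\<close> by one. This keeps the recursion for the moments closed although \<open>K\<close> enters the
  transition probabilities.\<close>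
definition moment_fun :: "real \<Rightarrow> real \<Rightarrow> nat set \<Rightarrow> nat set \<Rightarrow> (nat \<Rightarrow> nat) \<Rightarrow> nat \<Rightarrow> nat list \<Rightarrow> real" where
  "moment_fun \<alpha> \<theta> A S k q c =
     real (card (placements A S k c)) * pochhammer (real (num_types c) + \<theta> / \<alpha>) q"

lemma transition_moment_fun:
  assumes \<alpha>: "0 < \<alpha>" and pos: "\<theta> + real (length c) > 0"
    and S: "finite S" and k: "\<forall>s\<in>S. 1 \<le> k s"
    and c: "set c \<subseteq> {..<length c}" and A: "A \<subseteq> set c"
  shows "transition \<alpha> \<theta> (moment_fun \<alpha> \<theta> A S k q) c * (\<theta> + real (length c))
     = (\<theta> + real (length c) + \<alpha> * real (card S + q) - real (sum k S)) * moment_fun \<alpha> \<theta> A S k q c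
       + (\<Sum>s\<in>S. if k s = 1 then \<alpha> * moment_fun \<alpha> \<theta> A (S - {s}) k (Suc q) c
                  else (real (k s) - 1 - \<alpha>) * moment_fun \<alpha> \<theta> A S (k(s := k s - 1)) q c)"
proof -
  let ?K = "real (num_types c)"
  let ?f = "\<lambda>q. pochhammer (?K + \<theta> / \<alpha>) q"
  let ?T = "\<lambda>S k. real (card (placements A S k c))"
  have fresh: "length c \<notin> set c" "length c \<notin> A" using c A by auto
  have K': "real (num_types (c @ [length c])) = ?K + 1" using fresh by (simp add: num_types_def)
  have K'': "num_types (c @ [i]) = num_types c" if "i \<in> set c" for i
    using that by (simp add: num_types_def insert_absorb)
  have up: "(\<theta> + \<alpha> * ?K) * pochhammer (?K + 1 + \<theta> / \<alpha>) q = \<alpha> * ?f (Suc q)"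
    using \<alpha> by (simp add: pochhammer_rec field_simps)
  have up2: "?f (Suc q) = ?f q * (?K + \<theta> / \<alpha> + real q)" by (simp add: pochhammer_Suc)
  have "transition \<alpha> \<theta> (moment_fun \<alpha> \<theta> A S k q) c * (\<theta> + real (length c))
     = (\<theta> + \<alpha> * ?K) * (real (card (placements A S k (c @ [length c]))) * pochhammer (?K + 1 + \<theta> / \<alpha>) q)
       + ?f q * (\<Sum>y\<in>set c. (real (count_list c y) - \<alpha>) * real (card (placements A S k (c @ [y]))))"
    using pos unfolding transition_def moment_fun_def sum_distrib_left K'
    by (simp add: K'' mult_ac cong: sum.cong)
  also have "(\<theta> + \<alpha> * ?K) * (real (card (placements A S k (c @ [length c]))) * pochhammer (?K + 1 + \<theta> / \<alpha>) q)
     = \<alpha> * ?f (Suc q) * (?T S k + (\<Sum>s\<in>S. if k s = 1 then ?T (S - {s}) k else 0))"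
  proof -
    have "real (card (placements A S k (c @ [length c])))
        = ?T S k + (\<Sum>s\<in>S. if k s = 1 then ?T (S - {s}) k else 0)"
      unfolding card_placements_fresh[OF S fresh] of_nat_add of_nat_sum
      by (intro arg_cong2[where f = "(+)"] sum.cong refl) simp
    then show ?thesis unfolding up[symmetric] by (simp only: mult_ac)
  qed
  also have "\<alpha> * ?f (Suc q) * (?T S k + (\<Sum>s\<in>S. if k s = 1 then ?T (S - {s}) k else 0))
     + ?f q * (\<Sum>y\<in>set c. (real (count_list c y) - \<alpha>) * real (card (placements A S k (c @ [y]))))
     = (\<theta> + real (length c) + \<alpha> * real (card S + q) - real (sum k S)) * (?T S k * ?f q)
      + (\<Sum>s\<in>S. \<alpha> * ?f (Suc q) * (if k s = 1 then ?T (S - {s}) k else 0)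
           + ?f q * ((real (k s) - 1 - \<alpha>) * ?T S (k(s := k s - 1))))"
    unfolding sum_placements_repeat[OF S k]
    using \<alpha> unfolding sum.distrib sum_distrib_left[symmetric] up2 by (simp add: field_simps)
  also have "(\<Sum>s\<in>S. \<alpha> * ?f (Suc q) * (if k s = 1 then ?T (S - {s}) k else 0)
           + ?f q * ((real (k s) - 1 - \<alpha>) * ?T S (k(s := k s - 1))))
     = (\<Sum>s\<in>S. if k s = 1 then \<alpha> * moment_fun \<alpha> \<theta> A (S - {s}) k (Suc q) c
                  else (real (k s) - 1 - \<alpha>) * moment_fun \<alpha> \<theta> A S (k(s := k s - 1)) q c)"
    by (rule sum.cong) (auto simp: moment_fun_def placements_zero_count)
  finally show ?thesis by (simp only: moment_fun_def[of \<alpha> \<theta> A S k q c])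
qed

section \<open>Closed form of the moments\<close>

text \<open>The limit proportion of types with frequency \<open>k\<close>.\<close>
definition block_weight :: "real \<Rightarrow> nat \<Rightarrow> real" where
  "block_weight \<alpha> k = \<alpha> * pochhammer (1 - \<alpha>) (k - 1) / fact k"

definition falling :: "nat \<Rightarrow> nat \<Rightarrow> real" where
  "falling m c = fact c * real (m choose c)"

definition moment :: "real \<Rightarrow> real \<Rightarrow> real \<Rightarrow> nat set \<Rightarrow> (nat \<Rightarrow> nat) \<Rightarrow> nat \<Rightarrow> nat \<Rightarrow> real" where
  "moment \<alpha> x B S k q m =
     (\<Prod>s\<in>S. block_weight \<alpha> (k s)) * pochhammer x (card S + q) * falling m (sum k S)
     * pochhammer (B + \<alpha> * real (card S + q)) (m - sum k S) / pochhammer B m"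

lemma falling_Suc: "falling (Suc m) (Suc c) = falling m (Suc c) + real (Suc c) * falling m c"
  by (simp add: falling_def algebra_simps)

text \<open>This identity is the recursion of the moments once the weights of the blocks are divided out.\<close>
lemma falling_pochhammer_Suc:
  fixes a :: real
  shows "falling (Suc m) c * pochhammer a (Suc m - c)
       = (a + real m - real c) * (falling m c * pochhammer a (m - c))
         + real c * (falling m (c - 1) * pochhammer a (m - (c - 1)))"
proof (cases c)
  case 0
  then show ?thesis by (simp add: falling_def pochhammer_Suc)
next
  case (Suc d)
  show ?thesis
  proof (cases "c \<le> m")
    case True
    have "m - d = Suc (m - c)" using True Suc by simp
    then have "pochhammer a (m - d) = (a + real m - real c) * pochhammer a (m - c)"
      using True by (simp add: pochhammer_Suc of_nat_diff algebra_simps)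
    moreover have "Suc m - c = m - d" using Suc by simp
    ultimately show ?thesis using Suc
      by (simp add: falling_Suc del: of_nat_Suc) (simp only: ring_distribs mult_ac)
  next
    case False
    then have "falling m (Suc d) = 0" "m - d = 0" using Suc by (simp_all add: falling_def binomial_eq_0)
    then show ?thesis using Suc by (simp add: falling_Suc del: of_nat_Suc)
  qed
qed

lemma block_weight_Suc: "1 \<le> k \<Longrightarrow> (real k - \<alpha>) * block_weight \<alpha> k = real (Suc k) * block_weight \<alpha> (Suc k)"
proof (cases k)
  case (Suc d)
  have "real k - \<alpha> = 1 - \<alpha> + real d" using Suc by simp
  moreover have "(fact (Suc k) :: real) = real (Suc k) * fact k" by (rule fact_Suc)
  moreover have "real (Suc k) \<noteq> 0" by simp
  ultimately show ?thesis
    using Suc by (simp add: block_weight_def pochhammer_Suc del: fact_Suc of_nat_Suc)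
qed simp

lemma transition_add: "transition \<alpha> \<theta> (\<lambda>c. f c + g c) = (\<lambda>c. transition \<alpha> \<theta> f c + transition \<alpha> \<theta> g c)"
  by (auto simp: transition_def ring_distribs sum.distrib add_divide_distrib)

lemma transition_scale: "transition \<alpha> \<theta> (\<lambda>c. a * f c) = (\<lambda>c. a * transition \<alpha> \<theta> f c)"
  by (auto simp: transition_def ring_distribs sum_distrib_left mult_ac)

lemma funpow_transition_add:
  "(transition \<alpha> \<theta> ^^ m) (\<lambda>c. f c + g c) = (\<lambda>c. (transition \<alpha> \<theta> ^^ m) f c + (transition \<alpha> \<theta> ^^ m) g c)"
  by (induction m) (simp_all add: transition_add)

lemma funpow_transition_scale: "(transition \<alpha> \<theta> ^^ m) (\<lambda>c. a * f c) = (\<lambda>c. a * (transition \<alpha> \<theta> ^^ m) f c)"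
  by (induction m) (simp_all add: transition_scale)

lemma funpow_transition_sum:
  assumes "finite I"
  shows "(transition \<alpha> \<theta> ^^ m) (\<lambda>c. \<Sum>i\<in>I. f i c) = (\<lambda>c. \<Sum>i\<in>I. (transition \<alpha> \<theta> ^^ m) (f i) c)"
  using assms
proof (induction I rule: finite_induct)
  case empty
  then show ?case using funpow_transition_scale[of m \<alpha> \<theta> 0 "\<lambda>_. 0"] by simp
next
  case (insert i I)
  then show ?case by (simp add: funpow_transition_add)
qed

text \<open>The lists that can be reached from \<open>c\<close> in \<open>m\<close> transitions satisfy this condition; it guarantees that
  the entry appended for a new type is indeed new.\<close>
definition extends :: "nat list \<Rightarrow> nat \<Rightarrow> nat list \<Rightarrow> bool" where
  "extends c m c' \<longleftrightarrow> set c' \<subseteq> {..<length c'} \<and> length c' = length c + m \<and> take (length c) c' = c"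

lemma funpow_transition_cong:
  assumes "\<And>c'. extends c m c' \<Longrightarrow> g c' = h c'" and "set c \<subseteq> {..<length c}"
  shows "(transition \<alpha> \<theta> ^^ m) g c = (transition \<alpha> \<theta> ^^ m) h c"
  using assms
proof (induction m arbitrary: c)
  case 0
  then show ?case by (simp add: extends_def)
next
  case (Suc m)
  have "(transition \<alpha> \<theta> ^^ m) g (c @ [i]) = (transition \<alpha> \<theta> ^^ m) h (c @ [i])" if i: "i \<le> length c" for i
  proof (rule Suc.IH)
    show "set (c @ [i]) \<subseteq> {..<length (c @ [i])}" using i Suc.prems(2) by auto
    fix c' assume "extends (c @ [i]) m c'"
    then have c': "set c' \<subseteq> {..<length c'}" "length c' = length c + Suc m" "take (Suc (length c)) c' = c @ [i]"
      by (auto simp: extends_def)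
    have "take (length c) c' = take (length c) (take (Suc (length c)) c')" by simp
    also have "\<dots> = c" by (simp add: c'(3))
    finally show "g c' = h c'" using c' Suc.prems(1) by (simp add: extends_def)
  qed
  moreover have "i \<le> length c" if "i \<in> set c" for i using that Suc.prems(2) by auto
  ultimately show ?case
    by (simp add: transition_def[of _ _ "(transition \<alpha> \<theta> ^^ m) g"] transition_def[of _ _ "(transition \<alpha> \<theta> ^^ m) h"] cong: sum.cong)
qed

text \<open>The closed form satisfies the recursion of \<open>transition_moment_fun\<close>: by \<open>block_weight_Suc\<close>, decreasing
  the frequency of a mark \<open>s\<close> by one, or removing it if its frequency is one, multiplies the product
  of weights so that each \<open>s\<close> contributes \<open>k s\<close> times the same term.\<close>
lemma moment_Suc:
  assumes \<alpha>: "0 < \<alpha>" and B: "0 < B" and S: "finite S" and k: "\<forall>s\<in>S. 1 \<le> k s"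
  shows "moment \<alpha> x B S k q (Suc m) * (B + real m)
     = (B + real m + \<alpha> * real (card S + q) - real (sum k S)) * moment \<alpha> x B S k q m
       + (\<Sum>s\<in>S. if k s = 1 then \<alpha> * moment \<alpha> x B (S - {s}) k (Suc q) m
                  else (real (k s) - 1 - \<alpha>) * moment \<alpha> x B S (k(s := k s - 1)) q m)"
proof -
  let ?W = "\<Prod>s\<in>S. block_weight \<alpha> (k s)" and ?P = "pochhammer x (card S + q)"
  let ?a = "B + \<alpha> * real (card S + q)" and ?c = "sum k S"
  have [simp]: "pochhammer B m \<noteq> 0" using B by (simp add: pochhammer_pos less_imp_neq[symmetric])
  have one: "(if k s = 1 then \<alpha> * moment \<alpha> x B (S - {s}) k (Suc q) m
                  else (real (k s) - 1 - \<alpha>) * moment \<alpha> x B S (k(s := k s - 1)) q m)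
     = real (k s) * (?W * ?P * falling m (?c - 1) * pochhammer ?a (m - (?c - 1)) / pochhammer B m)"
    if s: "s \<in> S" for s
  proof (cases "k s = 1")
    case True
    have "card S = Suc (card (S - {s}))" using s S by (metis card.remove)
    moreover have "?c = k s + sum k (S - {s})" "?W = block_weight \<alpha> (k s) * (\<Prod>s\<in>S - {s}. block_weight \<alpha> (k s))"
      using s S by (auto simp: sum.remove prod.remove)
    ultimately show ?thesis using True by (simp add: moment_def block_weight_def)
  next
    case False
    then obtain d where d: "k s = Suc d" "1 \<le> d" using k s by (cases "k s") force+
    have W1: "?W = block_weight \<alpha> (k s) * (\<Prod>s\<in>S - {s}. block_weight \<alpha> (k s))"
      using s S by (simp add: prod.remove)
    have W2: "(\<Prod>s'\<in>S. block_weight \<alpha> ((k(s := k s - 1)) s')) = block_weight \<alpha> d * (\<Prod>s\<in>S - {s}. block_weight \<alpha> (k s))"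
      using s S d by (subst prod.remove[OF S s]) (simp cong: prod.cong_simp)
    have C1: "?c = k s + sum k (S - {s})" using s S by (simp add: sum.remove)
    have "sum (k(s := k s - 1)) S = d + sum k (S - {s})"
      using s S d by (subst sum.remove[OF S s]) (simp cong: sum.cong_simp)
    then have C2: "sum (k(s := k s - 1)) S = ?c - 1" using C1 d by simp
    have "(real d - \<alpha>) * block_weight \<alpha> d = real (Suc d) * block_weight \<alpha> (Suc d)"
      by (rule block_weight_Suc[OF d(2)])
    then have "(real (k s) - 1 - \<alpha>) * (\<Prod>s'\<in>S. block_weight \<alpha> ((k(s := k s - 1)) s')) = real (k s) * ?W"
      unfolding W1 W2 using d by (simp flip: mult.assoc)
    then show ?thesis using False unfolding moment_def C2 by (simp add: divide_simps)
  qed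
  have "(\<Sum>s\<in>S. if k s = 1 then \<alpha> * moment \<alpha> x B (S - {s}) k (Suc q) m
                  else (real (k s) - 1 - \<alpha>) * moment \<alpha> x B S (k(s := k s - 1)) q m)
     = real ?c * (?W * ?P * falling m (?c - 1) * pochhammer ?a (m - (?c - 1)) / pochhammer B m)"
    unfolding of_nat_sum sum_distrib_right by (rule sum.cong[OF refl one])
  moreover have "moment \<alpha> x B S k q (Suc m) * (B + real m)
     = ?W * ?P * (falling (Suc m) ?c * pochhammer ?a (Suc m - ?c)) / pochhammer B m"
    using B by (simp add: moment_def pochhammer_Suc)
  ultimately show ?thesis unfolding falling_pochhammer_Suc by (simp add: moment_def field_simps)
qed

text \<open>Induction on the number of draws with the last transition split off, simultaneously for all
  \<open>S\<close>, \<open>k\<close> and \<open>q\<close>, because the recursion changes all three.\<close>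
theorem expectation_moment_fun:
  assumes \<alpha>: "0 < \<alpha>" and \<theta>: "\<theta> + real (length c) > 0" and c: "set c \<subseteq> {..<length c}"
    and S: "finite S" and k: "\<forall>s\<in>S. 1 \<le> k s"
  shows "(transition \<alpha> \<theta> ^^ m) (moment_fun \<alpha> \<theta> (set c) S k q) c
       = moment \<alpha> (real (num_types c) + \<theta> / \<alpha>) (\<theta> + real (length c)) S k q m"
  using S k
proof (induction m arbitrary: S k q)
  case 0
  show ?case
  proof (cases "S = {}")
    case True
    then show ?thesis by (simp add: moment_fun_def moment_def placements_def falling_def)
  next
    case False
    then have "placements (set c) S k c = {}" by (auto simp: placements_def PiE_iff)
    moreover have "sum k S > 0" using 0 False by (metis (no_types, lifting) One_nat_def Suc_le_lessD bot_nat_0.not_eq_extremum not_one_le_zero sum_eq_0_iff all_not_in_conv)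
    ultimately show ?thesis by (simp add: moment_fun_def moment_def falling_def binomial_eq_0)
  qed
next
  case (Suc m)
  let ?x = "real (num_types c) + \<theta> / \<alpha>" and ?B = "\<theta> + real (length c)"
  let ?M = "\<lambda>S k q. moment_fun \<alpha> \<theta> (set c) S k q"
  define D where "D = ?B + real m"
  define a where "a = (D + \<alpha> * real (card S + q) - real (sum k S)) / D"
  define G where "G = (\<lambda>s c'. if k s = 1 then \<alpha> / D * ?M (S - {s}) k (Suc q) c'
                  else (real (k s) - 1 - \<alpha>) / D * ?M S (k(s := k s - 1)) q c')"
  have D: "D > 0" using \<theta> by (simp add: D_def)
  have "(transition \<alpha> \<theta> ^^ Suc m) (?M S k q) c = (transition \<alpha> \<theta> ^^ m) (transition \<alpha> \<theta> (?M S k q)) c"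
    by (simp add: funpow_swap1)
  also have "\<dots> = (transition \<alpha> \<theta> ^^ m) (\<lambda>c'. a * ?M S k q c' + (\<Sum>s\<in>S. G s c')) c"
  proof (rule funpow_transition_cong[OF _ c])
    fix c' assume c': "extends c m c'"
    have len: "\<theta> + real (length c') = D" using c' by (simp add: extends_def D_def)
    have "set c \<subseteq> set c'" using c' set_take_subset[of "length c" c'] by (simp add: extends_def)
    then have "transition \<alpha> \<theta> (?M S k q) c' * D
     = (D + \<alpha> * real (card S + q) - real (sum k S)) * ?M S k q c'
       + (\<Sum>s\<in>S. if k s = 1 then \<alpha> * ?M (S - {s}) k (Suc q) c'
                  else (real (k s) - 1 - \<alpha>) * ?M S (k(s := k s - 1)) q c')"
      using transition_moment_fun[of \<alpha> \<theta> c' S k "set c" q] \<alpha> D Suc.prems c' unfolding len extends_def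
      by blast
    also have "(\<Sum>s\<in>S. if k s = 1 then \<alpha> * ?M (S - {s}) k (Suc q) c'
                  else (real (k s) - 1 - \<alpha>) * ?M S (k(s := k s - 1)) q c') = D * (\<Sum>s\<in>S. G s c')"
      unfolding sum_distrib_left using D by (intro sum.cong) (auto simp: G_def)
    finally have step_D: "transition \<alpha> \<theta> (?M S k q) c' * D
      = (D + \<alpha> * real (card S + q) - real (sum k S)) * ?M S k q c' + D * (\<Sum>s\<in>S. G s c')" .
    have "D + \<alpha> * real (card S + q) - real (sum k S) = D * a" using D by (simp add: a_def)
    then have "transition \<alpha> \<theta> (?M S k q) c' * D = (a * ?M S k q c' + (\<Sum>s\<in>S. G s c')) * D"
      unfolding step_D by (simp only: ring_distribs mult_ac)
    then show "transition \<alpha> \<theta> (?M S k q) c' = a * ?M S k q c' + (\<Sum>s\<in>S. G s c')"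
      using D by (metis mult_cancel_right less_imp_neq)
  qed
  also have "\<dots> = a * (transition \<alpha> \<theta> ^^ m) (?M S k q) c + (\<Sum>s\<in>S. (transition \<alpha> \<theta> ^^ m) (G s) c)"
    by (simp add: funpow_transition_add funpow_transition_scale funpow_transition_sum Suc.prems)
  also have "(\<Sum>s\<in>S. (transition \<alpha> \<theta> ^^ m) (G s) c)
     = (\<Sum>s\<in>S. (if k s = 1 then \<alpha> * moment \<alpha> ?x ?B (S - {s}) k (Suc q) m
                  else (real (k s) - 1 - \<alpha>) * moment \<alpha> ?x ?B S (k(s := k s - 1)) q m) / D)"
  proof (rule sum.cong[OF refl])
    fix s assume s: "s \<in> S"
    show "(transition \<alpha> \<theta> ^^ m) (G s) c = (if k s = 1 then \<alpha> * moment \<alpha> ?x ?B (S - {s}) k (Suc q) m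
                  else (real (k s) - 1 - \<alpha>) * moment \<alpha> ?x ?B S (k(s := k s - 1)) q m) / D"
    proof (cases "k s = 1")
      case True
      then have "G s = (\<lambda>c'. \<alpha> / D * ?M (S - {s}) k (Suc q) c')" by (simp add: G_def)
      then have "(transition \<alpha> \<theta> ^^ m) (G s) c = \<alpha> / D * (transition \<alpha> \<theta> ^^ m) (?M (S - {s}) k (Suc q)) c"
        by (simp only: funpow_transition_scale)
      then show ?thesis using Suc.IH[of "S - {s}" k "Suc q"] Suc.prems True by simp
    next
      case False
      moreover have "\<forall>s'\<in>S. 1 \<le> (k(s := k s - 1)) s'" using Suc.prems False s by force
      moreover have "G s = (\<lambda>c'. (real (k s) - 1 - \<alpha>) / D * ?M S (k(s := k s - 1)) q c')"
        using False by (simp add: G_def)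
      then have "(transition \<alpha> \<theta> ^^ m) (G s) c
          = (real (k s) - 1 - \<alpha>) / D * (transition \<alpha> \<theta> ^^ m) (?M S (k(s := k s - 1)) q) c"
        by (simp only: funpow_transition_scale)
      ultimately show ?thesis using Suc.IH[of S "k(s := k s - 1)" q] Suc.prems by (simp del: fun_upd_apply)
    qed
  qed
  also have "a * (transition \<alpha> \<theta> ^^ m) (?M S k q) c = a * moment \<alpha> ?x ?B S k q m"
    using Suc by simp
  finally have step_eq: "(transition \<alpha> \<theta> ^^ Suc m) (?M S k q) c = a * moment \<alpha> ?x ?B S k q m
     + (\<Sum>s\<in>S. (if k s = 1 then \<alpha> * moment \<alpha> ?x ?B (S - {s}) k (Suc q) m
                  else (real (k s) - 1 - \<alpha>) * moment \<alpha> ?x ?B S (k(s := k s - 1)) q m) / D)" .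
  have "moment \<alpha> ?x ?B S k q (Suc m) * D = D * a * moment \<alpha> ?x ?B S k q m
     + (\<Sum>s\<in>S. if k s = 1 then \<alpha> * moment \<alpha> ?x ?B (S - {s}) k (Suc q) m
                  else (real (k s) - 1 - \<alpha>) * moment \<alpha> ?x ?B S (k(s := k s - 1)) q m)"
    using moment_Suc[OF \<alpha> \<theta> Suc.prems, of ?x q m] D by (simp only: D_def[symmetric]) (simp add: a_def)
  also have "\<dots> = (transition \<alpha> \<theta> ^^ Suc m) (?M S k q) c * D"
    unfolding step_eq sum_divide_distrib[symmetric] using D by (simp add: distrib_right)
  finally show ?case using D by (metis mult_cancel_right less_imp_neq)
qed

section \<open>Samples and their codes\<close>

text \<open>The index of the first occurrence, and \<open>length xs\<close> if there is none; the latter makes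
  \<open>code_snoc\<close> uniform in old and new values.\<close>
definition pos :: "'a list \<Rightarrow> 'a \<Rightarrow> nat" where
  "pos xs x = length (takeWhile (\<lambda>z. z \<noteq> x) xs)"

text \<open>Two samples have the same code iff they have the same coincidences. All statistics of the model are
  invariant under injective relabelling, hence can be read off the code.\<close>
definition code :: "'a list \<Rightarrow> nat list" where
  "code xs = map (pos xs) xs"

lemma pos_append: "x \<in> set xs \<Longrightarrow> pos (xs @ ys) x = pos xs x"
  by (simp add: pos_def takeWhile_append1)

lemma pos_notin: "x \<notin> set xs \<Longrightarrow> pos xs x = length xs"
proof -
  assume "x \<notin> set xs"
  then have "takeWhile (\<lambda>z. z \<noteq> x) xs = xs" by (auto simp: takeWhile_eq_all_conv)
  then show ?thesis unfolding pos_def by (rule arg_cong)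
qed

lemma pos_less: "x \<in> set xs \<Longrightarrow> pos xs x < length xs"
  by (induction xs) (auto simp: pos_def)

lemma nth_pos: "x \<in> set xs \<Longrightarrow> xs ! pos xs x = x"
  by (induction xs) (auto simp: pos_def)

lemma inj_on_pos: "inj_on (pos xs) (set xs)"
  by (metis inj_onI nth_pos)

lemma pos_eq_iff:
  "pos xs x = i \<longleftrightarrow> i \<le> length xs \<and> (\<forall>k<i. xs ! k \<noteq> x) \<and> (i < length xs \<longrightarrow> xs ! i = x)"
proof (induction xs arbitrary: i)
  case Nil
  then show ?case by (auto simp: pos_def)
next
  case (Cons a xs)
  show ?case
  proof (cases i)
    case 0
    then show ?thesis by (auto simp: pos_def)
  next
    case (Suc j)
    have "pos (a # xs) x = Suc j \<longleftrightarrow> a \<noteq> x \<and> pos xs x = j" by (simp add: pos_def)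
    then show ?thesis unfolding Suc Cons.IH by (auto simp: less_Suc_eq_0_disj)
  qed
qed

lemma length_code [simp]: "length (code xs) = length xs"
  by (simp add: code_def)

lemma set_code: "set (code xs) \<subseteq> {..<length xs}"
  by (auto simp: code_def pos_less)

text \<open>An entry of the code is the first occurrence of its value, so the next draw has this position
  iff it equals the value found there.\<close>
lemma pos_eq_code_iff:
  assumes "j \<in> set (code xs)"
  shows "pos xs y = j \<longleftrightarrow> xs ! j = y"
proof -
  obtain x where x: "x \<in> set xs" "j = pos xs x" using assms unfolding code_def by auto
  have "y \<in> set xs" if "pos xs y = j" using that pos_notin[of y xs] pos_less[OF x(1)] x(2) by auto
  then show ?thesis using nth_pos[OF x(1)] nth_pos[of y xs] x(2) by metis
qed

lemma code_snoc: "code (xs @ [y]) = code xs @ [pos xs y]"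
proof -
  have "pos (xs @ [y]) y = pos xs y"
  proof (cases "y \<in> set xs")
    case False
    then have "takeWhile (\<lambda>z. z \<noteq> y) (xs @ [y]) = xs" by (subst takeWhile_append2) auto
    then show ?thesis using False by (simp add: pos_notin) (simp add: pos_def)
  qed (simp add: pos_append)
  then show ?thesis by (simp add: code_def pos_append cong: map_cong)
qed

lemma num_types_map: "inj_on f (set xs) \<Longrightarrow> num_types (map f xs) = num_types xs"
  by (simp add: num_types_def card_image)

lemma remdups_map_inj: "inj_on f (set xs) \<Longrightarrow> remdups (map f xs) = map f (remdups xs)"
  by (induction xs) (auto simp: inj_on_def)

lemma types_map: "inj_on f (set xs) \<Longrightarrow> types (map f xs) = map f (types xs)"
  using remdups_map_inj[of f "rev xs"] by (simp add: types_def rev_map)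

lemma set_types [simp]: "set (types xs) = set xs"
  by (simp add: types_def)

lemma distinct_types: "distinct (types xs)"
  by (simp add: types_def)

lemma length_types: "length (types xs) = num_types xs"
  by (simp add: num_types_def flip: distinct_card[OF distinct_types])

lemma freqs_map: "inj_on f (set xs) \<Longrightarrow> freqs (map f xs) = freqs xs"
  by (simp add: freqs_def types_map count_list_inj_map)

lemma num_new_types_map:
  assumes "inj_on f (set xs \<union> set ys)"
  shows "num_new_types (map f xs) (map f ys) = num_new_types xs ys"
proof -
  have "f ` set ys - f ` set xs = f ` (set ys - set xs)"
    using assms by (auto simp: inj_on_def)
  then show ?thesis using assms by (simp add: num_new_types_def card_image inj_on_diff inj_on_Un inj_on_subset)
qed

lemma num_new_freq_map:
  assumes "inj_on f (set xs \<union> set ys)"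
  shows "num_new_freq l (map f xs) (map f ys) = num_new_freq l xs ys"
proof -
  have c: "count_list (map f ys) (f y) = count_list ys y" if "y \<in> set ys" for y
    using assms that by (intro count_list_inj_map) (auto intro: inj_on_subset)
  have "{y \<in> f ` set ys - f ` set xs. count_list (map f ys) y = l} = f ` {y \<in> set ys - set xs. count_list ys y = l}"
  proof (intro equalityI subsetI)
    fix z assume "z \<in> {y \<in> f ` set ys - f ` set xs. count_list (map f ys) y = l}"
    then show "z \<in> f ` {y \<in> set ys - set xs. count_list ys y = l}" using c by auto
  next
    fix z assume "z \<in> f ` {y \<in> set ys - set xs. count_list ys y = l}"
    then obtain y where y: "z = f y" "y \<in> set ys" "y \<notin> set xs" "count_list ys y = l" by auto
    have "f y \<notin> f ` set xs" using y assms by (auto simp: inj_on_def)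
    then show "z \<in> {y \<in> f ` set ys - f ` set xs. count_list (map f ys) y = l}" using c y by auto
  qed
  then show ?thesis
    using assms by (simp add: num_new_freq_def card_image inj_on_subset[OF assms])
       (subst card_image, auto intro: inj_on_subset[OF assms])
qed

lemma num_types_code: "num_types (code xs) = num_types xs"
  unfolding code_def by (rule num_types_map[OF inj_on_pos])

lemma freqs_code: "freqs (code xs) = freqs xs"
  unfolding code_def by (rule freqs_map[OF inj_on_pos])

lemma num_new_types_code:
  assumes "length xs = n"
  shows "num_new_types (take n (code (xs @ ys))) (drop n (code (xs @ ys))) = num_new_types xs ys"
proof -
  have "take n (code (xs @ ys)) = map (pos (xs @ ys)) xs" "drop n (code (xs @ ys)) = map (pos (xs @ ys)) ys"
    using assms by (simp_all add: code_def)
  then show ?thesis using num_new_types_map[of "pos (xs @ ys)" xs ys] inj_on_pos[of "xs @ ys"] by simp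
qed

lemma num_new_freq_code:
  assumes "length xs = n"
  shows "num_new_freq l (take n (code (xs @ ys))) (drop n (code (xs @ ys))) = num_new_freq l xs ys"
proof -
  have "take n (code (xs @ ys)) = map (pos (xs @ ys)) xs" "drop n (code (xs @ ys)) = map (pos (xs @ ys)) ys"
    using assms by (simp_all add: code_def)
  then show ?thesis using num_new_freq_map[of "pos (xs @ ys)" xs ys] inj_on_pos[of "xs @ ys"] by simp
qed

lemma num_types_new: "num_types (xs @ ys) = num_types xs + num_new_types xs ys"
proof -
  have "set (xs @ ys) = set xs \<union> (set ys - set xs)" by auto
  then show ?thesis unfolding num_types_def num_new_types_def by (simp only:) (rule card_Un_disjoint, auto)
qed

lemma length_sample [simp]: "length (sample X n \<omega>) = n"
  by (simp add: sample_def)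

lemma nth_sample: "i < n \<Longrightarrow> sample X n \<omega> ! i = X (Suc i) \<omega>"
  unfolding sample_def by (subst nth_map) (auto simp del: upt_Suc)

lemma sample_Suc: "sample X (Suc n) \<omega> = sample X n \<omega> @ [X (Suc n) \<omega>]"
  by (simp add: sample_def)

lemma sample_add: "sample X (n + m) \<omega> = sample X n \<omega> @ add_sample X n m \<omega>"
proof -
  have "[1..<n + m + 1] = [1..<n + 1] @ [n + 1..<n + m + 1]"
    using upt_add_eq_append[of 1 "n + 1" m] by simp
  then show ?thesis by (simp add: sample_def add_sample_def)
qed

lemma measurable_code_event:
  fixes X :: "nat \<Rightarrow> 'w \<Rightarrow> 'a::polish_space"
  assumes X: "\<And>i. i \<in> {1..N} \<Longrightarrow> X i \<in> borel_measurable F"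
  shows "{\<omega> \<in> space F. code (sample X N \<omega>) = c} \<in> sets F"
  using X
proof (induction N arbitrary: c)
  case 0
  have "sample X 0 \<omega> = []" for \<omega> by (simp add: sample_def)
  then have "{\<omega> \<in> space F. code (sample X 0 \<omega>) = c} = (if c = [] then space F else {})"
    by (auto simp: code_def)
  then show ?case by simp
next
  case (Suc N)
  show ?case
  proof (cases c rule: rev_cases)
    case Nil
    have "code (sample X (Suc N) \<omega>) \<noteq> c" for \<omega>
      using Nil by (metis length_0_conv length_code length_sample nat.distinct(1))
    then show ?thesis by simp
  next
    case (snoc c' i)
    have eq [measurable]: "{\<omega> \<in> space F. X a \<omega> = X b \<omega>} \<in> sets F" if "a \<in> {1..Suc N}" "b \<in> {1..Suc N}" for a b
      using Suc.prems that by (intro measurable_equality_set) auto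
    have "{\<omega> \<in> space F. code (sample X (Suc N) \<omega>) = c}
      = {\<omega> \<in> space F. code (sample X N \<omega>) = c'} \<inter> {\<omega> \<in> space F. i \<le> N \<and> (\<forall>k<i. X (Suc k) \<omega> \<noteq> X (Suc N) \<omega>)
          \<and> (i < N \<longrightarrow> X (Suc i) \<omega> = X (Suc N) \<omega>)}"
      unfolding snoc by (auto simp: sample_Suc code_snoc pos_eq_iff nth_sample)
    moreover have "{\<omega> \<in> space F. code (sample X N \<omega>) = c'} \<in> sets F"
      using Suc by auto
    moreover have "{\<omega> \<in> space F. i \<le> N \<and> (\<forall>k<i. X (Suc k) \<omega> \<noteq> X (Suc N) \<omega>)
          \<and> (i < N \<longrightarrow> X (Suc i) \<omega> = X (Suc N) \<omega>)} \<in> sets F"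
    proof (cases "i \<le> N")
      case True
      have "{\<omega> \<in> space F. \<forall>k\<in>{..<i}. X (Suc k) \<omega> \<noteq> X (Suc N) \<omega>} \<in> sets F"
        using True by (intro sets.sets_Collect_finite_All sets.sets_Collect_neg eq) auto
      moreover have "{\<omega> \<in> space F. i < N \<longrightarrow> X (Suc i) \<omega> = X (Suc N) \<omega>} \<in> sets F"
        using eq[of "Suc i" "Suc N"] by (cases "i < N") auto
      ultimately have "{\<omega> \<in> space F. \<forall>k\<in>{..<i}. X (Suc k) \<omega> \<noteq> X (Suc N) \<omega>}
          \<inter> {\<omega> \<in> space F. i < N \<longrightarrow> X (Suc i) \<omega> = X (Suc N) \<omega>} \<in> sets F" by (rule sets.Int)
      then show ?thesis using True by (simp add: Int_def Ball_def conj_ac)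
    qed simp
    ultimately show ?thesis by (simp add: sets.Int)
  qed
qed

section \<open>The Markov chain of codes\<close>

text \<open>A Dynkin argument. The weights may be negative, which rules out treating the right-hand side as a
  measure.\<close>
lemma measure_eq_combination:
  fixes w :: "'i \<Rightarrow> real"
  assumes I: "finite I" and \<mu>: "finite_measure \<mu>" "sets \<mu> = sets (M1 \<Otimes>\<^sub>M M2)"
    and \<kappa>: "\<And>i. i \<in> I \<Longrightarrow> finite_measure (\<kappa> i)" "\<And>i. i \<in> I \<Longrightarrow> sets (\<kappa> i) = sets (M1 \<Otimes>\<^sub>M M2)"
    and rect: "\<And>A B. A \<in> sets M1 \<Longrightarrow> B \<in> sets M2 \<Longrightarrow> measure \<mu> (A \<times> B) = (\<Sum>i\<in>I. w i * measure (\<kappa> i) (A \<times> B))"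
    and C: "C \<in> sets (M1 \<Otimes>\<^sub>M M2)"
  shows "measure \<mu> C = (\<Sum>i\<in>I. w i * measure (\<kappa> i) C)"
proof -
  let ?G = "{a \<times> b | a b. a \<in> sets M1 \<and> b \<in> sets M2}" and ?\<Omega> = "space M1 \<times> space M2"
  have sets_eq: "sets (M1 \<Otimes>\<^sub>M M2) = sigma_sets ?\<Omega> ?G" by (rule sets_pair_measure)
  have sp: "space \<mu> = ?\<Omega>" using sets_eq_imp_space_eq[OF \<mu>(2)] by (simp add: space_pair_measure)
  have sp': "space (\<kappa> i) = ?\<Omega>" if "i \<in> I" for i
    using sets_eq_imp_space_eq[OF \<kappa>(2)[OF that]] by (simp add: space_pair_measure)
  have total: "measure \<mu> ?\<Omega> = (\<Sum>i\<in>I. w i * measure (\<kappa> i) ?\<Omega>)"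
    using rect by blast
  show ?thesis
  proof (rule sigma_sets_induct_disjoint[OF Int_stable_pair_measure_generator[of M1 M2] pair_measure_closed])
    show "C \<in> sigma_sets ?\<Omega> ?G" using C sets_eq by simp
  next
    fix A assume "A \<in> ?G"
    then show "measure \<mu> A = (\<Sum>i\<in>I. w i * measure (\<kappa> i) A)" using rect by auto
  next
    show "measure \<mu> {} = (\<Sum>i\<in>I. w i * measure (\<kappa> i) {})" by simp
  next
    fix A assume A: "A \<in> sigma_sets ?\<Omega> ?G" and eq: "measure \<mu> A = (\<Sum>i\<in>I. w i * measure (\<kappa> i) A)"
    have "measure \<mu> (?\<Omega> - A) = measure \<mu> ?\<Omega> - measure \<mu> A"
      using finite_measure.finite_measure_compl[OF \<mu>(1), of A] A \<mu>(2) sets_eq sp by simp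
    moreover have "measure (\<kappa> i) (?\<Omega> - A) = measure (\<kappa> i) ?\<Omega> - measure (\<kappa> i) A" if "i \<in> I" for i
      using finite_measure.finite_measure_compl[OF \<kappa>(1)[OF that], of A] A \<kappa>(2)[OF that] sets_eq sp'[OF that] by simp
    ultimately show "measure \<mu> (?\<Omega> - A) = (\<Sum>i\<in>I. w i * measure (\<kappa> i) (?\<Omega> - A))"
      by (simp add: total eq right_diff_distrib sum_subtractf cong: sum.cong)
  next
    fix A :: "nat \<Rightarrow> _" assume A: "disjoint_family A" "range A \<subseteq> sigma_sets ?\<Omega> ?G"
      "\<And>n. measure \<mu> (A n) = (\<Sum>i\<in>I. w i * measure (\<kappa> i) (A n))"
    have "(\<lambda>n. measure \<mu> (A n)) sums measure \<mu> (\<Union>n. A n)"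
      using A \<mu>(2) sets_eq by (intro finite_measure.finite_measure_UNION[OF \<mu>(1)]) auto
    moreover have "(\<lambda>n. \<Sum>i\<in>I. w i * measure (\<kappa> i) (A n)) sums (\<Sum>i\<in>I. w i * measure (\<kappa> i) (\<Union>n. A n))"
      using A \<kappa> sets_eq by (intro sums_sum sums_mult finite_measure.finite_measure_UNION) auto
    ultimately show "measure \<mu> (\<Union>n. A n) = (\<Sum>i\<in>I. w i * measure (\<kappa> i) (\<Union>n. A n))"
      unfolding A(3) using sums_unique2 by blast
  qed
qed

lemma (in finite_measure) integrable_finite_range:
  fixes f :: "'a \<Rightarrow> real"
  assumes "f \<in> borel_measurable M" "finite (range f)"
  shows "integrable M f"
proof (rule integrable_const_bound[where B = "Max (range (\<lambda>x. \<bar>f x\<bar>))"])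
  have "finite (range (\<lambda>x. \<bar>f x\<bar>))" using finite_imageI[OF assms(2), of abs] by (simp add: image_image)
  then show "AE x in M. norm (f x) \<le> Max (range (\<lambda>x. \<bar>f x\<bar>))" by (intro AE_I2) (simp add: Max_ge)
qed (rule assms(1))

locale ewens_pitman_model =
  fixes \<alpha> \<theta> :: real and \<nu> :: "'a::polish_space measure" and M :: "'w measure" and X :: "nat \<Rightarrow> 'w \<Rightarrow> 'a"
  assumes \<alpha>: "0 < \<alpha>" "\<alpha> < 1" and \<theta>: "\<theta> > - \<alpha>" and model: "ewens_pitman \<alpha> \<theta> \<nu> M X"
begin

sublocale prob_space M using model by (simp add: ewens_pitman_def)

sublocale nu: prob_space \<nu> using model by (simp add: ewens_pitman_def)

lemma sets_nu: "sets \<nu> = sets borel" and diffuse: "measure \<nu> {x} = 0"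
  using model by (simp_all add: ewens_pitman_def)

lemma X_measurable: "1 \<le> i \<Longrightarrow> X i \<in> borel_measurable M"
  using model by (simp add: ewens_pitman_def)

lemma past_component: "i \<in> {1..n} \<Longrightarrow> X i \<in> borel_measurable (past M X n)"
proof -
  assume i: "i \<in> {1..n}"
  have "(\<lambda>\<omega>. \<lambda>i\<in>{1..n}. X i \<omega>) \<in> measurable (past M X n) (\<Pi>\<^sub>M i\<in>{1..n}. borel)"
    unfolding past_def by (intro measurable_vimage_algebra1) (auto simp: space_PiM)
  then have "(\<lambda>\<omega>. (\<lambda>i\<in>{1..n}. X i \<omega>) i) \<in> borel_measurable (past M X n)"
    using i by (rule measurable_compose[OF _ measurable_component_singleton])
  then show ?thesis using i by (simp add: restrict_def)
qed

lemma subalgebra_past: "subalgebra M (past M X n)"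
  unfolding subalgebra_def
proof
  show "space (past M X n) = space M" by (simp add: past_def)
  have "(\<lambda>\<omega>. \<lambda>i\<in>{1..n}. X i \<omega>) \<in> measurable M (\<Pi>\<^sub>M i\<in>{1..n}. borel)"
    by (intro measurable_restrict X_measurable) auto
  then show "sets (past M X n) \<subseteq> sets M"
    unfolding past_def by (rule sets_image_in_sets[OF refl])
qed

definition code_event :: "nat list \<Rightarrow> 'w set" where
  "code_event c = {\<omega> \<in> space M. code (sample X (length c) \<omega>) = c}"

lemma code_event_in_past: "code_event c \<in> sets (past M X (length c))"
  using measurable_code_event[of "length c" X "past M X (length c)" c] past_component
  subalgebra_past[of "length c"] by (simp add: code_event_def subalgebra_def)

lemma code_event_in_events: "code_event c \<in> events"
  using code_event_in_past subalgebra_past by (auto simp: subalgebra_def)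

lemma sum_over_types:
  fixes h :: "nat \<Rightarrow> 'a \<Rightarrow> real"
  assumes "code xs = c"
  shows "(\<Sum>r<num_types xs. h (freqs xs ! r) (types xs ! r)) = (\<Sum>i\<in>set c. h (count_list c i) (xs ! i))"
proof -
  have "(\<Sum>r<num_types xs. h (freqs xs ! r) (types xs ! r)) = (\<Sum>r<length (types xs). h (count_list xs (types xs ! r)) (types xs ! r))"
    by (rule sum.cong) (auto simp: length_types freqs_def)
  also have "\<dots> = (\<Sum>x\<in>set (types xs). h (count_list xs x) x)"
    using sum.reindex_bij_betw[OF bij_betw_nth[OF distinct_types refl refl], of "\<lambda>x. h (count_list xs x) x" xs]
    by (simp add: lessThan_atLeast0)
  also have "\<dots> = (\<Sum>x\<in>set xs. h (count_list xs x) x)" by simp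
  also have "\<dots> = (\<Sum>x\<in>set xs. h (count_list c (pos xs x)) (xs ! pos xs x))"
    using assms by (intro sum.cong) (auto simp: code_def nth_pos count_list_inj_map[OF inj_on_pos])
  also have "\<dots> = (\<Sum>i\<in>pos xs ` set xs. h (count_list c i) (xs ! i))"
    by (simp add: sum.reindex[OF inj_on_pos])
  also have "pos xs ` set xs = set c" using assms by (auto simp: code_def)
  finally show ?thesis .
qed

text \<open>The types of a sample with code \<open>c\<close> are its entries at the positions in \<open>set c\<close>.\<close>
lemma predictive_code:
  assumes "code xs = c"
  shows "predictive \<alpha> \<theta> \<nu> xs A = (\<theta> + \<alpha> * real (num_types c)) / (\<theta> + real (length c)) * measure \<nu> A
    + (\<Sum>i\<in>set c. (real (count_list c i) - \<alpha>) / (\<theta> + real (length c)) * indicator A (xs ! i))"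
proof -
  have "num_types xs = num_types c" "length xs = length c" using assms num_types_code[of xs] by auto
  then show ?thesis
    unfolding predictive_def sum_over_types[OF assms, of "\<lambda>n x. (real n - \<alpha>) * indicator A x"]
    unfolding sum_distrib_left by (intro arg_cong2[where f = "(+)"] sum.cong) (simp_all add: mult.commute)
qed

text \<open>On an event on which the code is constant, the weights of the predictive distribution are
  constants, and the defining conditional expectation integrates to a finite sum.\<close>
lemma past_event:
  assumes c: "1 \<le> length c" "set c \<subseteq> {..<length c}"
    and E: "E \<in> sets (past M X (length c))" "E \<subseteq> code_event c" and A: "A \<in> sets borel"
  shows "prob (E \<inter> (X (Suc (length c)) -` A \<inter> space M))
       = (\<theta> + \<alpha> * real (num_types c)) / (\<theta> + real (length c)) * (prob E * measure \<nu> A)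
         + (\<Sum>i\<in>set c. (real (count_list c i) - \<alpha>) / (\<theta> + real (length c)) * prob (E \<inter> (X (Suc i) -` A \<inter> space M)))"
proof -
  let ?n = "length c" let ?F = "past M X ?n"
  interpret finite_measure_subalgebra M ?F
    by (intro finite_measure_subalgebra.intro finite_measure_axioms finite_measure_subalgebra_axioms.intro subalgebra_past)
  have E': "E \<in> sets M" using E subalgebra_past by (auto simp: subalgebra_def)
  have B: "X (Suc i) -` A \<inter> space M \<in> sets M" for i
    using X_measurable[of "Suc i"] A by (auto intro: measurable_sets)
  let ?B = "X (?n + 1) -` A \<inter> space M"
  let ?a = "(\<theta> + \<alpha> * real (num_types c)) / (\<theta> + real ?n) * measure \<nu> A"
  let ?w = "\<lambda>i. (real (count_list c i) - \<alpha>) / (\<theta> + real ?n)"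
  have int: "integrable M (indicator ?B :: 'w \<Rightarrow> real)" using B[of ?n] by (simp add: integrable_indicator_iff emeasure_eq_measure)
  have "(\<integral>\<omega>\<in>E. indicator ?B \<omega> \<partial>M) = (\<integral>\<omega>. indicator (E \<inter> ?B) \<omega> \<partial>M :: real)"
    unfolding set_lebesgue_integral_def by (intro Bochner_Integration.integral_cong) (auto simp: indicator_def)
  then have "prob (E \<inter> ?B) = (\<integral>\<omega>\<in>E. indicator ?B \<omega> \<partial>M)" using E' B by simp
  also have "\<dots> = (\<integral>\<omega>\<in>E. real_cond_exp M ?F (indicator ?B) \<omega> \<partial>M)"
    by (rule real_cond_exp_intA[OF int E(1)])
  also have "\<dots> = (\<integral>\<omega>. indicator E \<omega> * real_cond_exp M ?F (indicator ?B) \<omega> \<partial>M)"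
    by (simp add: set_lebesgue_integral_def)
  also have "\<dots> = (\<integral>\<omega>. ?a * indicator E \<omega> + (\<Sum>i\<in>set c. ?w i * indicator (E \<inter> (X (Suc i) -` A \<inter> space M)) \<omega>) \<partial>M)"
  proof (rule integral_cong_AE)
    have "AE \<omega> in M. real_cond_exp M ?F (indicator ?B) \<omega> = predictive \<alpha> \<theta> \<nu> (sample X ?n \<omega>) A"
      using model c A by (simp add: ewens_pitman_def)
    then show "AE \<omega> in M. indicator E \<omega> * real_cond_exp M ?F (indicator ?B) \<omega>
      = ?a * indicator E \<omega> + (\<Sum>i\<in>set c. ?w i * indicator (E \<inter> (X (Suc i) -` A \<inter> space M)) \<omega>)"
    proof eventually_elim
      case (elim \<omega>)
      show ?case
      proof (cases "\<omega> \<in> E")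
        case True
        then have \<omega>: "\<omega> \<in> space M" "code (sample X ?n \<omega>) = c" using E by (auto simp: code_event_def)
        have "indicator A (sample X ?n \<omega> ! i) = (indicator (E \<inter> (X (Suc i) -` A \<inter> space M)) \<omega> :: real)"
          if "i \<in> set c" for i
          using that c True \<omega>(1) by (auto simp: nth_sample indicator_def)
        then show ?thesis
          using True unfolding elim predictive_code[OF \<omega>(2)] by (simp cong: sum.cong)
      qed simp
    qed
  qed (use E' B in measurable)
  also have "\<dots> = ?a * prob E + (\<Sum>i\<in>set c. ?w i * prob (E \<inter> (X (Suc i) -` A \<inter> space M)))"
    using E' B by (subst Bochner_Integration.integral_add) (auto simp: emeasure_eq_measure)
  finally show ?thesis by (simp add: mult_ac)
qed

definition restricted :: "'w set \<Rightarrow> 'w measure" where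
  "restricted E = density M (indicator E)"

lemma finite_restricted: "E \<in> events \<Longrightarrow> finite_measure (restricted E)"
  by (rule finite_measureI) (simp add: restricted_def emeasure_density emeasure_eq_measure cong: nn_integral_cong)

lemma measure_restricted: "E \<in> events \<Longrightarrow> S \<in> events \<Longrightarrow> measure (restricted E) S = prob (E \<inter> S)"
  by (simp add: restricted_def measure_def emeasure_density flip: indicator_inter_arith)

text \<open>The predictive distribution speaks of fixed Borel sets, whereas the event that a draw repeats the
  value at position \<open>j\<close> concerns a random point. The law of the pair formed by that value and the next draw is
  therefore identified on rectangles, extended to all measurable sets of the plane, and evaluated on the
  diagonal. There the continuous part has no mass, and the only atom that counts is \<open>j\<close> itself.\<close>
lemma code_event_repeat:
  assumes c: "1 \<le> length c" "set c \<subseteq> {..<length c}" and j: "j \<in> set c"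
  shows "prob (code_event (c @ [j])) = (real (count_list c j) - \<alpha>) / (\<theta> + real (length c)) * prob (code_event c)"
proof -
  let ?n = "length c" and ?E = "code_event c" and ?P = "borel \<Otimes>\<^sub>M borel :: ('a \<times> 'a) measure"
  let ?a = "(\<theta> + \<alpha> * real (num_types c)) / (\<theta> + real ?n)"
  let ?w = "\<lambda>i. (real (count_list c i) - \<alpha>) / (\<theta> + real ?n)"
  (* \<open>None\<close> stands for a fresh draw from \<nu>, \<open>Some i\<close> for a repetition of the value at position i. *)
  define \<kappa> where "\<kappa> = case_option (distr (restricted ?E) borel (X (Suc j)) \<Otimes>\<^sub>M \<nu>)
      (\<lambda>i. distr (restricted ?E) ?P (\<lambda>\<omega>. (X (Suc j) \<omega>, X (Suc i) \<omega>)))"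
  have \<kappa>_None: "\<kappa> None = distr (restricted ?E) borel (X (Suc j)) \<Otimes>\<^sub>M \<nu>"
    and \<kappa>_Some: "\<kappa> (Some i) = distr (restricted ?E) ?P (\<lambda>\<omega>. (X (Suc j) \<omega>, X (Suc i) \<omega>))" for i
    by (simp_all add: \<kappa>_def)
  define w where "w = case_option ?a ?w"
  define I where "I = insert None (Some ` set c)"
  define \<mu> where "\<mu> = distr (restricted ?E) ?P (\<lambda>\<omega>. (X (Suc j) \<omega>, X (Suc ?n) \<omega>))"
  have E: "?E \<in> events" by (rule code_event_in_events)
  have XR: "X (Suc i) \<in> borel_measurable (restricted ?E)" for i
    using X_measurable[of "Suc i"] by (simp add: restricted_def)
  have fR: "finite_measure (restricted ?E)" by (rule finite_restricted[OF E])
  have fX: "finite_measure (distr (restricted ?E) borel (X (Suc j)))"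
    by (rule finite_measure.finite_measure_distr[OF fR XR])
  have pairR: "(\<lambda>\<omega>. (X (Suc j) \<omega>, X (Suc i) \<omega>)) \<in> measurable (restricted ?E) ?P" for i
    using XR by measurable
  have mX: "X (Suc i) -` B \<inter> space M \<in> events" if "B \<in> sets borel" for i B
    using X_measurable[of "Suc i"] that by (auto intro: measurable_sets)
  have mP: "measure (distr (restricted ?E) ?P (\<lambda>\<omega>. (X (Suc j) \<omega>, X (Suc i) \<omega>))) C
      = prob (?E \<inter> {\<omega> \<in> space M. (X (Suc j) \<omega>, X (Suc i) \<omega>) \<in> C})" if "C \<in> sets ?P" for i C
  proof -
    have "(\<lambda>\<omega>. (X (Suc j) \<omega>, X (Suc i) \<omega>)) -` C \<inter> space M \<in> events"
      using measurable_sets[OF pairR that] by (simp add: restricted_def)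
    then show ?thesis
      using that pairR by (simp add: measure_distr measure_restricted E)
        (simp add: restricted_def measure_restricted[OF E, unfolded restricted_def] vimage_def Int_def conj_commute)
  qed
  define D where "D = {p :: 'a \<times> 'a. fst p = snd p}"
  have D: "D \<in> sets ?P"
  proof -
    have "closed D" unfolding D_def by (intro closed_Collect_eq continuous_intros)
    then have "D \<in> sets borel" by (rule borel_closed)
    then show ?thesis by (subst borel_prod)
  qed
  have "measure \<mu> D = (\<Sum>i\<in>I. w i * measure (\<kappa> i) D)"
  proof (rule measure_eq_combination[where ?M1.0 = borel and ?M2.0 = borel])
    show "finite I" by (simp add: I_def)
    show "finite_measure \<mu>" unfolding \<mu>_def by (rule finite_measure.finite_measure_distr[OF fR pairR])
    show "sets \<mu> = sets ?P" by (simp add: \<mu>_def)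
    show "finite_measure (\<kappa> i)" for i
    proof (cases i)
      case None
      show ?thesis unfolding None \<kappa>_None
        by (rule finite_measure_pair_measure[OF nu.finite_measure_axioms fX])
    next
      case (Some i')
      show ?thesis unfolding Some \<kappa>_Some by (rule finite_measure.finite_measure_distr[OF fR pairR])
    qed
    show "sets (\<kappa> i) = sets ?P" for i
    proof (cases i)
      case None
      show ?thesis unfolding None \<kappa>_None by (rule sets_pair_measure_cong[OF sets_distr sets_nu])
    next
      case (Some i')
      show ?thesis unfolding Some \<kappa>_Some by (rule sets_distr)
    qed
    show "D \<in> sets ?P" by (rule D)
    fix A B :: "'a set" assume A: "A \<in> sets borel" and B: "B \<in> sets borel"
    let ?EA = "?E \<inter> (X (Suc j) -` A \<inter> space M)"
    have "X (Suc j) -` A \<inter> space M \<in> sets (past M X ?n)"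
    proof -
      have "Suc j \<in> {1..?n}" using c j by auto
      from measurable_sets[OF past_component[OF this] A] show ?thesis
        using subalgebra_past[of ?n] by (simp add: subalgebra_def)
    qed
    then have EA: "?EA \<in> sets (past M X ?n)" by (rule sets.Int[OF code_event_in_past])
    have rect: "measure (distr (restricted ?E) ?P (\<lambda>\<omega>. (X (Suc j) \<omega>, X (Suc i) \<omega>))) (A \<times> B)
        = prob (?EA \<inter> (X (Suc i) -` B \<inter> space M))" for i
    proof -
      have AB: "A \<times> B \<in> sets ?P" using A B by (rule pair_measureI)
      have "?E \<inter> {\<omega> \<in> space M. (X (Suc j) \<omega>, X (Suc i) \<omega>) \<in> A \<times> B} = ?EA \<inter> (X (Suc i) -` B \<inter> space M)"
        by blast
      then show ?thesis unfolding mP[OF AB] by (rule arg_cong)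
    qed
    have "measure \<mu> (A \<times> B) = prob (?EA \<inter> (X (Suc ?n) -` B \<inter> space M))"
      unfolding \<mu>_def by (rule rect)
    also have "\<dots> = ?a * (prob ?EA * measure \<nu> B) + (\<Sum>i\<in>set c. ?w i * prob (?EA \<inter> (X (Suc i) -` B \<inter> space M)))"
      by (rule past_event[OF c EA _ B]) auto
    also have "prob ?EA * measure \<nu> B = measure (\<kappa> None) (A \<times> B)"
    proof -
      have "measure (distr (restricted ?E) borel (X (Suc j))) A = prob ?EA"
      proof -
        have "space (restricted ?E) = space M" by (simp add: restricted_def)
        then have "measure (distr (restricted ?E) borel (X (Suc j))) A = measure (restricted ?E) (X (Suc j) -` A \<inter> space M)"
          using measure_distr[OF XR A] by simp
        then show ?thesis using measure_restricted[OF E mX[OF A]] by simp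
      qed
      moreover have "measure (distr (restricted ?E) borel (X (Suc j)) \<Otimes>\<^sub>M \<nu>) (A \<times> B)
          = measure (distr (restricted ?E) borel (X (Suc j))) A * measure \<nu> B"
        using A B sets_nu by (simp add: measure_def nu.emeasure_pair_measure_Times enn2real_mult)
      ultimately show ?thesis unfolding \<kappa>_None by simp
    qed
    also have "(\<Sum>i\<in>set c. ?w i * prob (?EA \<inter> (X (Suc i) -` B \<inter> space M))) = (\<Sum>i\<in>set c. ?w i * measure (\<kappa> (Some i)) (A \<times> B))"
    proof (rule sum.cong[OF refl])
      fix i assume "i \<in> set c"
      have "measure (\<kappa> (Some i)) (A \<times> B) = prob (?EA \<inter> (X (Suc i) -` B \<inter> space M))"
        unfolding \<kappa>_Some by (rule rect)
      then show "?w i * prob (?EA \<inter> (X (Suc i) -` B \<inter> space M)) = ?w i * measure (\<kappa> (Some i)) (A \<times> B)" by simp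
    qed
    finally show "measure \<mu> (A \<times> B) = (\<Sum>i\<in>I. w i * measure (\<kappa> i) (A \<times> B))"
      by (simp add: I_def w_def sum.reindex)
  qed
  also have "\<dots> = ?a * measure (\<kappa> None) D + (\<Sum>i\<in>set c. ?w i * measure (\<kappa> (Some i)) D)"
    by (simp add: I_def w_def sum.reindex)
  also have "measure (\<kappa> None) D = 0"
  proof -
    have "Pair x -` D = {x}" for x by (auto simp: D_def)
    moreover have "emeasure \<nu> {x} = 0" for x using diffuse[of x] by (simp add: nu.emeasure_eq_measure)
    ultimately have "emeasure (distr (restricted ?E) borel (X (Suc j)) \<Otimes>\<^sub>M \<nu>) D = 0"
      using D sets_nu by (subst nu.emeasure_pair_measure) (auto cong: sets_pair_measure_cong simp flip: indicator_vimage)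
    then show ?thesis unfolding \<kappa>_None measure_def by simp
  qed
  also have "(\<Sum>i\<in>set c. ?w i * measure (\<kappa> (Some i)) D) = (\<Sum>i\<in>set c. if i = j then ?w j * prob ?E else 0)"
  proof (rule sum.cong[OF refl])
    fix i assume i: "i \<in> set c"
    have "?E \<inter> {\<omega> \<in> space M. (X (Suc j) \<omega>, X (Suc i) \<omega>) \<in> D} = (if i = j then ?E else {})"
    proof -
      have "i = j" if "\<omega> \<in> ?E" "X (Suc j) \<omega> = X (Suc i) \<omega>" for \<omega>
      proof -
        have cc: "code (sample X ?n \<omega>) = c" using that by (simp add: code_event_def)
        have "pos (sample X ?n \<omega>) (X (Suc i) \<omega>) = i" if "i \<in> set c" for i
        proof -
          have "i < ?n" using that c by auto
          then show ?thesis using pos_eq_code_iff[of i "sample X ?n \<omega>"] that unfolding cc by (simp add: nth_sample)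
        qed
        from this[OF i] this[OF j] show ?thesis using that(2) by simp
      qed
      then show ?thesis by (auto simp: D_def code_event_def)
    qed
    then have "measure (\<kappa> (Some i)) D = (if i = j then prob ?E else 0)"
      unfolding \<kappa>_Some mP[OF D] by simp
    then show "?w i * measure (\<kappa> (Some i)) D = (if i = j then ?w j * prob ?E else 0)" by simp
  qed
  also have "\<dots> = ?w j * prob ?E" using j by simp
  also have "measure \<mu> D = prob (code_event (c @ [j]))"
  proof -
    have "?E \<inter> {\<omega> \<in> space M. (X (Suc j) \<omega>, X (Suc ?n) \<omega>) \<in> D} = code_event (c @ [j])"
    proof -
      have "X (Suc j) \<omega> = X (Suc ?n) \<omega> \<longleftrightarrow> pos (sample X ?n \<omega>) (X (Suc ?n) \<omega>) = j" if "code (sample X ?n \<omega>) = c" for \<omega>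
      proof -
        have "j < ?n" using j c by auto
        then show ?thesis using pos_eq_code_iff[of j "sample X ?n \<omega>"] j unfolding that by (simp add: nth_sample)
      qed
      then show ?thesis by (auto simp: code_event_def D_def sample_Suc code_snoc)
    qed
    then show ?thesis unfolding \<mu>_def mP[OF D] by simp
  qed
  finally show ?thesis by simp
qed

lemma theta_pos: "1 \<le> n \<Longrightarrow> 0 < \<theta> + real n"
  using \<alpha> \<theta> by linarith

lemma code_event_split:
  assumes c: "set c \<subseteq> {..<length c}"
  shows "code_event c = (\<Union>i\<in>insert (length c) (set c). code_event (c @ [i]))"
proof (intro equalityI subsetI)
  fix \<omega> assume \<omega>: "\<omega> \<in> code_event c"
  let ?xs = "sample X (length c) \<omega>"
  have "pos ?xs (X (Suc (length c)) \<omega>) \<in> insert (length c) (set c)"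
  proof (cases "X (Suc (length c)) \<omega> \<in> set ?xs")
    case True
    then have "pos ?xs (X (Suc (length c)) \<omega>) \<in> set (code ?xs)" by (simp add: code_def)
    then show ?thesis using \<omega> by (simp add: code_event_def)
  qed (simp add: pos_notin)
  then show "\<omega> \<in> (\<Union>i\<in>insert (length c) (set c). code_event (c @ [i]))"
    using \<omega> by (auto simp: code_event_def sample_Suc code_snoc)
qed (auto simp: code_event_def sample_Suc code_snoc)

text \<open>By complementation: the code is extended either by an old position or by its length.\<close>
lemma code_event_new:
  assumes c: "1 \<le> length c" "set c \<subseteq> {..<length c}"
  shows "prob (code_event (c @ [length c])) = (\<theta> + \<alpha> * real (num_types c)) / (\<theta> + real (length c)) * prob (code_event c)"
proof -
  let ?n = "length c"
  have fresh: "?n \<notin> set c" using c by auto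
  note code_event_split[OF c(2)]
  moreover have "prob (\<Union>i\<in>insert ?n (set c). code_event (c @ [i])) = (\<Sum>i\<in>insert ?n (set c). prob (code_event (c @ [i])))"
  proof (rule finite_measure_finite_Union)
    show "(\<lambda>i. code_event (c @ [i])) ` insert ?n (set c) \<subseteq> events" using code_event_in_events by blast
  qed (auto simp: disjoint_family_on_def code_event_def)
  ultimately have "prob (code_event c) = (\<Sum>i\<in>insert ?n (set c). prob (code_event (c @ [i])))" by simp
  also have "\<dots> = prob (code_event (c @ [?n])) + (\<Sum>i\<in>set c. (real (count_list c i) - \<alpha>) / (\<theta> + real ?n) * prob (code_event c))"
    using fresh by (simp add: code_event_repeat[OF c])
  also have "(\<Sum>i\<in>set c. (real (count_list c i) - \<alpha>) / (\<theta> + real ?n) * prob (code_event c))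
      = (real ?n - \<alpha> * real (num_types c)) / (\<theta> + real ?n) * prob (code_event c)"
  proof -
    have "(\<Sum>i\<in>set c. count_list c i) = ?n" by (simp add: sum_count_set)
    then have "(\<Sum>i\<in>set c. real (count_list c i) - \<alpha>) = real ?n - \<alpha> * real (num_types c)"
      by (simp add: sum_subtractf num_types_def flip: of_nat_sum)
    then show ?thesis by (simp flip: sum_distrib_right sum_divide_distrib)
  qed
  finally have "prob (code_event (c @ [?n])) = prob (code_event c) - (real ?n - \<alpha> * real (num_types c)) / (\<theta> + real ?n) * prob (code_event c)"
    by linarith
  also have "\<dots> = (\<theta> + \<alpha> * real (num_types c)) / (\<theta> + real ?n) * prob (code_event c)"
    using theta_pos[OF c(1)] by (simp add: field_simps)
  finally show ?thesis .
qed

end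

context ewens_pitman_model
begin

lemma measurable_code: "(\<lambda>\<omega>. code (sample X n \<omega>)) \<in> measurable M (count_space UNIV)"
proof (subst measurable_count_space_eq_countable)
  show "countable (UNIV :: nat list set)" by simp
  have "(\<lambda>\<omega>. code (sample X n \<omega>)) -` {c} \<inter> space M \<in> events" for c
  proof -
    have "(\<lambda>\<omega>. code (sample X n \<omega>)) -` {c} \<inter> space M = {\<omega> \<in> space M. code (sample X n \<omega>) = c}" by auto
    then show ?thesis using measurable_code_event[of n X M c] X_measurable by simp
  qed
  then show "(\<lambda>\<omega>. code (sample X n \<omega>)) \<in> space M \<rightarrow> UNIV \<and>
    (\<forall>c\<in>UNIV. (\<lambda>\<omega>. code (sample X n \<omega>)) -` {c} \<inter> space M \<in> events)" by simp
qed

lemma code_fun_borel: "(\<lambda>\<omega>. g (code (sample X n \<omega>)) :: real) \<in> borel_measurable M"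
  by (rule measurable_compose[OF measurable_code]) simp

lemma finite_codes: "finite (range (\<lambda>\<omega>. code (sample X n \<omega>)))"
proof (rule finite_subset)
  show "range (\<lambda>\<omega>. code (sample X n \<omega>)) \<subseteq> {c. set c \<subseteq> {..<n} \<and> length c = n}"
    using set_code[of "sample X n _"] by fastforce
  show "finite {c. set c \<subseteq> {..<n} \<and> length c = n}" by (rule finite_lists_length_eq) simp
qed

lemma integrable_code_fun: "integrable M (\<lambda>\<omega>. g (code (sample X n \<omega>)) :: real)"
  using finite_imageI[OF finite_codes[of n], of g]
  by (intro integrable_finite_range code_fun_borel) (simp add: image_image)

text \<open>The Markov property of the codes, in the form needed here: the expectation over \<open>m\<close> further draws is
  obtained by iterating \<open>transition\<close>.\<close>
theorem expectation_on_code_event: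
  assumes "1 \<le> length c" "set c \<subseteq> {..<length c}"
  shows "(\<integral>\<omega>. indicator (code_event c) \<omega> * g (code (sample X (length c + m) \<omega>)) \<partial>M) = prob (code_event c) * (transition \<alpha> \<theta> ^^ m) g c"
  using assms
proof (induction m arbitrary: c)
  case 0
  have "(\<integral>\<omega>. indicator (code_event c) \<omega> * g (code (sample X (length c) \<omega>)) \<partial>M) = (\<integral>\<omega>. g c * indicator (code_event c) \<omega> \<partial>M)"
    by (intro Bochner_Integration.integral_cong) (auto simp: code_event_def indicator_def)
  then show ?case using code_event_in_events[of c] by simp
next
  case (Suc m)
  let ?n = "length c" and ?h = "(transition \<alpha> \<theta> ^^ m) g"
  have fresh: "?n \<notin> set c" using Suc.prems by auto
  have ind: "indicator (code_event c) \<omega> = (\<Sum>i\<in>insert ?n (set c). indicator (code_event (c @ [i])) \<omega> :: real)" for \<omega>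
    by (subst code_event_split[OF Suc.prems(2)], rule indicator_UN_disjoint)
       (auto simp: disjoint_family_on_def code_event_def)
  have int: "integrable M (\<lambda>\<omega>. indicator (code_event c') \<omega> * g (code (sample X n \<omega>)))" for c' n
    using integrable_mult_indicator[OF code_event_in_events integrable_code_fun] by simp
  have IH: "(\<integral>\<omega>. indicator (code_event (c @ [i])) \<omega> * g (code (sample X (?n + Suc m) \<omega>)) \<partial>M)
      = prob (code_event (c @ [i])) * ?h (c @ [i])" if "i \<in> insert ?n (set c)" for i
  proof -
    have "set (c @ [i]) \<subseteq> {..<length (c @ [i])}" using that Suc.prems by auto
    then show ?thesis using Suc.IH[of "c @ [i]"] by simp
  qed
  have "(\<integral>\<omega>. indicator (code_event c) \<omega> * g (code (sample X (?n + Suc m) \<omega>)) \<partial>M)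
      = (\<Sum>i\<in>insert ?n (set c). prob (code_event (c @ [i])) * ?h (c @ [i]))"
    unfolding ind sum_distrib_right by (subst Bochner_Integration.integral_sum) (auto intro: int simp: IH simp del: add_Suc_right)
  also have "\<dots> = (\<theta> + \<alpha> * real (num_types c)) / (\<theta> + real ?n) * prob (code_event c) * ?h (c @ [?n])
      + (\<Sum>i\<in>set c. (real (count_list c i) - \<alpha>) / (\<theta> + real ?n) * prob (code_event c) * ?h (c @ [i]))"
    using fresh by (simp add: code_event_new[OF Suc.prems] code_event_repeat[OF Suc.prems])
  also have "\<dots> = prob (code_event c) * transition \<alpha> \<theta> ?h c"
  proof -
    have key: "A / D * p * h0 + (\<Sum>i\<in>set c. w i / D * p * h i) = p * ((A * h0 + (\<Sum>i\<in>set c. w i * h i)) / D)"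
      for A D p h0 :: real and w h :: "nat \<Rightarrow> real"
    proof -
      have "(\<Sum>i\<in>set c. w i / D * p * h i) = p / D * (\<Sum>i\<in>set c. w i * h i)"
        by (simp add: sum_distrib_left mult_ac)
      then show ?thesis by (simp add: add_divide_distrib distrib_left)
    qed
    show ?thesis unfolding transition_def[of \<alpha> \<theta> ?h c] by (rule key)
  qed
  finally show ?case by simp
qed

lemma prob_first: "prob (code_event [0]) = 1"
proof -
  have "code_event [0] = space M" by (auto simp: code_event_def sample_def code_def pos_def)
  then show ?thesis by (simp add: prob_space)
qed

text \<open>The nonempty codes that occur with positive probability. They are used to show that every composition of \<open>n\<close> occurs as a
  frequency vector with positive probability.\<close>
inductive realizable :: "nat list \<Rightarrow> bool" where
  first: "realizable [0]"
| repeat: "realizable c \<Longrightarrow> i \<in> set c \<Longrightarrow> realizable (c @ [i])"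
| fresh: "realizable c \<Longrightarrow> realizable (c @ [length c])"

lemma realizable_wf: "realizable c \<Longrightarrow> 1 \<le> length c \<and> set c \<subseteq> {..<length c}"
  by (induction rule: realizable.induct) (auto simp: less_Suc_eq)

lemma realizable_pos: "realizable c \<Longrightarrow> 0 < prob (code_event c)"
proof (induction rule: realizable.induct)
  case first
  then show ?case by (simp add: prob_first)
next
  case (repeat c i)
  note wf = realizable_wf[OF repeat(1), THEN conjunct1] realizable_wf[OF repeat(1), THEN conjunct2]
  have "1 \<le> count_list c i" using repeat(2) by (metis One_nat_def Suc_leI count_list_0_iff neq0_conv)
  then have "0 < real (count_list c i) - \<alpha>" using \<alpha> by linarith
  then show ?case using repeat theta_pos[OF wf(1)] by (simp add: code_event_repeat[OF wf repeat(2)])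
next
  case (fresh c)
  note wf = realizable_wf[OF fresh(1), THEN conjunct1] realizable_wf[OF fresh(1), THEN conjunct2]
  have "1 \<le> num_types c" using wf(1) by (cases c) (auto simp: num_types_def Suc_le_eq card_gt_0_iff)
  then have "\<alpha> * 1 \<le> \<alpha> * real (num_types c)" using \<alpha> by (intro mult_left_mono) auto
  then have "0 < \<theta> + \<alpha> * real (num_types c)" using \<theta> by linarith
  then show ?case using fresh theta_pos[OF wf(1)] by (simp add: code_event_new[OF wf])
qed

end

lemma types_snoc: "types (xs @ [y]) = (if y \<in> set xs then types xs else types xs @ [y])"
  by (simp add: types_def)

lemma types_replicate: "y \<notin> set xs \<Longrightarrow> types (xs @ replicate (Suc k) y) = types xs @ [y]"
proof (induction k)
  case (Suc k)
  have "xs @ replicate (Suc (Suc k)) y = (xs @ replicate (Suc k) y) @ [y]"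
    by (simp add: replicate_append_same)
  then show ?case using Suc by (simp only: types_snoc) simp
qed (simp add: types_snoc)

lemma freqs_replicate:
  assumes "y \<notin> set xs"
  shows "freqs (xs @ replicate (Suc k) y) = freqs xs @ [Suc k]"
proof -
  have "count_list (replicate m y) z = (if z = y then m else 0)" for m z by (induction m) auto
  moreover have "count_list xs y = 0" using assms by (simp add: count_list_0_iff)
  moreover have "y \<notin> set (types xs)" using assms by simp
  ultimately show ?thesis unfolding freqs_def types_replicate[OF assms] by auto
qed

context ewens_pitman_model
begin

lemma realizable_replicate:
  "c = [] \<or> realizable c \<Longrightarrow> realizable (c @ replicate (Suc k) (length c))"
proof (induction k)
  case 0
  then show ?case using realizable.fresh realizable.first by auto
next
  case (Suc k)
  have "c @ replicate (Suc (Suc k)) (length c) = (c @ replicate (Suc k) (length c)) @ [length c]"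
    by (simp add: replicate_append_same)
  moreover have "realizable ((c @ replicate (Suc k) (length c)) @ [length c])"
    using Suc by (intro realizable.repeat) auto
  ultimately show ?case by (simp only:)
qed

text \<open>The sample that exhausts one type before it passes to the next has the required frequencies.\<close>
lemma realizable_freqs_exists:
  assumes "\<forall>i\<in>set ns. 1 \<le> i"
  shows "\<exists>c. (c = [] \<and> ns = [] \<or> realizable c) \<and> freqs c = ns \<and> length c = sum_list ns"
  using assms
proof (induction ns rule: rev_induct)
  case Nil
  show ?case by (rule exI[of _ "[]"]) (simp add: freqs_def types_def)
next
  case (snoc k ns)
  then obtain c where c: "c = [] \<and> ns = [] \<or> realizable c" "freqs c = ns" "length c = sum_list ns" by auto
  obtain k' where k': "k = Suc k'" using snoc.prems by (cases k) auto
  have "length c \<notin> set c" using c(1) realizable_wf[of c] by auto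
  then have "freqs (c @ replicate k (length c)) = ns @ [k]" using c(2) by (simp add: k' freqs_replicate del: replicate_Suc)
  moreover have "realizable (c @ replicate k (length c))" unfolding k' using c(1) by (intro realizable_replicate) auto
  ultimately show ?case using c(3) by (intro exI[of _ "c @ replicate k (length c)"]) simp
qed

end

section \<open>Conditioning on the observed frequencies\<close>

locale conditioned_model = ewens_pitman_model +
  fixes n j :: nat and ns :: "nat list"
  assumes n: "1 \<le> n" and j: "1 \<le> j" and ns: "length ns = j" "\<forall>i\<in>set ns. 1 \<le> i" "sum_list ns = n"
begin

definition initial_codes :: "nat list set" where
  "initial_codes = {c. set c \<subseteq> {..<n} \<and> length c = n \<and> num_types c = j \<and> freqs c = ns}"

definition event :: "'b set" where
  "event = {\<omega> \<in> space M. num_types (sample X n \<omega>) = j \<and> freqs (sample X n \<omega>) = ns}"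

lemma finite_initial_codes: "finite initial_codes"
  unfolding initial_codes_def by (rule finite_subset[OF _ finite_lists_length_eq[of "{..<n}" n]]) auto

lemma event_eq: "event = (\<Union>c\<in>initial_codes. code_event c)"
proof (intro equalityI subsetI)
  fix \<omega> assume \<omega>: "\<omega> \<in> event"
  let ?c = "code (sample X n \<omega>)"
  have "?c \<in> initial_codes" using \<omega> set_code[of "sample X n \<omega>"]
    by (simp add: initial_codes_def event_def num_types_code freqs_code)
  moreover have "\<omega> \<in> code_event ?c" using \<omega> by (simp add: code_event_def event_def)
  ultimately show "\<omega> \<in> (\<Union>c\<in>initial_codes. code_event c)" by blast
next
  fix \<omega> assume "\<omega> \<in> (\<Union>c\<in>initial_codes. code_event c)"
  then obtain c where c: "c \<in> initial_codes" "\<omega> \<in> code_event c" by blast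
  then have "code (sample X n \<omega>) = c" by (simp add: code_event_def initial_codes_def)
  moreover have "\<omega> \<in> space M" "num_types c = j" "freqs c = ns"
    using c by (auto simp: initial_codes_def code_event_def)
  ultimately show "\<omega> \<in> event" unfolding event_def mem_Collect_eq
    using num_types_code[of "sample X n \<omega>"] freqs_code[of "sample X n \<omega>"] by metis
qed

lemma event_in: "event \<in> events"
  unfolding event_eq using finite_initial_codes code_event_in_events by blast

lemma disjoint_code_event: "disjoint_family_on code_event initial_codes"
  by (auto simp: disjoint_family_on_def code_event_def initial_codes_def)

lemma event_pos: "0 < prob event"
proof -
  obtain c where c: "c = [] \<and> ns = [] \<or> realizable c" "freqs c = ns" "length c = sum_list ns"
    using realizable_freqs_exists[OF ns(2)] by blast
  have "realizable c" using c(1) ns j by auto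
  moreover have "num_types c = j" using arg_cong[OF c(2), of length] ns by (simp add: freqs_def length_types)
  ultimately have "c \<in> initial_codes" using realizable_wf[of c] c ns by (simp add: initial_codes_def)
  then have "code_event c \<subseteq> event" unfolding event_eq by blast
  then have "prob (code_event c) \<le> prob event" by (rule finite_measure_mono[OF _ event_in])
  then show ?thesis using realizable_pos[OF \<open>realizable c\<close>] by linarith
qed

abbreviation Q where "Q \<equiv> given_freqs M X n j ns"

lemma Q_eq: "Q = uniform_measure M event"
  by (simp add: given_freqs_def event_def)

lemma prob_space_Q: "prob_space Q"
  unfolding Q_eq using event_pos by (intro prob_space_uniform_measure) (simp_all add: emeasure_eq_measure)

lemma sets_Q: "sets Q = events" and space_Q: "space Q = space M"
  by (simp_all add: Q_eq)

lemma integral_Q: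
  assumes "f \<in> borel_measurable M"
  shows "(\<integral>\<omega>. f \<omega> \<partial>Q) = (\<integral>\<omega>. indicator event \<omega> * f \<omega> \<partial>M) / prob event"
proof -
  have "Q = density M (\<lambda>\<omega>. ennreal (indicator event \<omega> / prob event))"
    unfolding Q_eq uniform_measure_def using event_pos
    by (intro arg_cong2[where f = density] refl ext)
       (auto simp: emeasure_eq_measure indicator_def divide_ennreal ennreal_1[symmetric] simp del: ennreal_1)
  then have "(\<integral>\<omega>. f \<omega> \<partial>Q) = (\<integral>\<omega>. indicator event \<omega> / prob event * f \<omega> \<partial>M)"
    using assms event_in by (simp add: integral_density)
  then show ?thesis by simp
qed

text \<open>The conditioning event is a finite disjoint union of events with a fixed code, so an expectation
  that takes the same value for all these codes keeps that value after conditioning.\<close>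
theorem expectation_Q:
  assumes "\<And>c. c \<in> initial_codes \<Longrightarrow> (transition \<alpha> \<theta> ^^ m) g c = v"
  shows "(\<integral>\<omega>. g (code (sample X (n + m) \<omega>)) \<partial>Q) = v"
proof -
  have ind: "indicator event \<omega> = (\<Sum>c\<in>initial_codes. indicator (code_event c) \<omega> :: real)" for \<omega>
    unfolding event_eq by (rule indicator_UN_disjoint[OF finite_initial_codes disjoint_code_event])
  have int: "integrable M (\<lambda>\<omega>. indicator (code_event c') \<omega> * g (code (sample X n \<omega>)))" for c' n
    using integrable_mult_indicator[OF code_event_in_events integrable_code_fun] by simp
  have "(\<integral>\<omega>. indicator event \<omega> * g (code (sample X (n + m) \<omega>)) \<partial>M)
      = (\<Sum>c\<in>initial_codes. \<integral>\<omega>. indicator (code_event c) \<omega> * g (code (sample X (n + m) \<omega>)) \<partial>M)"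
    unfolding ind sum_distrib_right by (rule Bochner_Integration.integral_sum) (rule int)
  also have "\<dots> = (\<Sum>c\<in>initial_codes. prob (code_event c) * v)"
  proof (rule sum.cong[OF refl])
    fix c assume c: "c \<in> initial_codes"
    then show "(\<integral>\<omega>. indicator (code_event c) \<omega> * g (code (sample X (n + m) \<omega>)) \<partial>M) = prob (code_event c) * v"
      using expectation_on_code_event[of c g m] assms[OF c] n by (simp add: initial_codes_def)
  qed
  also have "\<dots> = prob event * v"
  proof -
    have "prob event = (\<Sum>c\<in>initial_codes. prob (code_event c))" unfolding event_eq
      by (rule finite_measure_finite_Union[OF finite_initial_codes _ disjoint_code_event]) (use code_event_in_events in blast)
    then show ?thesis by (simp add: sum_distrib_right)
  qed
  finally show ?thesis
    using event_pos by (simp add: integral_Q[OF code_fun_borel])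
qed

lemma integrable_Q: "integrable Q (\<lambda>\<omega>. g (code (sample X k \<omega>)) :: real)"
proof -
  interpret Q: prob_space Q by (rule prob_space_Q)
  have "(\<lambda>\<omega>. g (code (sample X k \<omega>))) \<in> borel_measurable Q"
    using code_fun_borel sets_Q measurable_cong_sets by blast
  then show ?thesis using finite_imageI[OF finite_codes[of k], of g]
    by (intro Q.integrable_finite_range) (simp_all add: image_image)
qed

text \<open>The closed form depends on the initial code only through \<open>n\<close> and \<open>j\<close>, hence survives the
  conditioning. The first \<open>n\<close> entries of a code recover the initial types.\<close>
theorem expectation_placements:
  assumes "finite S" "\<forall>s\<in>S. 1 \<le> k s"
  shows "(\<integral>\<omega>. moment_fun \<alpha> \<theta> (set (take n (code (sample X (n + m) \<omega>)))) S k q (code (sample X (n + m) \<omega>)) \<partial>Q)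
    = moment \<alpha> (real j + \<theta> / \<alpha>) (\<theta> + real n) S k q m"
proof (rule expectation_Q)
  fix c assume "c \<in> initial_codes"
  then have c: "set c \<subseteq> {..<length c}" "length c = n" "num_types c = j" by (auto simp: initial_codes_def)
  have "(transition \<alpha> \<theta> ^^ m) (\<lambda>c. moment_fun \<alpha> \<theta> (set (take n c)) S k q c) c
      = (transition \<alpha> \<theta> ^^ m) (moment_fun \<alpha> \<theta> (set c) S k q) c"
    using c by (intro funpow_transition_cong) (auto simp: extends_def)
  also have "\<dots> = moment \<alpha> (real j + \<theta> / \<alpha>) (\<theta> + real n) S k q m"
    using expectation_moment_fun[OF \<alpha>(1) _ c(1) assms, of \<theta> m q] c theta_pos[OF n] by simp
  finally show "(transition \<alpha> \<theta> ^^ m) (\<lambda>c. moment_fun \<alpha> \<theta> (set (take n c)) S k q c) c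
      = moment \<alpha> (real j + \<theta> / \<alpha>) (\<theta> + real n) S k q m" .
qed

end

section \<open>Bounds for the coefficients\<close>

text \<open>The binomial series with exponent \<open>- a\<close>.\<close>
lemma pochhammer_series_sums:
  fixes a z :: real
  assumes "\<bar>z\<bar> < 1"
  shows "(\<lambda>k. pochhammer a k / fact k * z ^ k) sums ((1 - z) powr (- a))"
proof -
  have "((- a) gchoose k) * (- z) ^ k = pochhammer a k / fact k * z ^ k" for k
  proof -
    have "(- 1) ^ k * (- z) ^ k = z ^ k" by (simp flip: power_mult_distrib)
    then show ?thesis by (simp add: gbinomial_pochhammer)
  qed
  then show ?thesis using gen_binomial_real[of "- z" "- a"] assms by simp
qed

lemma pochhammer_fact_mono:
  fixes a :: real
  assumes "1 \<le> a" "m \<le> i"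
  shows "pochhammer a m / fact m \<le> pochhammer a i / fact i"
  using assms(2)
proof (induction i rule: dec_induct)
  case (step i)
  have "pochhammer a i / fact i * 1 \<le> pochhammer a i / fact i * ((a + real i) / (real i + 1))"
    using assms(1) by (intro mult_left_mono) (auto simp: pochhammer_nonneg field_simps)
  also have "\<dots> = pochhammer a (Suc i) / fact (Suc i)" by (simp add: pochhammer_Suc field_simps)
  finally show ?case using step.IH by simp
qed simp

text \<open>For \<open>a \<ge> 1\<close> the coefficients of the binomial series increase, so \<open>L\<close> consecutive terms, all at least the first
  coefficient times \<open>(1 - v)\<close> to the power \<open>m + L\<close>, are bounded by the sum of the series. The
  factor \<open>L\<close> gained in this way compensates a power of \<open>m\<close>.\<close>
lemma pochhammer_upper:
  fixes a v :: real
  assumes a: "1 \<le> a" and v: "0 < v" "v < 1"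
  shows "pochhammer a m / fact m * (real L * (1 - v) ^ (m + L)) \<le> v powr (- a)"
proof -
  let ?f = "\<lambda>k. pochhammer a k / fact k * (1 - v) ^ k"
  have sums: "?f sums (v powr (- a))" using pochhammer_series_sums[of "1 - v" a] v by simp
  have "pochhammer a m / fact m * (real L * (1 - v) ^ (m + L))
      = (\<Sum>i\<in>{m..<m + L}. pochhammer a m / fact m * (1 - v) ^ (m + L))" by simp
  also have "\<dots> \<le> (\<Sum>i\<in>{m..<m + L}. ?f i)"
    using a v by (intro sum_mono mult_mono pochhammer_fact_mono power_decreasing) (auto simp: pochhammer_nonneg)
  also have "\<dots> \<le> suminf ?f"
    using a v sums by (intro sum_le_suminf) (auto simp: pochhammer_nonneg sums_iff)
  finally show ?thesis using sums by (simp add: sums_iff)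
qed

lemma pochhammer_fact_lower:
  fixes x :: real
  assumes "0 < x" "1 \<le> r"
  shows "x / real r \<le> pochhammer x r / fact r"
  using assms(2)
proof (induction r rule: dec_induct)
  case (step r)
  have "x / real (Suc r) = x / real r * (real r / real (Suc r))" using step by simp
  also have "\<dots> \<le> pochhammer x r / fact r * ((x + real r) / real (Suc r))"
    using step assms(1) by (intro mult_mono divide_right_mono) (auto simp: pochhammer_nonneg)
  also have "\<dots> = pochhammer x (Suc r) / fact (Suc r)" by (simp add: pochhammer_Suc field_simps)
  finally show ?case .
qed simp

text \<open>The difference \<open>(a + y) ln (a + y) - (b + y) ln (b + y)\<close> has the decreasing derivative
  \<open>ln ((a + y) / (b + y))\<close>, so its increment over a unit interval is at most the derivative at the
  left end.\<close>
lemma ln_ratio_increment: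
  fixes a b :: real
  assumes "0 < b" "b \<le> a"
  shows "((a + 1) * ln (a + 1) - (b + 1) * ln (b + 1)) - (a * ln a - b * ln b) \<le> ln (a / b)"
proof -
  define h where "h = (\<lambda>y. (a + y) * ln (a + y) - (b + y) * ln (b + y) - y * ln (a / b))"
  have "h 1 \<le> h 0"
  proof (rule DERIV_nonpos_imp_nonincreasing[of 0 1 h])
    fix y :: real assume y: "0 \<le> y" "y \<le> 1"
    have pos: "0 < a + y" "0 < b + y" using assms y by auto
    have "(h has_real_derivative (ln (a + y) - ln (b + y) - ln (a / b))) (at y)"
      unfolding h_def using pos by (auto intro!: derivative_eq_intros)
    moreover have "ln (a + y) - ln (b + y) - ln (a / b) \<le> 0"
    proof -
      have "(a + y) / (b + y) \<le> a / b" using assms y pos mult_left_mono[of b a y] by (simp add: field_simps)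
      then have "ln ((a + y) / (b + y)) \<le> ln (a / b)" using assms pos by (subst ln_le_cancel_iff) auto
      then show ?thesis using pos by (simp add: ln_div)
    qed
    ultimately show "\<exists>z. (h has_real_derivative z) (at y) \<and> z \<le> 0" by blast
  qed simp
  then show ?thesis by (simp add: h_def)
qed

lemma x_ln_x_increment:
  fixes b h :: real
  assumes "0 < b" "0 \<le> h"
  shows "h * (ln b + 1) \<le> (b + h) * ln (b + h) - b * ln b"
proof -
  have "(b + h) * (1 - b / (b + h)) \<le> (b + h) * ln ((b + h) / b)"
  proof (intro mult_left_mono)
    have "ln (b / (b + h)) \<le> b / (b + h) - 1" using assms by (intro ln_le_minus_one) auto
    then show "1 - b / (b + h) \<le> ln ((b + h) / b)" using assms by (simp add: ln_div)
  qed (use assms in auto)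
  moreover have "(b + h) * (1 - b / (b + h)) = h" using assms by (simp add: field_simps)
  ultimately show ?thesis using assms by (simp add: ln_div algebra_simps)
qed

text \<open>A lower bound of Stirling type: the logarithm of the ratio is a sum of terms
  \<open>ln ((B + h + i) / (B + i))\<close>, compared with an integral by \<open>ln_ratio_increment\<close>.\<close>
lemma pochhammer_ratio_lower:
  fixes B h :: real
  assumes B: "0 < B" and h: "0 \<le> h"
  shows "exp (h * ln (B + real m) + h - (B + h) * ln (B + h) + B * ln B) \<le> pochhammer (B + h) m / pochhammer B m"
proof -
  have "(B + h + real m) * ln (B + h + real m) - (B + real m) * ln (B + real m)
      - ((B + h) * ln (B + h) - B * ln B) \<le> ln (pochhammer (B + h) m / pochhammer B m)"
  proof (induction m)
    case (Suc m)
    have pos: "0 < pochhammer (B + h) m" "0 < pochhammer B m" using B h by (auto intro: pochhammer_pos)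
    have "pochhammer (B + h) (Suc m) / pochhammer B (Suc m)
        = pochhammer (B + h) m / pochhammer B m * ((B + h + real m) / (B + real m))"
      by (simp add: pochhammer_Suc)
    moreover have "0 < pochhammer (B + h) m / pochhammer B m" "0 < (B + h + real m) / (B + real m)"
      using pos B h by auto
    ultimately have "ln (pochhammer (B + h) (Suc m) / pochhammer B (Suc m))
        = ln (pochhammer (B + h) m / pochhammer B m) + ln ((B + h + real m) / (B + real m))"
      by (simp only: ln_mult_pos)
    then show ?case using Suc ln_ratio_increment[of "B + real m" "B + h + real m"] B h
      by (simp add: add_ac)
  qed simp
  moreover have "h * (ln (B + real m) + 1) \<le> (B + real m + h) * ln (B + real m + h) - (B + real m) * ln (B + real m)"
    using B h by (intro x_ln_x_increment) auto
  ultimately have "h * ln (B + real m) + h - (B + h) * ln (B + h) + B * ln B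
      \<le> ln (pochhammer (B + h) m / pochhammer B m)"
    by (simp add: algebra_simps)
  moreover have "0 < pochhammer (B + h) m / pochhammer B m" using B h by (auto intro!: divide_pos_pos pochhammer_pos)
  ultimately show ?thesis by (simp add: ln_ge_iff)
qed

text \<open>The coefficients of the generating function of \<open>K + \<theta>/\<alpha>\<close> after \<open>m\<close> draws, where \<open>x = j + \<theta>/\<alpha>\<close> and \<open>B = \<theta> + n\<close> describe
  the initial state.\<close>
definition gcoeff :: "real \<Rightarrow> real \<Rightarrow> real \<Rightarrow> nat \<Rightarrow> nat \<Rightarrow> real" where
  "gcoeff \<alpha> x B m r = pochhammer x r / fact r * pochhammer (B + \<alpha> * real r) m / pochhammer B m"

lemma gcoeff_pos: "0 < \<alpha> \<Longrightarrow> 0 < x \<Longrightarrow> 0 < B \<Longrightarrow> 0 < gcoeff \<alpha> x B m r"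
  unfolding gcoeff_def by (intro divide_pos_pos mult_pos_pos pochhammer_pos) (auto intro: add_pos_nonneg)

text \<open>Inserting \<open>pochhammer_upper\<close> with \<open>a = B + \<alpha> r\<close> in each term leaves a binomial series in
  \<open>y\<close> times \<open>v\<close> to the power \<open>- \<alpha>\<close>. The term \<open>r = 0\<close> is at most \<open>1\<close> and is kept apart because \<open>B\<close> may be
  less than \<open>1\<close>.\<close>
lemma gcoeff_sum_upper:
  assumes \<alpha>: "0 < \<alpha>" and x: "0 < x" and B: "0 < B" "1 \<le> B + \<alpha>" and v: "0 < v" "v < 1"
    and y: "0 \<le> y" "y * v powr (- \<alpha>) < 1" and L: "1 \<le> L"
    and g: "\<And>r. 0 \<le> g r" "\<And>r. g r \<le> gcoeff \<alpha> x B m r"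
    and S: "(\<lambda>r. y ^ r * g r) sums S"
  shows "S \<le> 1 + fact m / pochhammer B m * v powr (- B) / (real L * (1 - v) ^ (m + L))
                 * (1 - y * v powr (- \<alpha>)) powr (- x)"
proof -
  define \<theta> where "\<theta> = y * v powr (- \<alpha>)"
  define D where "D = fact m / pochhammer B m * v powr (- B) / (real L * (1 - v) ^ (m + L))"
  have \<theta>: "0 \<le> \<theta>" "\<theta> < 1" using y by (auto simp: \<theta>_def)
  have D: "0 \<le> D" unfolding D_def using B v by (auto intro!: divide_nonneg_nonneg mult_nonneg_nonneg pochhammer_nonneg)
  have sums: "(\<lambda>r. (if r = 0 then 1 else 0) + D * (pochhammer x r / fact r * \<theta> ^ r)) sums (1 + D * (1 - \<theta>) powr (- x))"
    using \<theta> by (intro sums_add sums_mult pochhammer_series_sums sums_single) auto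
  have "y ^ r * g r \<le> (if r = 0 then 1 else 0) + D * (pochhammer x r / fact r * \<theta> ^ r)" for r
  proof (cases "r = 0")
    case True
    then show ?thesis using g(2)[of 0] D B pochhammer_pos[OF B(1), of m] by (simp add: gcoeff_def)
  next
    case False
    have a: "1 \<le> B + \<alpha> * real r" using B \<alpha> False
      by (smt (verit) One_nat_def Suc_leI mult_left_le_imp_le mult_less_cancel_left2 not_gr_zero of_nat_1 of_nat_mono)
    have P: "0 < pochhammer B m" using B by (simp add: pochhammer_pos)
    have "pochhammer (B + \<alpha> * real r) m \<le> fact m * v powr (- (B + \<alpha> * real r)) / (real L * (1 - v) ^ (m + L))"
      using pochhammer_upper[OF a v, of m L] v L by (simp add: field_simps)
    then have "pochhammer (B + \<alpha> * real r) m / pochhammer B m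
        \<le> fact m * v powr (- (B + \<alpha> * real r)) / (real L * (1 - v) ^ (m + L)) / pochhammer B m"
      using P by (intro divide_right_mono) auto
    also have "\<dots> = D * (v powr (- \<alpha>)) ^ r"
    proof -
      have "(v powr (- \<alpha>)) ^ r = v powr (- \<alpha> * real r)"
        using v by (simp only: powr_realpow[symmetric] powr_gt_zero powr_powr)
      then have "v powr (- (B + \<alpha> * real r)) = v powr (- B) * (v powr (- \<alpha>)) ^ r"
        by (simp flip: powr_add)
      then show ?thesis by (simp add: D_def mult_ac)
    qed
    finally have "gcoeff \<alpha> x B m r \<le> pochhammer x r / fact r * (D * (v powr (- \<alpha>)) ^ r)"
      unfolding gcoeff_def times_divide_eq_right[symmetric] using x by (intro mult_left_mono) (auto simp: pochhammer_nonneg)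
    then have "y ^ r * g r \<le> y ^ r * (pochhammer x r / fact r * (D * (v powr (- \<alpha>)) ^ r))"
      using y g(2)[of r] by (intro mult_left_mono) auto
    also have "\<dots> = D * (pochhammer x r / fact r * \<theta> ^ r)" by (simp add: \<theta>_def power_mult_distrib mult_ac)
    finally show ?thesis using False by simp
  qed
  then have "S \<le> 1 + D * (1 - \<theta>) powr (- x)" by (rule sums_le[OF _ S sums])
  then show ?thesis by (simp add: D_def \<theta>_def)
qed

text \<open>This exposes the order of growth, since the Gamma series converges.\<close>
lemma fact_over_pochhammer:
  fixes B :: real
  assumes "0 < B" "0 < m"
  shows "fact m / pochhammer B m = Gamma_series B m * (B + real m) * real m powr (- B)"
proof -
  have "exp (B * ln (real m)) * real m powr (- B) = 1"
    using assms by (simp add: powr_def flip: exp_add)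
  moreover have "Gamma_series B m * (B + real m) = fact m * exp (B * ln (real m)) / pochhammer B m"
    using assms by (simp add: Gamma_series_def pochhammer_Suc)
  ultimately show ?thesis by simp
qed

lemma falling_eq_pochhammer: "c \<le> m \<Longrightarrow> falling m c = pochhammer (real (m - c) + 1) c"
proof -
  assume c: "c \<le> m"
  have "falling m c = fact c * (pochhammer (real m - real c + 1) c / fact c)"
    by (simp only: falling_def binomial_gbinomial gbinomial_pochhammer')
  then show ?thesis using c by (simp add: of_nat_diff)
qed

lemma falling_eq_prod: "falling m r = (\<Prod>i = 0..<r. real (m - i))"
proof (induction r)
  case (Suc r)
  have "fact (Suc r) * (m choose Suc r) = fact r * (Suc r * (m choose Suc r))"
    by (simp only: fact_Suc of_nat_id mult_ac)
  also have "Suc r * (m choose Suc r) = (m - r) * (m choose r)"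
    by (simp only: binomial_absorption binomial_absorb_comp)
  finally have "fact (Suc r) * (m choose Suc r) = (m - r) * (fact r * (m choose r))" by simp
  then have "real (fact (Suc r) * (m choose Suc r)) = real ((m - r) * (fact r * (m choose r)))" by (rule arg_cong)
  then have "falling m (Suc r) = real (m - r) * falling m r"
    by (simp only: falling_def of_nat_mult of_nat_fact)
  then show ?case using Suc by (simp add: mult.commute)
qed (simp add: falling_def)

text \<open>The coefficients of the generating function of the number of new types with frequency \<open>l\<close>, apart from the
  powers of \<open>block_weight \<alpha> l\<close>.\<close>
definition freq_coeff :: "real \<Rightarrow> real \<Rightarrow> real \<Rightarrow> nat \<Rightarrow> nat \<Rightarrow> nat \<Rightarrow> real" where
  "freq_coeff \<alpha> x B l m r = pochhammer x r / fact r * (falling m (r * l) * pochhammer (B + \<alpha> * real r) (m - r * l)) / pochhammer B m"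

lemma pochhammer_mono:
  fixes a b :: real
  assumes "0 < a" "a \<le> b"
  shows "pochhammer a c \<le> pochhammer b c"
proof (induction c)
  case (Suc c)
  show ?case unfolding pochhammer_Suc using assms Suc
    by (intro mult_mono) (auto intro: pochhammer_nonneg order_trans)
qed simp

lemma pochhammer_split: "c \<le> m \<Longrightarrow> pochhammer a m = pochhammer a (m - c) * pochhammer (a + real (m - c)) c"
  for a :: real
  using pochhammer_product'[of a "m - c" c] by simp

lemma pochhammer_quotient_lower:
  fixes a b :: real
  assumes "1 \<le> b" "b \<le> a"
  shows "exp (- (real c * (a - b) / b)) * pochhammer a c \<le> pochhammer b c"
proof (induction c)
  case (Suc c)
  have "exp (- ((a - b) / b)) * (a + real c) \<le> b + real c"
  proof -
    have "1 + (a - b) / b \<le> exp ((a - b) / b)" by (rule exp_ge_add_one_self)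
    then have "a / b \<le> exp ((a - b) / b)" using assms by (simp add: field_simps)
    moreover have "a + real c \<le> (b + real c) * (a / b)"
      using assms mult_right_mono[of b a "real c"] by (simp add: field_simps)
    ultimately have "a + real c \<le> (b + real c) * exp ((a - b) / b)"
      using assms by (smt (verit) mult_left_mono of_nat_0_le_iff)
    then have "exp (- ((a - b) / b)) * (a + real c) \<le> exp (- ((a - b) / b)) * ((b + real c) * exp ((a - b) / b))"
      by (rule mult_left_mono) simp
    also have "\<dots> = b + real c" by (simp add: exp_minus)
    finally show ?thesis .
  qed
  moreover have "exp (- (real (Suc c) * (a - b) / b)) = exp (- ((a - b) / b)) * exp (- (real c * (a - b) / b))"
    by (simp only: of_nat_Suc distrib_right mult_1 add_divide_distrib minus_add_distrib exp_add)
  ultimately show ?case using Suc assms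
    by (simp only: pochhammer_Suc) (smt (verit) exp_ge_zero mult.assoc mult.commute mult_mono mult_nonneg_nonneg of_nat_0_le_iff pochhammer_nonneg)
qed simp

lemma freq_coeff_nonneg: "0 < \<alpha> \<Longrightarrow> 0 < x \<Longrightarrow> 0 < B \<Longrightarrow> 0 \<le> freq_coeff \<alpha> x B l m r"
  unfolding freq_coeff_def falling_def
  by (intro divide_nonneg_nonneg mult_nonneg_nonneg pochhammer_nonneg) (auto intro: add_pos_nonneg)

text \<open>Both products have \<open>m\<close> factors; \<open>m - c\<close> of them coincide, and the other \<open>c\<close> differ by \<open>a - 1\<close> each.\<close>
lemma falling_pochhammer_bounds:
  fixes a :: real
  assumes a: "1 \<le> a"
  shows "falling m c * pochhammer a (m - c) \<le> pochhammer a m"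
    and "c \<le> m \<Longrightarrow> exp (- (real c * (a - 1) / (real (m - c) + 1))) * pochhammer a m \<le> falling m c * pochhammer a (m - c)"
proof -
  have P: "0 \<le> pochhammer a (m - c)" using a by (intro pochhammer_nonneg) simp
  show "falling m c * pochhammer a (m - c) \<le> pochhammer a m"
  proof (cases "c \<le> m")
    case True
    have "pochhammer (real (m - c) + 1) c \<le> pochhammer (a + real (m - c)) c"
      using a by (intro pochhammer_mono) auto
    then show ?thesis using P True unfolding pochhammer_split[OF True, of a] falling_eq_pochhammer[OF True]
      by (simp add: mult.commute mult_left_mono)
  next
    case False
    then show ?thesis using a by (simp add: falling_def binomial_eq_0 pochhammer_nonneg)
  qed
  assume c: "c \<le> m"
  have "exp (- (real c * (a + real (m - c) - (real (m - c) + 1)) / (real (m - c) + 1))) * pochhammer (a + real (m - c)) c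
      \<le> pochhammer (real (m - c) + 1) c"
    using a by (intro pochhammer_quotient_lower) auto
  then have "exp (- (real c * (a - 1) / (real (m - c) + 1))) * pochhammer (a + real (m - c)) c \<le> falling m c"
    by (simp add: falling_eq_pochhammer[OF c])
  then have "exp (- (real c * (a - 1) / (real (m - c) + 1))) * pochhammer (a + real (m - c)) c * pochhammer a (m - c)
      \<le> falling m c * pochhammer a (m - c)" using P by (rule mult_right_mono)
  then show "exp (- (real c * (a - 1) / (real (m - c) + 1))) * pochhammer a m \<le> falling m c * pochhammer a (m - c)"
    unfolding pochhammer_split[OF c, of a] by (simp add: mult_ac)
qed

lemma freq_coeff_le:
  assumes "0 < \<alpha>" "0 < x" "0 < B" "1 \<le> B + \<alpha>"
  shows "freq_coeff \<alpha> x B l m r \<le> gcoeff \<alpha> x B m r"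
proof (cases "r = 0")
  case True
  then show ?thesis by (simp add: freq_coeff_def gcoeff_def falling_def)
next
  case False
  have "\<alpha> * 1 \<le> \<alpha> * real r" using assms False by (intro mult_left_mono) auto
  then have a: "1 \<le> B + \<alpha> * real r" using assms by linarith
  show ?thesis unfolding freq_coeff_def gcoeff_def using assms
    by (intro divide_right_mono mult_left_mono falling_pochhammer_bounds(1) a) (auto simp: pochhammer_nonneg)
qed

lemma freq_coeff_ge:
  assumes "0 < \<alpha>" "0 < x" "0 < B" "1 \<le> B + \<alpha>" "1 \<le> r" "r * l \<le> m"
  shows "gcoeff \<alpha> x B m r * exp (- (real (r * l) * (B + \<alpha> * real r - 1) / (real (m - r * l) + 1))) \<le> freq_coeff \<alpha> x B l m r"
proof -
  have "\<alpha> * 1 \<le> \<alpha> * real r" using assms by (intro mult_left_mono) auto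
  then have a: "1 \<le> B + \<alpha> * real r" using assms by linarith
  have "pochhammer x r / fact r * (exp (- (real (r * l) * (B + \<alpha> * real r - 1) / (real (m - r * l) + 1))) * pochhammer (B + \<alpha> * real r) m) / pochhammer B m
      \<le> freq_coeff \<alpha> x B l m r"
    unfolding freq_coeff_def using assms
    by (intro divide_right_mono mult_left_mono falling_pochhammer_bounds(2) a) (auto simp: pochhammer_nonneg)
  then show ?thesis by (simp add: gcoeff_def mult_ac)
qed

section \<open>Logarithmic asymptotics of the generating functions\<close>

text \<open>The number of draws is \<open>k - e\<close>: conditionally on an initial sample \<open>e = 0\<close>, and \<open>e = 1\<close> when the first
  draw counts as the initial sample. The argument \<open>y k\<close> of the generating functions is of the order at which their
  logarithm is comparable with the speed \<open>s k\<close>.\<close>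
locale moderate_regime =
  fixes \<alpha> x B \<tau> :: real and s y :: "nat \<Rightarrow> real" and e :: nat
  assumes \<alpha>: "0 < \<alpha>" "\<alpha> < 1" and x: "0 < x" and B: "0 < B" "1 \<le> B + \<alpha>" and \<tau>: "0 < \<tau>"
    and s_top: "filterlim s at_top sequentially"
    and s_small: "(\<lambda>k. s k / real k) \<longlonglongrightarrow> 0"
    and y: "(\<lambda>k. y k / (s k / real k) powr \<alpha>) \<longlonglongrightarrow> \<tau>"
begin

lemma s_pos: "\<forall>\<^sub>F k in sequentially. 1 < s k"
  using s_top by (simp add: filterlim_at_top_dense)

lemma inv_s: "(\<lambda>k. c / s k) \<longlonglongrightarrow> 0"
  using s_top by (intro tendsto_divide_0[OF tendsto_const] filterlim_at_top_imp_at_infinity)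

lemma y_pos: "\<forall>\<^sub>F k in sequentially. 0 < y k"
proof -
  have "\<forall>\<^sub>F k in sequentially. 0 < y k / (s k / real k) powr \<alpha>" using y \<tau> by (rule order_tendstoD)
  then show ?thesis by eventually_elim (simp add: zero_less_divide_iff)
qed

lemma draws_ratio: "(\<lambda>k. (c + real (k - e)) / real k) \<longlonglongrightarrow> 1"
proof -
  have "(\<lambda>k. 1 + (c - real e) / real k) \<longlonglongrightarrow> 1 + 0"
    by (intro tendsto_intros tendsto_divide_0[OF tendsto_const] filterlim_at_top_imp_at_infinity filterlim_real_sequentially)
  moreover have "\<forall>\<^sub>F k in sequentially. 1 + (c - real e) / real k = (c + real (k - e)) / real k"
    using eventually_ge_at_top[of "max 1 e"] by eventually_elim (simp add: of_nat_diff field_simps)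
  ultimately show ?thesis by (simp add: tendsto_cong)
qed

text \<open>For \<open>v = c s/k\<close> the bound of \<open>gcoeff_sum_upper\<close> is \<open>exp (c s)\<close> up to powers of \<open>s\<close>. The
  argument of the binomial series there tends to a limit below \<open>1\<close> iff \<open>c\<close> exceeds \<open>\<tau>\<close> to the power \<open>1/\<alpha>\<close>, so
  \<open>c\<close> can be chosen arbitrarily close to this value.\<close>
lemma upper:
  assumes g: "\<And>k r. 0 \<le> g k r" "\<And>k r. g k r \<le> gcoeff \<alpha> x B (k - e) r"
    and S: "\<forall>\<^sub>F k in sequentially. (\<lambda>r. y k ^ r * g k r) sums S k"
    and pos: "\<forall>\<^sub>F k in sequentially. 0 < S k" and a: "\<tau> powr (1 / \<alpha>) < a"
  shows "\<forall>\<^sub>F k in sequentially. ln (S k) / s k < a"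
proof -
  define c where "c = (\<tau> powr (1 / \<alpha>) + a) / 2"
  have c: "\<tau> powr (1 / \<alpha>) < c" "c < a" "0 < c"
  proof -
    have "0 \<le> \<tau> powr (1 / \<alpha>)" by simp
    then have "0 < \<tau> powr (1 / \<alpha>) + a" using a le_less_trans by (intro add_nonneg_pos) blast+
    then show "\<tau> powr (1 / \<alpha>) < c" "c < a" "0 < c" using a by (simp_all add: c_def)
  qed
  define v where "v = (\<lambda>k. c * (s k / real k))"
  define \<theta> where "\<theta> = (\<lambda>k. y k * v k powr (- \<alpha>))"
  define L where "L = (\<lambda>k. nat \<lceil>real k / s k\<rceil>)"
  define m where "m = (\<lambda>k. k - e)"
  (* H collects the factors that converge to a positive limit. *)
  define H where "H = (\<lambda>k. Gamma_series B (m k) * ((B + real (m k)) / real k) * (real k / real (m k)) powr B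
      * c powr (- B) * (1 - \<theta> k) powr (- x))"
  have v0: "v \<longlonglongrightarrow> 0" unfolding v_def using tendsto_mult[OF tendsto_const s_small, of c] by simp
  have v_pos: "\<forall>\<^sub>F k in sequentially. 0 < v k"
    using s_pos eventually_gt_at_top[of 0] by eventually_elim (use c in \<open>auto simp: v_def\<close>)
  have v_lt: "\<forall>\<^sub>F k in sequentially. v k < 1" using v0 by (rule order_tendstoD) simp
  have \<theta>_lim: "\<theta> \<longlonglongrightarrow> \<tau> * c powr (- \<alpha>)"
  proof -
    have "\<forall>\<^sub>F k in sequentially. y k / (s k / real k) powr \<alpha> * c powr (- \<alpha>) = \<theta> k"
      using s_pos
    proof eventually_elim
      case (elim k)
      show ?case unfolding \<theta>_def v_def powr_mult by (simp add: powr_minus_divide)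
    qed
    with tendsto_mult[OF y tendsto_const[of "c powr (- \<alpha>)"]] show ?thesis
      by (rule Lim_transform_eventually)
  qed
  have \<theta>_small: "\<tau> * c powr (- \<alpha>) < 1"
  proof -
    have "(\<tau> powr (1 / \<alpha>)) powr \<alpha> < c powr \<alpha>" using c \<alpha> by (intro powr_less_mono2) auto
    then show ?thesis using \<alpha> \<tau> c by (simp add: powr_powr powr_minus field_simps)
  qed
  then have \<theta>_lt: "\<forall>\<^sub>F k in sequentially. \<theta> k < 1" using \<theta>_lim by (intro order_tendstoD(2))
  have m_ratio: "(\<lambda>k. (b + real (m k)) / real k) \<longlonglongrightarrow> 1" for b unfolding m_def by (rule draws_ratio)
  have m_top: "filterlim m at_top sequentially" unfolding m_def
    by (simp add: filterlim_minus_const_nat_at_top)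
  have "(\<lambda>k. inverse (real (m k) / real k)) \<longlonglongrightarrow> inverse 1"
    using m_ratio[of 0] by (intro tendsto_inverse) auto
  then have km: "(\<lambda>k. real k / real (m k)) \<longlonglongrightarrow> 1" by (simp add: inverse_eq_divide)
  have Gam: "(\<lambda>k. Gamma_series B (m k)) \<longlonglongrightarrow> Gamma B"
    by (rule filterlim_compose[OF Gamma_series_LIMSEQ m_top])
  define H\<^sub>0 where "H\<^sub>0 = Gamma B * 1 * 1 powr B * c powr (- B) * (1 - \<tau> * c powr (- \<alpha>)) powr (- x)"
  have H_lim: "H \<longlonglongrightarrow> H\<^sub>0"
    unfolding H_def H\<^sub>0_def using \<theta>_small by (intro tendsto_intros Gam m_ratio km \<theta>_lim) auto
  have H_pos: "0 < H\<^sub>0" using B c \<theta>_small by (simp add: H\<^sub>0_def Gamma_real_pos)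
  have ln_s: "(\<lambda>k. ln (s k) / s k) \<longlonglongrightarrow> 0"
    by (rule filterlim_compose[OF ln_x_over_x_tendsto_0 s_top])
  (* The window length L is of order k/s and hence negligible against k. *)
  have exponent: "(\<lambda>k. - (real (m k + L k) * ln (1 - v k)) / s k) \<longlonglongrightarrow> c"
  proof -
    have "(\<lambda>k. (real (m k) + real (L k)) / real k) \<longlonglongrightarrow> 1 + 0"
      unfolding add_divide_distrib
    proof (intro tendsto_add)
      show "(\<lambda>k. real (m k) / real k) \<longlonglongrightarrow> 1" using m_ratio[of 0] by simp
      show "(\<lambda>k. real (L k) / real k) \<longlonglongrightarrow> 0"
      proof (rule tendsto_sandwich[OF _ _ tendsto_const])
        have "(\<lambda>k. 1 / s k + 1 / real k) \<longlonglongrightarrow> 0 + 0"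
          by (intro tendsto_add inv_s tendsto_divide_0[OF tendsto_const] filterlim_at_top_imp_at_infinity filterlim_real_sequentially)
        then show "(\<lambda>k. 1 / s k + 1 / real k) \<longlonglongrightarrow> 0" by simp
        show "\<forall>\<^sub>F k in sequentially. real (L k) / real k \<le> 1 / s k + 1 / real k"
          using s_pos eventually_gt_at_top[of 0]
        proof eventually_elim
          case (elim k)
          have "real (L k) \<le> real k / s k + 1" using elim by (simp add: L_def)
          then have "real (L k) / real k \<le> (real k / s k + 1) / real k" by (intro divide_right_mono) auto
          also have "\<dots> = 1 / s k + 1 / real k" using elim by (simp add: add_divide_distrib)
          finally show ?case .
        qed
      qed simp
    qed
    moreover have "(\<lambda>k. ln (1 + - v k) / (- v k)) \<longlonglongrightarrow> 1"
    proof -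
      have "((\<lambda>h. (ln (1 + h) - ln 1) / h) \<longlongrightarrow> 1) (at (0::real))"
        using DERIV_ln[of "1::real"] unfolding DERIV_def by simp
      moreover have "filterlim (\<lambda>k. - v k) (at 0) sequentially"
        unfolding filterlim_at
      proof
        show "\<forall>\<^sub>F k in sequentially. - v k \<in> UNIV \<and> - v k \<noteq> 0"
          using v_pos by eventually_elim simp
        show "(\<lambda>k. - v k) \<longlonglongrightarrow> 0" using tendsto_minus[OF v0] by simp
      qed
      ultimately have "(\<lambda>k. (ln (1 + - v k) - ln 1) / (- v k)) \<longlonglongrightarrow> 1"
        by (rule filterlim_compose)
      then show ?thesis by simp
    qed
    ultimately have "(\<lambda>k. (real (m k) + real (L k)) / real k * c * (ln (1 + - v k) / (- v k))) \<longlonglongrightarrow> (1 + 0) * c * 1"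
      by (intro tendsto_intros)
    moreover have "\<forall>\<^sub>F k in sequentially. (real (m k) + real (L k)) / real k * c * (ln (1 + - v k) / (- v k))
        = - (real (m k + L k) * ln (1 - v k)) / s k"
      using s_pos eventually_gt_at_top[of 0]
    proof eventually_elim
      case (elim k)
      then show ?case using c by (simp add: v_def)
    qed
    ultimately have "(\<lambda>k. - (real (m k + L k) * ln (1 - v k)) / s k) \<longlonglongrightarrow> (1 + 0) * c * 1"
      by (rule Lim_transform_eventually)
    then show ?thesis by simp
  qed
  have "(\<lambda>k. ln (H k) * (1 / s k) + (1 - B) * (ln (s k) / s k) + - (real (m k + L k) * ln (1 - v k)) / s k)
      \<longlonglongrightarrow> ln H\<^sub>0 * 0 + (1 - B) * 0 + c"
    using H_pos by (intro tendsto_intros H_lim inv_s ln_s exponent) auto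
  then have "\<forall>\<^sub>F k in sequentially. ln (H k) * (1 / s k) + (1 - B) * (ln (s k) / s k)
      + - (real (m k + L k) * ln (1 - v k)) / s k < (a + c) / 2"
    using c by (intro order_tendstoD(2)) auto
  moreover have "\<forall>\<^sub>F k in sequentially. 0 < H k" using H_lim H_pos by (rule order_tendstoD)
  moreover have "\<forall>\<^sub>F k in sequentially. ln 2 / s k < (a - c) / 2"
    using c by (intro order_tendstoD(2)[OF inv_s]) auto
  moreover have "\<forall>\<^sub>F k in sequentially. 0 < m k"
    using filterlim_at_top[THEN iffD1, OF m_top, rule_format, of 1] by eventually_elim simp
  ultimately show ?thesis
    using s_pos v_pos v_lt \<theta>_lt y_pos S pos eventually_gt_at_top[of 0]
  proof eventually_elim
    case (elim k)
    note bound = elim(1) and Hpos = elim(2) and small = elim(3) and mpos = elim(4) and s1 = elim(5)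
    define E where "E = fact (m k) / pochhammer B (m k) * v k powr (- B) / (real (L k) * (1 - v k) ^ (m k + L k))
                 * (1 - \<theta> k) powr (- x)"
    have L: "1 \<le> L k" "real k / s k \<le> real (L k)"
    proof -
      have "0 < real k / s k" using elim by simp
      then show "1 \<le> L k" unfolding L_def by linarith
      show "real k / s k \<le> real (L k)" unfolding L_def by (rule real_nat_ceiling_ge)
    qed
    have S_le: "S k \<le> 1 + E"
      unfolding E_def \<theta>_def m_def
      using \<alpha> x B elim g L by (intro gcoeff_sum_upper[of \<alpha> x B "v k" "y k" "L k" "g k"]) (auto simp: \<theta>_def)
    have "E \<le> H k * s k powr (1 - B) * exp (- (real (m k + L k) * ln (1 - v k)))"
    proof -
      define W where "W = fact (m k) / pochhammer B (m k) * v k powr (- B)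
        * exp (- (real (m k + L k) * ln (1 - v k))) * (1 - \<theta> k) powr (- x)"
      have "0 \<le> W" unfolding W_def using B
        by (auto intro!: mult_nonneg_nonneg divide_nonneg_nonneg pochhammer_nonneg)
      have "(1 - v k) ^ (m k + L k) = exp (real (m k + L k) * ln (1 - v k))"
        using elim by (simp add: exp_of_nat_mult del: of_nat_add)
      then have "E = W / real (L k)" by (simp add: E_def W_def exp_minus divide_inverse mult_ac)
      also have "\<dots> \<le> W / (real k / s k)"
        using \<open>0 \<le> W\<close> L s1 elim by (intro divide_left_mono) auto
      also have "\<dots> = H k * s k powr (1 - B) * exp (- (real (m k + L k) * ln (1 - v k)))"
      proof -
        have 1: "fact (m k) / pochhammer B (m k) = Gamma_series B (m k) * (B + real (m k)) * real (m k) powr (- B)"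
          using B mpos by (intro fact_over_pochhammer) auto
        have 2: "v k powr (- B) = c powr (- B) * (s k powr (- B) * real k powr B)"
          using c s1 by (simp add: v_def powr_mult powr_divide powr_minus_divide)
        have 3: "(real k / real (m k)) powr B = real k powr B * real (m k) powr (- B)"
          by (simp add: powr_divide powr_minus_divide)
        have 4: "s k powr (1 - B) = s k * s k powr (- B)" using s1 by (simp add: powr_diff powr_minus_divide)
        show ?thesis unfolding W_def H_def 1 2 3 4 by (simp add: divide_inverse mult_ac)
      qed
      finally show ?thesis .
    qed
    also have "\<dots> = exp (s k * (ln (H k) * (1 / s k) + (1 - B) * (ln (s k) / s k)
      + - (real (m k + L k) * ln (1 - v k)) / s k))"
    proof -
      have "s k * (ln (H k) * (1 / s k) + (1 - B) * (ln (s k) / s k) + - (real (m k + L k) * ln (1 - v k)) / s k)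
          = ln (H k) + (1 - B) * ln (s k) + - (real (m k + L k) * ln (1 - v k))"
        using s1 by (simp add: distrib_left right_diff_distrib)
      then show ?thesis using Hpos s1 by (simp only: exp_add) (simp add: powr_def)
    qed
    also have "\<dots> \<le> exp (s k * ((a + c) / 2))" using bound s1 by simp
    finally have "S k \<le> 1 + exp (s k * ((a + c) / 2))" using S_le by simp
    also have "\<dots> \<le> 2 * exp (s k * ((a + c) / 2))" using s1 c by simp
    finally have "ln (S k) \<le> ln (2 * exp (s k * ((a + c) / 2)))" using elim by (intro ln_mono) auto
    then have "ln (S k) \<le> ln 2 + s k * ((a + c) / 2)" by (simp add: ln_mult)
    then have "ln (S k) / s k \<le> (ln 2 + s k * ((a + c) / 2)) / s k" using s1 by (intro divide_right_mono) auto
    also have "\<dots> = ln 2 / s k + (a + c) / 2" using s1 by (simp add: add_divide_distrib)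
    finally show ?case using small by argo
  qed
qed

text \<open>The single term with index \<open>R\<close> is bounded below by \<open>pochhammer_ratio_lower\<close>. The index is chosen at the
  maximum of the exponent: with \<open>\<alpha> R\<close> asymptotic to \<open>\<tau>\<close> to the power \<open>1/\<alpha>\<close> times \<open>s\<close>, the base of the power \<open>R\<close>, called
  \<open>V\<close> below, tends to \<open>1\<close> and only \<open>exp (\<alpha> R)\<close> remains.\<close>
lemma lower:
  assumes g: "\<And>k r. 0 \<le> g k r"
    and R: "(\<lambda>k. real (R k) / s k) \<longlonglongrightarrow> \<tau> powr (1 / \<alpha>) / \<alpha>" and \<epsilon>: "\<epsilon> \<longlonglongrightarrow> 0"
    and g_lower: "\<forall>\<^sub>F k in sequentially. gcoeff \<alpha> x B (k - e) (R k) * exp (- (\<epsilon> k * s k)) \<le> g k (R k)"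
    and S: "\<forall>\<^sub>F k in sequentially. (\<lambda>r. y k ^ r * g k r) sums S k"
    and a: "a < \<tau> powr (1 / \<alpha>)"
  shows "\<forall>\<^sub>F k in sequentially. a < ln (S k) / s k"
proof -
  define \<sigma> where "\<sigma> = \<tau> powr (1 / \<alpha>)"
  have \<sigma>: "0 < \<sigma>" using \<tau> by (simp add: \<sigma>_def)
  define m where "m = (\<lambda>k. k - e)"
  define b where "b = (\<lambda>k. B + \<alpha> * real (R k))"
  define V where "V = (\<lambda>k. y k / (s k / real k) powr \<alpha> * ((B + real (m k)) / real k) powr \<alpha> * (s k / b k) powr \<alpha>)"
  have R_top: "filterlim (\<lambda>k. real (R k)) at_top sequentially"
  proof -
    have "filterlim (\<lambda>k. real (R k) / s k * s k) at_top sequentially"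
      using \<sigma> \<alpha> by (intro filterlim_tendsto_pos_mult_at_top[OF R _ s_top]) (simp add: \<sigma>_def)
    moreover have "\<forall>\<^sub>F k in sequentially. real (R k) / s k * s k = real (R k)"
      using s_pos by eventually_elim simp
    ultimately show ?thesis by (rule filterlim_cong[OF refl refl, THEN iffD1, rotated])
  qed
  have b_s: "(\<lambda>k. b k / s k) \<longlonglongrightarrow> \<sigma>"
  proof -
    have "(\<lambda>k. B / s k + \<alpha> * (real (R k) / s k)) \<longlonglongrightarrow> 0 + \<alpha> * (\<sigma> / \<alpha>)"
      unfolding \<sigma>_def by (intro tendsto_intros inv_s R)
    then show ?thesis using \<alpha> by (simp add: b_def add_divide_distrib)
  qed
  have b_pos: "0 < b k" for k using B \<alpha> by (auto simp: b_def intro: add_pos_nonneg)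
  have "(\<lambda>k. inverse (b k / s k)) \<longlonglongrightarrow> inverse \<sigma>" using b_s \<sigma> by (intro tendsto_inverse) auto
  then have s_b: "(\<lambda>k. s k / b k) \<longlonglongrightarrow> 1 / \<sigma>" by (simp add: inverse_eq_divide)
  have "V \<longlonglongrightarrow> \<tau> * 1 powr \<alpha> * (1 / \<sigma>) powr \<alpha>"
    unfolding V_def m_def using \<sigma> by (intro tendsto_intros y draws_ratio s_b) auto
  moreover have "\<tau> * 1 powr \<alpha> * (1 / \<sigma>) powr \<alpha> = 1"
    using \<tau> \<alpha> by (simp add: \<sigma>_def powr_divide powr_powr)
  ultimately have V: "V \<longlonglongrightarrow> 1" by simp
  have ln_R: "(\<lambda>k. ln (real (R k)) / s k) \<longlonglongrightarrow> 0"
  proof -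
    have "(\<lambda>k. ln (real (R k)) / real (R k) * (real (R k) / s k)) \<longlonglongrightarrow> 0 * (\<sigma> / \<alpha>)"
      unfolding \<sigma>_def by (intro tendsto_mult R filterlim_compose[OF ln_x_over_x_tendsto_0 R_top])
    moreover have "ln (real (R k)) / real (R k) * (real (R k) / s k) = ln (real (R k)) / s k" for k by simp
    ultimately show ?thesis by (simp only: mult_zero_left)
  qed
  have ln_b: "(\<lambda>k. ln (b k) / s k) \<longlonglongrightarrow> 0"
  proof -
    have "filterlim (\<lambda>k. \<alpha> * real (R k)) at_top sequentially"
      using \<alpha> by (intro filterlim_tendsto_pos_mult_at_top[OF tendsto_const _ R_top]) auto
    then have "filterlim b at_top sequentially"
      unfolding b_def by (rule filterlim_tendsto_add_at_top[OF tendsto_const])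
    then have "(\<lambda>k. ln (b k) / b k * (b k / s k)) \<longlonglongrightarrow> 0 * \<sigma>"
      by (intro tendsto_mult b_s filterlim_compose[OF ln_x_over_x_tendsto_0])
    moreover have "ln (b k) / b k * (b k / s k) = ln (b k) / s k" for k using b_pos[of k] by simp
    ultimately show ?thesis by (simp only: mult_zero_left)
  qed
  define A where "A = (\<lambda>k. real (R k) / s k * ln (V k) + \<alpha> * (real (R k) / s k) + (ln x + B * ln B) / s k
    - ln (real (R k)) / s k - B * (ln (b k) / s k) - \<epsilon> k)"
  have "A \<longlonglongrightarrow> (\<sigma> / \<alpha>) * ln 1 + \<alpha> * (\<sigma> / \<alpha>) + 0 - 0 - B * 0 - 0"
    unfolding A_def by (intro tendsto_intros inv_s R[folded \<sigma>_def] V ln_R ln_b \<epsilon>) auto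
  then have "A \<longlonglongrightarrow> \<sigma>" using \<alpha> by simp
  then have "\<forall>\<^sub>F k in sequentially. a < A k" using a unfolding \<sigma>_def by (intro order_tendstoD(1))
  moreover have "\<forall>\<^sub>F k in sequentially. 1 \<le> real (R k)"
    using R_top unfolding filterlim_at_top by blast
  ultimately show ?thesis
    using s_pos y_pos S g_lower eventually_gt_at_top[of 0]
  proof eventually_elim
    case (elim k)
    note A = elim(1) and R1 = elim(2) and s1 = elim(3) and y0 = elim(4) and k0 = elim(7)
    have Bm: "0 < B + real (m k)" using B by (simp add: add_pos_nonneg)
    have "V k = y k * real k powr \<alpha> * s k powr (- \<alpha>) * ((B + real (m k)) powr \<alpha> * real k powr (- \<alpha>)) * (s k powr \<alpha> * b k powr (- \<alpha>))"
      using s1 Bm b_pos[of k] unfolding V_def by (simp add: powr_divide powr_minus_divide)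
    then have V_eq: "V k = y k * (B + real (m k)) powr \<alpha> * b k powr (- \<alpha>)"
      using s1 k0 by (simp add: powr_minus_divide)
    have ln_V: "ln (V k) = ln (y k) + \<alpha> * ln (B + real (m k)) - \<alpha> * ln (b k)"
      unfolding V_eq using y0 Bm b_pos[of k] by (simp add: ln_mult_pos ln_powr)
    have "exp (s k * A k) = exp (real (R k) * ln (y k)) * (x / real (R k)
        * exp (\<alpha> * real (R k) * ln (B + real (m k)) + \<alpha> * real (R k) - b k * ln (b k) + B * ln B))
        * exp (- (\<epsilon> k * s k))"
    proof -
      have "s k * A k = real (R k) * ln (V k) + \<alpha> * real (R k) + (ln x + B * ln B)
         - ln (real (R k)) - B * ln (b k) - \<epsilon> k * s k"
        using s1 by (simp add: A_def field_simps)
      also have "\<dots> = real (R k) * ln (y k) + (ln x - ln (real (R k))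
        + (\<alpha> * real (R k) * ln (B + real (m k)) + \<alpha> * real (R k) - b k * ln (b k) + B * ln B)) + - (\<epsilon> k * s k)"
        unfolding ln_V by (simp add: b_def algebra_simps)
      finally have "exp (s k * A k) = exp (real (R k) * ln (y k)) * (exp (ln x - ln (real (R k)))
        * exp (\<alpha> * real (R k) * ln (B + real (m k)) + \<alpha> * real (R k) - b k * ln (b k) + B * ln B))
        * exp (- (\<epsilon> k * s k))"
        by (simp only: exp_add)
      moreover have "exp (ln x - ln (real (R k))) = x / real (R k)" using x R1 by (simp add: exp_diff)
      ultimately show ?thesis by simp
    qed
    also have "\<dots> \<le> y k ^ R k * gcoeff \<alpha> x B (m k) (R k) * exp (- (\<epsilon> k * s k))"
    proof (intro mult_right_mono mult_mono)
      show "exp (real (R k) * ln (y k)) \<le> y k ^ R k" using y0 by (simp add: exp_of_nat_mult)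
      have "x / real (R k) * exp (\<alpha> * real (R k) * ln (B + real (m k)) + \<alpha> * real (R k) - b k * ln (b k) + B * ln B)
          \<le> pochhammer x (R k) / fact (R k) * (pochhammer (B + \<alpha> * real (R k)) (m k) / pochhammer B (m k))"
        using x R1 B \<alpha> unfolding b_def
        by (intro mult_mono pochhammer_fact_lower pochhammer_ratio_lower) (auto simp: pochhammer_nonneg)
      then show "x / real (R k) * exp (\<alpha> * real (R k) * ln (B + real (m k)) + \<alpha> * real (R k) - b k * ln (b k) + B * ln B)
          \<le> gcoeff \<alpha> x B (m k) (R k)" by (simp add: gcoeff_def)
    qed (use x y0 in auto)
    also have "\<dots> \<le> y k ^ R k * g k (R k)"
      using mult_left_mono[OF elim(6), of "y k ^ R k"] y0 by (simp add: m_def mult.assoc)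
    also have "\<dots> \<le> S k"
    proof -
      have "(\<Sum>r\<in>{R k}. y k ^ r * g k r) \<le> (\<Sum>r. y k ^ r * g k r)"
        using elim(5) y0 g by (intro sum_le_suminf) (auto simp: sums_iff)
      then show ?thesis using elim(5) by (simp add: sums_iff)
    qed
    finally have le: "exp (s k * A k) \<le> S k" .
    then have "s k * A k \<le> ln (S k)" by (subst ln_ge_iff) (auto intro: less_le_trans[OF exp_gt_zero])
    then have "A k \<le> ln (S k) / s k" using s1 by (simp add: field_simps)
    then show ?case using A by simp
  qed
qed

text \<open>The coefficients may be replaced by smaller ones as long as they agree with \<open>gcoeff\<close> up to a factor
  \<open>exp (- o(s))\<close> at indices of order \<open>s\<close>.\<close>
theorem limit:
  assumes g: "\<And>k r. 0 \<le> g k r" "\<And>k r. g k r \<le> gcoeff \<alpha> x B (k - e) r"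
    and g_lower: "\<And>R. (\<lambda>k. real (R k) / s k) \<longlonglongrightarrow> \<tau> powr (1 / \<alpha>) / \<alpha> \<Longrightarrow>
      \<exists>\<epsilon>. \<epsilon> \<longlonglongrightarrow> 0 \<and> (\<forall>\<^sub>F k in sequentially. gcoeff \<alpha> x B (k - e) (R k) * exp (- (\<epsilon> k * s k)) \<le> g k (R k))"
    and S: "\<forall>\<^sub>F k in sequentially. (\<lambda>r. y k ^ r * g k r) sums S k"
    and pos: "\<forall>\<^sub>F k in sequentially. 0 < S k"
  shows "(\<lambda>k. ln (S k) / s k) \<longlonglongrightarrow> \<tau> powr (1 / \<alpha>)"
proof -
  define \<rho> where "\<rho> = \<tau> powr (1 / \<alpha>) / \<alpha>"
  define R where "R = (\<lambda>k. nat \<lfloor>\<rho> * s k\<rfloor>)"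
  have \<rho>: "0 \<le> \<rho>" using \<alpha> by (simp add: \<rho>_def)
  have R: "(\<lambda>k. real (R k) / s k) \<longlonglongrightarrow> \<rho>"
  proof (rule tendsto_sandwich)
    show "\<forall>\<^sub>F k in sequentially. \<rho> - 1 / s k \<le> real (R k) / s k"
      using s_pos
    proof eventually_elim
      case (elim k)
      have "\<rho> * s k - 1 \<le> real (R k)" unfolding R_def using \<rho> elim by linarith
      then have "(\<rho> * s k - 1) / s k \<le> real (R k) / s k" using elim by (intro divide_right_mono) auto
      then show ?case using elim by (simp add: diff_divide_distrib)
    qed
    show "\<forall>\<^sub>F k in sequentially. real (R k) / s k \<le> \<rho>"
      using s_pos
    proof eventually_elim
      case (elim k)
      have "0 \<le> \<rho> * s k" using \<rho> elim by simp
      then have "real (R k) \<le> \<rho> * s k" unfolding R_def by linarith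
      then show ?case using elim by (simp add: field_simps)
    qed
    show "(\<lambda>k. \<rho> - 1 / s k) \<longlonglongrightarrow> \<rho>" using tendsto_diff[OF tendsto_const inv_s, of \<rho> 1] by simp
  qed simp
  obtain \<epsilon> where \<epsilon>: "\<epsilon> \<longlonglongrightarrow> 0"
    "\<forall>\<^sub>F k in sequentially. gcoeff \<alpha> x B (k - e) (R k) * exp (- (\<epsilon> k * s k)) \<le> g k (R k)"
    using g_lower[of R] R unfolding \<rho>_def by blast
  show ?thesis
  proof (rule order_tendstoI)
    fix a assume "a < \<tau> powr (1 / \<alpha>)"
    then show "\<forall>\<^sub>F k in sequentially. a < ln (S k) / s k"
      by (rule lower[OF g(1) R[unfolded \<rho>_def] \<epsilon> S])
  next
    fix a assume "\<tau> powr (1 / \<alpha>) < a"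
    then show "\<forall>\<^sub>F k in sequentially. ln (S k) / s k < a"
      by (rule upper[OF g S pos])
  qed
qed

end

context moderate_regime
begin

lemma gcoeff_limit:
  assumes S: "\<forall>\<^sub>F k in sequentially. (\<lambda>r. y k ^ r * gcoeff \<alpha> x B (k - e) r) sums S k"
    and pos: "\<forall>\<^sub>F k in sequentially. 0 < S k"
  shows "(\<lambda>k. ln (S k) / s k) \<longlonglongrightarrow> \<tau> powr (1 / \<alpha>)"
proof (rule limit[OF _ _ _ S pos])
  show "0 \<le> gcoeff \<alpha> x B (k - e) r" for k r using gcoeff_pos[OF \<alpha>(1) x B(1)] by (simp add: less_imp_le)
  fix R :: "nat \<Rightarrow> nat"
  show "\<exists>\<epsilon>. \<epsilon> \<longlonglongrightarrow> 0 \<and> (\<forall>\<^sub>F k in sequentially. gcoeff \<alpha> x B (k - e) (R k) * exp (- (\<epsilon> k * s k)) \<le> gcoeff \<alpha> x B (k - e) (R k))"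
    by (rule exI[of _ "\<lambda>_. 0"]) simp
qed simp

text \<open>At indices of order \<open>s\<close>, the two families of coefficients differ by a factor \<open>exp (- O(s * s / k))\<close>, and
  \<open>s / k\<close> tends to \<open>0\<close>.\<close>
lemma freq_coeff_limit:
  assumes S: "\<forall>\<^sub>F k in sequentially. (\<lambda>r. y k ^ r * freq_coeff \<alpha> x B l (k - e) r) sums S k"
    and pos: "\<forall>\<^sub>F k in sequentially. 0 < S k"
  shows "(\<lambda>k. ln (S k) / s k) \<longlonglongrightarrow> \<tau> powr (1 / \<alpha>)"
proof (rule limit[OF freq_coeff_nonneg[OF \<alpha>(1) x B(1)] freq_coeff_le[OF \<alpha>(1) x B] _ S pos])
  fix R :: "nat \<Rightarrow> nat" assume R: "(\<lambda>k. real (R k) / s k) \<longlonglongrightarrow> \<tau> powr (1 / \<alpha>) / \<alpha>"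
  define \<epsilon> where "\<epsilon> = (\<lambda>k. real (R k * l) * (B + \<alpha> * real (R k) - 1) / (real (k - e - R k * l) + 1) / s k)"
  have R_k: "(\<lambda>k. real (R k) / real k) \<longlonglongrightarrow> 0"
  proof -
    have "(\<lambda>k. real (R k) / s k * (s k / real k)) \<longlonglongrightarrow> \<tau> powr (1 / \<alpha>) / \<alpha> * 0"
      by (intro tendsto_mult R s_small)
    moreover have "\<forall>\<^sub>F k in sequentially. real (R k) / s k * (s k / real k) = real (R k) / real k"
      using s_pos by eventually_elim simp
    ultimately show ?thesis using Lim_transform_eventually by fastforce
  qed
  have rest: "(\<lambda>k. (1 + real (k - e)) / real k - real l * (real (R k) / real k)) \<longlonglongrightarrow> 1"
    using tendsto_diff[OF draws_ratio[of 1] tendsto_mult[OF tendsto_const[of "real l"] R_k]] by simp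
  have pos': "\<forall>\<^sub>F k in sequentially. 1 / 2 < (1 + real (k - e)) / real k - real l * (real (R k) / real k)"
    using rest by (rule order_tendstoD) simp
  have fits: "\<forall>\<^sub>F k in sequentially. R k * l \<le> k - e"
    using pos' eventually_ge_at_top[of 2]
  proof eventually_elim
    case (elim k)
    have "1 / 2 < (1 + real (k - e) - real l * real (R k)) / real k"
      using elim by (simp add: diff_divide_distrib)
    then have "1 / 2 * real k < 1 + real (k - e) - real l * real (R k)"
      using elim by (simp add: field_simps)
    then have "real (l * R k) \<le> real (k - e)" using elim by simp
    then show ?case by (simp only: of_nat_le_iff mult.commute)
  qed
  have "(\<lambda>k. real l * (real (R k) / s k) * ((B - 1) / real k + \<alpha> * (real (R k) / real k))
      / ((1 + real (k - e)) / real k - real l * (real (R k) / real k)))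
      \<longlonglongrightarrow> real l * (\<tau> powr (1 / \<alpha>) / \<alpha>) * (0 + \<alpha> * 0) / 1"
    by (intro tendsto_intros R R_k rest tendsto_divide_0[OF tendsto_const] filterlim_at_top_imp_at_infinity filterlim_real_sequentially) auto
  moreover have "\<forall>\<^sub>F k in sequentially. real l * (real (R k) / s k) * ((B - 1) / real k + \<alpha> * (real (R k) / real k))
      / ((1 + real (k - e)) / real k - real l * (real (R k) / real k)) = \<epsilon> k"
    using fits s_pos eventually_gt_at_top[of 0]
  proof eventually_elim
    case (elim k)
    have "(1 + real (k - e)) / real k - real l * (real (R k) / real k) = (real (k - e - R k * l) + 1) / real k"
      unfolding of_nat_diff[OF elim(1)] by (simp add: diff_divide_distrib add_divide_distrib mult.commute)
    moreover have "(B - 1) / real k + \<alpha> * (real (R k) / real k) = (B + \<alpha> * real (R k) - 1) / real k"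
      by (simp add: diff_divide_distrib add_divide_distrib)
    ultimately show ?case using elim by (simp add: \<epsilon>_def mult_ac)
  qed
  ultimately have "\<epsilon> \<longlonglongrightarrow> real l * (\<tau> powr (1 / \<alpha>) / \<alpha>) * (0 + \<alpha> * 0) / 1"
    by (rule Lim_transform_eventually)
  then have "\<epsilon> \<longlonglongrightarrow> 0" by simp
  moreover have R1: "\<forall>\<^sub>F k in sequentially. 1 \<le> R k"
  proof -
    have "\<forall>\<^sub>F k in sequentially. 0 < real (R k) / s k"
      using R by (rule order_tendstoD) (use \<tau> \<alpha> in simp)
    then show ?thesis using s_pos by eventually_elim (simp add: zero_less_divide_iff Suc_le_eq)
  qed
  moreover have "\<forall>\<^sub>F k in sequentially. gcoeff \<alpha> x B (k - e) (R k) * exp (- (\<epsilon> k * s k)) \<le> freq_coeff \<alpha> x B l (k - e) (R k)"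
    using fits R1 s_pos
  proof eventually_elim
    case (elim k)
    then have "\<epsilon> k * s k = real (R k * l) * (B + \<alpha> * real (R k) - 1) / (real (k - e - R k * l) + 1)"
      by (simp add: \<epsilon>_def)
    then show ?case using freq_coeff_ge[OF \<alpha>(1) x B elim(2,1)] by simp
  qed
  ultimately show "\<exists>\<epsilon>. \<epsilon> \<longlonglongrightarrow> 0 \<and> (\<forall>\<^sub>F k in sequentially. gcoeff \<alpha> x B (k - e) (R k) * exp (- (\<epsilon> k * s k)) \<le> freq_coeff \<alpha> x B l (k - e) (R k))"
    by blast
qed

end

section \<open>From Laplace transforms to large deviations\<close>

lemma (in prob_space) expectation_exp_pos:
  fixes f :: "'a \<Rightarrow> real"
  assumes int: "integrable M (\<lambda>\<omega>. exp (f \<omega>))"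
  shows "0 < (\<integral>\<omega>. exp (f \<omega>) \<partial>M)"
proof -
  have "(\<integral>\<omega>. exp (f \<omega>) \<partial>M) \<noteq> 0"
  proof
    assume "(\<integral>\<omega>. exp (f \<omega>) \<partial>M) = 0"
    then have "AE \<omega> in M. exp (f \<omega>) = 0" using integral_nonneg_eq_0_iff_AE[OF int] by simp
    then show False by (simp add: AE_False)
  qed
  moreover have "0 \<le> (\<integral>\<omega>. exp (f \<omega>) \<partial>M)" by (rule Bochner_Integration.integral_nonneg) simp
  ultimately show ?thesis by linarith
qed

text \<open>A one-dimensional Gartner-Ellis argument for nonnegative variables, from the limit of the log-Laplace
  transforms at positive arguments only.\<close>
locale laplace_limit = prob_space Q for Q :: "'w measure" +
  fixes Z :: "nat \<Rightarrow> 'w \<Rightarrow> real" and s :: "nat \<Rightarrow> real" and \<Lambda> :: "real \<Rightarrow> real"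
  assumes meas [measurable]: "\<And>k. Z k \<in> borel_measurable Q"
    and nonneg: "\<And>k \<omega>. \<omega> \<in> space Q \<Longrightarrow> 0 \<le> Z k \<omega>"
    and int: "\<And>k t. integrable Q (\<lambda>\<omega>. exp (t * s k * Z k \<omega>))"
    and speed_top: "filterlim s at_top sequentially"
    and lim: "\<And>t. 0 < t \<Longrightarrow> log_laplace Q Z s t \<longlonglongrightarrow> \<Lambda> t"
begin

lemma speed_pos: "\<forall>\<^sub>F k in sequentially. s k > 0"
  using speed_top by (simp add: filterlim_at_top_dense)

lemma laplace_pos: "0 < (\<integral>\<omega>. exp (t * s k * Z k \<omega>) \<partial>Q)"
  by (rule expectation_exp_pos[OF int])

lemma laplace_eq_exp:
  "0 < s k \<Longrightarrow> (\<integral>\<omega>. exp (t * s k * Z k \<omega>) \<partial>Q) = exp (s k * log_laplace Q Z s t k)"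
  using laplace_pos by (simp add: log_laplace_def)

lemma upper_tail:
  assumes "0 < s k" "0 < t"
  shows "prob {\<omega> \<in> space Q. x \<le> Z k \<omega>} \<le> exp (s k * (log_laplace Q Z s t k - t * x))"
proof -
  have "prob {\<omega> \<in> space Q. x \<le> Z k \<omega>} = (\<integral>\<omega>. indicator {\<omega> \<in> space Q. x \<le> Z k \<omega>} \<omega> \<partial>Q)"
    by simp
  also have "\<dots> \<le> (\<integral>\<omega>. exp (- t * s k * x) * exp (t * s k * Z k \<omega>) \<partial>Q)"
  proof (intro integral_mono)
    fix \<omega> assume "\<omega> \<in> space Q"
    have "1 \<le> exp (- t * s k * x + t * s k * Z k \<omega>)" if "x \<le> Z k \<omega>"
      using that assms by simp
    then show "indicator {\<omega> \<in> space Q. x \<le> Z k \<omega>} \<omega> \<le> exp (- t * s k * x) * exp (t * s k * Z k \<omega>)"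
      by (auto simp: indicator_def simp flip: exp_add)
  qed (auto intro: int simp: emeasure_eq_measure)
  also have "\<dots> = exp (- t * s k * x) * exp (s k * log_laplace Q Z s t k)"
    by (simp only: integral_mult_right_zero laplace_eq_exp[OF assms(1)])
  also have "\<dots> = exp (s k * (log_laplace Q Z s t k - t * x))"
    by (simp add: algebra_simps flip: exp_add)
  finally show ?thesis .
qed

text \<open>Exponential tilting: the tilted mass outside the window around \<open>x = \<Lambda>' t\<close> is exponentially smaller
  than the total, because moving \<open>t\<close> by \<open>h\<close> in either direction changes \<open>\<Lambda>\<close> to first order by \<open>x h\<close>, whereas
  leaving the window costs \<open>h \<delta>\<close> more. What remains is the mass of the window, on which the tilting
  density is nearly constant.\<close>
lemma window_lower_bound:
  assumes t: "0 < t" and der: "(\<Lambda> has_real_derivative x) (at t)" and \<delta>: "0 < \<delta>"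
  shows "\<forall>\<^sub>F k in sequentially.
    exp (s k * (\<Lambda> t - t * x - (t + 1) * \<delta>)) \<le> prob {\<omega> \<in> space Q. \<bar>Z k \<omega> - x\<bar> < \<delta>}"
proof -
  obtain d where d: "0 < d" "\<And>h. \<bar>h\<bar> < d \<Longrightarrow> \<bar>\<Lambda> (t + h) - \<Lambda> t - x * h\<bar> \<le> \<delta> / 2 * \<bar>h\<bar>"
  proof -
    have "(\<Lambda> has_derivative (\<lambda>h. x * h)) (at t)" using der by (simp add: has_field_derivative_def)
    then obtain d where "0 < d"
      "\<And>y. norm (y - t) < d \<Longrightarrow> norm (\<Lambda> y - \<Lambda> t - x * (y - t)) \<le> \<delta> / 2 * norm (y - t)"
      unfolding has_derivative_at_alt using \<delta> by (meson half_gt_zero)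
    then show thesis using that[of d] by (metis add_diff_cancel_left' real_norm_def)
  qed
  (* t - h must remain in the range of arguments with a known limit. *)
  define h where "h = Min {d / 2, t / 2, 1}"
  have h: "0 < h" "h < d" "h < t" "h \<le> 1" using d t by (auto simp: h_def)
  define \<eta> where "\<eta> = h * \<delta> / 2"
  have \<eta>: "0 < \<eta>" "\<eta> \<le> \<delta> / 2" using h \<delta> by (auto simp: \<eta>_def)
  have up: "\<Lambda> (t + h) \<le> \<Lambda> t + x * h + \<eta>" and dn: "\<Lambda> (t - h) \<le> \<Lambda> t - x * h + \<eta>"
    using d(2)[of h] d(2)[of "- h"] h unfolding \<eta>_def abs_le_iff by (auto simp: algebra_simps)
  have ev: "\<forall>\<^sub>F k in sequentially. \<Lambda> t - \<eta> / 4 < log_laplace Q Z s t k"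
    "\<forall>\<^sub>F k in sequentially. log_laplace Q Z s (t + h) k < \<Lambda> (t + h) + \<eta> / 4"
    "\<forall>\<^sub>F k in sequentially. log_laplace Q Z s (t - h) k < \<Lambda> (t - h) + \<eta> / 4"
    using lim[OF t] lim[of "t + h"] lim[of "t - h"] h \<eta> t
    by (auto intro: order_tendstoD)
  have ev2: "\<forall>\<^sub>F k in sequentially. s k > ln 4 * 2 / \<eta>"
    using speed_top by (simp add: filterlim_at_top_dense)
  show ?thesis
    using ev ev2 speed_pos
  proof eventually_elim
    case (elim k)
    let ?W = "{\<omega> \<in> space Q. \<bar>Z k \<omega> - x\<bar> < \<delta>}"
    let ?L = "\<lambda>t. log_laplace Q Z s t k"
    have s: "0 < s k" by fact
    have "exp (s k * ?L t) = (\<integral>\<omega>. exp (t * s k * Z k \<omega>) \<partial>Q)" using s by (simp add: laplace_eq_exp)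
    also have "\<dots> \<le> (\<integral>\<omega>. exp (t * s k * (x + \<delta>)) * indicator ?W \<omega>
        + exp (- h * s k * (x + \<delta>)) * exp ((t + h) * s k * Z k \<omega>)
        + exp (h * s k * (x - \<delta>)) * exp ((t - h) * s k * Z k \<omega>) \<partial>Q)"
    proof (intro integral_mono Bochner_Integration.integrable_add integrable_mult_right int)
      fix \<omega> assume \<omega>: "\<omega> \<in> space Q"
      have nn: "0 \<le> exp (t * s k * (x + \<delta>)) * indicator ?W \<omega>" by simp
      consider "\<bar>Z k \<omega> - x\<bar> < \<delta>" | "x + \<delta> \<le> Z k \<omega>" | "Z k \<omega> \<le> x - \<delta>" by linarith
      then show "exp (t * s k * Z k \<omega>) \<le> exp (t * s k * (x + \<delta>)) * indicator ?W \<omega>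
        + exp (- h * s k * (x + \<delta>)) * exp ((t + h) * s k * Z k \<omega>)
        + exp (h * s k * (x - \<delta>)) * exp ((t - h) * s k * Z k \<omega>)"
      proof cases
        case 1
        then have "exp (t * s k * Z k \<omega>) \<le> exp (t * s k * (x + \<delta>))" using t s by auto
        then show ?thesis using 1 \<omega> by (simp add: add_increasing2)
      next
        case 2
        have "0 \<le> h * s k * (Z k \<omega> - (x + \<delta>))" using 2 h s by simp
        then have "exp (t * s k * Z k \<omega>) \<le> exp (- h * s k * (x + \<delta>)) * exp ((t + h) * s k * Z k \<omega>)"
          by (simp add: algebra_simps flip: exp_add)
        moreover have "0 \<le> exp (h * s k * (x - \<delta>)) * exp ((t - h) * s k * Z k \<omega>)" by simp
        ultimately show ?thesis using nn by linarith
      next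
        case 3
        have "0 \<le> h * s k * ((x - \<delta>) - Z k \<omega>)" using 3 h s by simp
        then have "exp (t * s k * Z k \<omega>) \<le> exp (h * s k * (x - \<delta>)) * exp ((t - h) * s k * Z k \<omega>)"
          by (simp add: algebra_simps flip: exp_add)
        moreover have "0 \<le> exp (- h * s k * (x + \<delta>)) * exp ((t + h) * s k * Z k \<omega>)" by simp
        ultimately show ?thesis using nn by linarith
      qed
    qed (auto simp: emeasure_eq_measure)
    also have "\<dots> = exp (t * s k * (x + \<delta>)) * prob ?W
        + exp (- h * s k * (x + \<delta>)) * exp (s k * ?L (t + h)) + exp (h * s k * (x - \<delta>)) * exp (s k * ?L (t - h))"
    proof -
      have i: "integrable Q (\<lambda>\<omega>. exp (t * s k * (x + \<delta>)) * indicator ?W \<omega>)"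
        by (auto simp: emeasure_eq_measure)
      show ?thesis
        by (subst Bochner_Integration.integral_add Bochner_Integration.integral_add[OF i];
            (intro Bochner_Integration.integrable_add i integrable_mult_right int)?)+
           (simp only: integral_mult_right_zero laplace_eq_exp[OF s], simp)
    qed
    also have "\<dots> = exp (t * s k * (x + \<delta>)) * prob ?W
        + exp (s k * (?L (t + h) - h * (x + \<delta>))) + exp (s k * (?L (t - h) + h * (x - \<delta>)))"
      by (simp add: algebra_simps flip: exp_add)
    finally have main: "exp (s k * ?L t) \<le> exp (t * s k * (x + \<delta>)) * prob ?W
        + exp (s k * (?L (t + h) - h * (x + \<delta>))) + exp (s k * (?L (t - h) + h * (x - \<delta>)))" .
    have "?L (t + h) - h * (x + \<delta>) \<le> \<Lambda> t - 3 * \<eta> / 4" "?L (t - h) + h * (x - \<delta>) \<le> \<Lambda> t - 3 * \<eta> / 4"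
    proof -
      have "h * (x + \<delta>) = x * h + 2 * \<eta>" "h * (x - \<delta>) = x * h - 2 * \<eta>"
        by (simp_all add: \<eta>_def algebra_simps)
      then show "?L (t + h) - h * (x + \<delta>) \<le> \<Lambda> t - 3 * \<eta> / 4" "?L (t - h) + h * (x - \<delta>) \<le> \<Lambda> t - 3 * \<eta> / 4"
        using elim(2,3) up dn by linarith+
    qed
    then have tails: "exp (s k * (?L (t + h) - h * (x + \<delta>))) \<le> exp (s k * (\<Lambda> t - 3 * \<eta> / 4))"
      "exp (s k * (?L (t - h) + h * (x - \<delta>))) \<le> exp (s k * (\<Lambda> t - 3 * \<eta> / 4))"
      using s by auto
    have "exp (s k * (\<Lambda> t - \<eta> / 4)) \<le> exp (s k * ?L t)" using elim(1) s by simp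
    moreover have "2 * exp (s k * (\<Lambda> t - 3 * \<eta> / 4)) \<le> exp (s k * (\<Lambda> t - \<eta> / 4)) / 2"
    proof -
      have "ln 4 \<le> s k * (\<eta> / 2)" using elim(4) \<eta> by (simp add: field_simps)
      then have "exp (ln 4) \<le> exp (s k * (\<eta> / 2))" by (simp only: exp_le_cancel_iff)
      then have "4 \<le> exp (s k * (\<eta> / 2))" by simp
      then have "4 * exp (s k * (\<Lambda> t - 3 * \<eta> / 4)) \<le> exp (s k * (\<eta> / 2)) * exp (s k * (\<Lambda> t - 3 * \<eta> / 4))"
        by (intro mult_right_mono) auto
      also have "\<dots> = exp (s k * (\<Lambda> t - \<eta> / 4))" by (simp add: algebra_simps flip: exp_add)
      finally show ?thesis by simp
    qed
    ultimately have half: "exp (s k * (\<Lambda> t - \<eta> / 4)) / 2 \<le> exp (t * s k * (x + \<delta>)) * prob ?W"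
      using main tails by linarith
    have "ln 2 \<le> s k * \<eta> / 4"
    proof -
      have "ln (4::real) = 2 * ln 2" using ln_realpow[of 2 2] by simp
      then show ?thesis using elim(4) \<eta> by (simp add: field_simps)
    qed
    then have "2 \<le> exp (s k * \<eta> / 4)" by (metis exp_le_cancel_iff exp_ln zero_less_numeral)
    then have "2 * exp (s k * (\<Lambda> t - \<eta> / 2)) \<le> exp (s k * \<eta> / 4) * exp (s k * (\<Lambda> t - \<eta> / 2))" by simp
    also have "\<dots> = exp (s k * (\<Lambda> t - \<eta> / 4))" by (simp add: algebra_simps flip: exp_add)
    finally have "exp (s k * (\<Lambda> t - \<eta> / 2)) \<le> exp (t * s k * (x + \<delta>)) * prob ?W" using half by simp
    then have "exp (- (t * s k * (x + \<delta>))) * exp (s k * (\<Lambda> t - \<eta> / 2))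
       \<le> exp (- (t * s k * (x + \<delta>))) * (exp (t * s k * (x + \<delta>)) * prob ?W)" by simp
    also have "\<dots> = prob ?W" by (simp flip: mult.assoc exp_add)
    finally have "exp (s k * (\<Lambda> t - \<eta> / 2 - t * (x + \<delta>))) \<le> prob ?W"
      by (simp add: algebra_simps flip: exp_add)
    moreover have "exp (s k * (\<Lambda> t - t * x - (t + 1) * \<delta>)) \<le> exp (s k * (\<Lambda> t - \<eta> / 2 - t * (x + \<delta>)))"
      using s \<eta> by (simp add: algebra_simps)
    ultimately show ?case by linarith
  qed
qed

end

text \<open>The Legendre transform of \<open>\<lambda>t. (p * t) powr (1 / \<alpha>)\<close> on the positive half line.\<close>
definition legendre :: "real \<Rightarrow> real \<Rightarrow> real \<Rightarrow> real" where
  "legendre \<alpha> p x = (1 - \<alpha>) / \<alpha> * (\<alpha> * x / p) powr (1 / (1 - \<alpha>))"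

definition rate_power :: "real \<Rightarrow> real \<Rightarrow> real \<Rightarrow> ereal" where
  "rate_power \<alpha> p x = (if 0 \<le> x then ereal (legendre \<alpha> p x) else \<infinity>)"

text \<open>The supremum in the Legendre transform is attained where the derivative equals \<open>x\<close>.\<close>
lemma legendre_dual:
  assumes \<alpha>: "0 < \<alpha>" "\<alpha> < 1" and p: "0 < p" and x: "0 < x"
  obtains t where "0 < t" "((\<lambda>t. (p * t) powr (1 / \<alpha>)) has_real_derivative x) (at t)"
    "(p * t) powr (1 / \<alpha>) - t * x = - legendre \<alpha> p x"
proof
  define w where "w = \<alpha> * x / p"
  have w: "0 < w" using assms by (simp add: w_def)
  define t where "t = w powr (\<alpha> / (1 - \<alpha>)) / p"
  show t: "0 < t" using w p by (simp add: t_def)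
  have pt: "p * t = w powr (\<alpha> / (1 - \<alpha>))" using p by (simp add: t_def)
  have "(w powr (\<alpha> / (1 - \<alpha>))) powr (1 / \<alpha> - 1) = w"
  proof -
    have "\<alpha> / (1 - \<alpha>) * (1 / \<alpha> - 1) = 1" using \<alpha> by (simp add: field_simps)
    then show ?thesis using w by (simp only: powr_powr powr_one)
  qed
  then have "(1 / \<alpha>) * (p * t) powr (1 / \<alpha> - 1) * p = x"
    using \<alpha> p by (simp add: pt) (simp add: w_def)
  then show "((\<lambda>t. (p * t) powr (1 / \<alpha>)) has_real_derivative x) (at t)"
    using t p by (auto intro!: derivative_eq_intros simp: mult_ac)
  have e1: "(p * t) powr (1 / \<alpha>) = w powr (1 / (1 - \<alpha>))"
    using \<alpha> by (simp add: pt powr_powr)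
  have "t * x = w powr (\<alpha> / (1 - \<alpha>)) * w powr 1 / \<alpha>"
  proof -
    have "x / p = w / \<alpha>" using \<alpha> by (simp add: w_def)
    then have "t * x = w powr (\<alpha> / (1 - \<alpha>)) * (w / \<alpha>)" by (metis t_def times_divide_eq_left times_divide_eq_right)
    then show ?thesis using w by simp
  qed
  also have "\<dots> = w powr (1 / (1 - \<alpha>)) / \<alpha>"
  proof -
    have "\<alpha> / (1 - \<alpha>) + 1 = 1 / (1 - \<alpha>)" using \<alpha> by (simp add: field_simps)
    then show ?thesis by (simp only: powr_add[symmetric])
  qed
  finally show "(p * t) powr (1 / \<alpha>) - t * x = - legendre \<alpha> p x"
    using \<alpha> by (simp add: e1 legendre_def w_def) (simp add: field_simps)
qed

lemma legendre_0: "legendre \<alpha> p 0 = 0" by (simp add: legendre_def)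

lemma rate_function_rate_power:
  assumes \<alpha>: "0 < \<alpha>" "\<alpha> < 1" and p: "0 < p"
  shows "rate_function (rate_power \<alpha> p)"
  unfolding rate_function_def
proof (intro conjI allI)
  show "0 \<le> rate_power \<alpha> p x" for x
    using assms by (auto simp: rate_power_def legendre_def)
  fix c :: real
  have "{x. rate_power \<alpha> p x \<le> ereal c} = {0..} \<inter> legendre \<alpha> p -` {..c}"
    by (auto simp: rate_power_def split: if_splits)
  moreover have "continuous_on {0..} (legendre \<alpha> p)"
    unfolding legendre_def using assms by (intro continuous_intros continuous_on_powr') auto
  ultimately show "closed {x. rate_power \<alpha> p x \<le> ereal c}"
    using continuous_closed_preimage by (metis closed_atLeast closed_atMost)
qed

locale power_laplace_limit = laplace_limit Q Z s "\<lambda>t. (p * t) powr (1 / \<alpha>)"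
  for Q :: "'w measure" and Z s and p \<alpha> :: real +
  assumes \<alpha>: "0 < \<alpha>" "\<alpha> < 1" and p: "0 < p"
begin

text \<open>The exponent of the Chernoff bound at the optimal \<open>t\<close> is the negative of a positive rate.\<close>
lemma tail_vanishes:
  assumes \<epsilon>: "0 < \<epsilon>"
  shows "(\<lambda>k. prob {\<omega> \<in> space Q. \<epsilon> \<le> Z k \<omega>}) \<longlonglongrightarrow> 0"
proof -
  obtain t where t: "0 < t" "(p * t) powr (1 / \<alpha>) - t * \<epsilon> = - legendre \<alpha> p \<epsilon>"
    using legendre_dual[OF \<alpha> p \<epsilon>] by metis
  have pos: "0 < legendre \<alpha> p \<epsilon>" using \<alpha> p \<epsilon> by (simp add: legendre_def)
  have "(\<lambda>k. log_laplace Q Z s t k - t * \<epsilon>) \<longlonglongrightarrow> - legendre \<alpha> p \<epsilon>"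
    using tendsto_diff[OF lim[OF t(1)] tendsto_const[of "t * \<epsilon>"]] t(2) by simp
  then have "filterlim (\<lambda>k. (log_laplace Q Z s t k - t * \<epsilon>) * s k) at_bot sequentially"
    using pos by (intro filterlim_tendsto_neg_mult_at_bot[OF _ _ speed_top]) auto
  then have z: "(\<lambda>k. exp ((log_laplace Q Z s t k - t * \<epsilon>) * s k)) \<longlonglongrightarrow> 0"
    by (rule filterlim_compose[OF exp_at_bot])
  show ?thesis
  proof (rule tendsto_sandwich[OF _ _ tendsto_const z])
    show "\<forall>\<^sub>F k in sequentially. prob {\<omega> \<in> space Q. \<epsilon> \<le> Z k \<omega>} \<le> exp ((log_laplace Q Z s t k - t * \<epsilon>) * s k)"
      using speed_pos by eventually_elim (metis upper_tail t(1) mult.commute)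
  qed simp
qed

lemma bulk_eventually:
  assumes \<epsilon>: "0 < \<epsilon>"
  shows "\<forall>\<^sub>F k in sequentially. 1 / 2 \<le> prob {\<omega> \<in> space Q. Z k \<omega> < \<epsilon>}"
proof -
  have "\<forall>\<^sub>F k in sequentially. prob {\<omega> \<in> space Q. \<epsilon> \<le> Z k \<omega>} < 1 / 2"
    using tail_vanishes[OF \<epsilon>] by (rule order_tendstoD) simp
  then show ?thesis
  proof eventually_elim
    case (elim k)
    have "space Q - {\<omega> \<in> space Q. \<epsilon> \<le> Z k \<omega>} = {\<omega> \<in> space Q. Z k \<omega> < \<epsilon>}" by auto
    then show ?case using elim prob_compl[of "{\<omega> \<in> space Q. \<epsilon> \<le> Z k \<omega>}"] by simp
  qed
qed

text \<open>For \<open>t \<le> 0\<close> the transform is at most \<open>0\<close>, and it is not much smaller since the variables are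
  close to \<open>0\<close> with probability at least one half.\<close>
theorem log_laplace_tendsto: "log_laplace Q Z s t \<longlonglongrightarrow> psi \<alpha> (p * t)"
proof (cases "0 < t")
  case True
  then show ?thesis using lim[OF True] p by (simp add: psi_def)
next
  case False
  have le: "\<forall>\<^sub>F k in sequentially. log_laplace Q Z s t k \<le> 0"
    using speed_pos
  proof eventually_elim
    case (elim k)
    have "(\<integral>\<omega>. exp (t * s k * Z k \<omega>) \<partial>Q) \<le> (\<integral>\<omega>. 1 \<partial>Q)"
      using False elim nonneg by (intro integral_mono int) (auto simp: mult_nonpos_nonneg)
    then show ?case using laplace_pos[of t k] elim
      by (simp add: log_laplace_def prob_space divide_nonpos_pos)
  qed
  have "\<forall>\<^sub>F k in sequentially. - e < log_laplace Q Z s t k" if e: "0 < e" for e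
  proof -
    define \<epsilon> where "\<epsilon> = e / (2 * (1 - t))"
    have \<epsilon>: "0 < \<epsilon>" "- t * \<epsilon> < e / 2"
      using False e by (auto simp: \<epsilon>_def field_simps)
    have "(\<lambda>k. ln (1 / 2) / s k) \<longlonglongrightarrow> 0"
      using speed_top by (intro tendsto_divide_0[OF tendsto_const] filterlim_at_top_imp_at_infinity)
    then have "\<forall>\<^sub>F k in sequentially. - (e / 2) < ln (1 / 2) / s k"
      using e by (intro order_tendstoD) auto
    then show ?thesis using bulk_eventually[OF \<epsilon>(1)] speed_pos
    proof eventually_elim
      case (elim k)
      let ?W = "{\<omega> \<in> space Q. Z k \<omega> < \<epsilon>}"
      have "exp (t * s k * \<epsilon>) * (1 / 2) \<le> exp (t * s k * \<epsilon>) * prob ?W" using elim by simp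
      also have "\<dots> = (\<integral>\<omega>. exp (t * s k * \<epsilon>) * indicator ?W \<omega> \<partial>Q)" by simp
      also have "\<dots> \<le> (\<integral>\<omega>. exp (t * s k * Z k \<omega>) \<partial>Q)"
      proof (intro integral_mono int)
        fix \<omega> assume "\<omega> \<in> space Q"
        show "exp (t * s k * \<epsilon>) * indicator ?W \<omega> \<le> exp (t * s k * Z k \<omega>)"
          using False elim by (auto simp: indicator_def mult_left_mono_neg mult_nonpos_nonneg)
      qed (auto simp: emeasure_eq_measure)
      finally have "ln (exp (t * s k * \<epsilon>) * (1 / 2)) \<le> ln (\<integral>\<omega>. exp (t * s k * Z k \<omega>) \<partial>Q)"
        by (intro ln_mono) auto
      then have "t * s k * \<epsilon> + ln (1 / 2) \<le> ln (\<integral>\<omega>. exp (t * s k * Z k \<omega>) \<partial>Q)"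
        by (subst (asm) ln_mult) simp_all
      then have "(t * s k * \<epsilon> + ln (1 / 2)) / s k \<le> ln (\<integral>\<omega>. exp (t * s k * Z k \<omega>) \<partial>Q) / s k"
        using elim by (intro divide_right_mono) auto
      then have "t * \<epsilon> + ln (1 / 2) / s k \<le> log_laplace Q Z s t k"
        using elim(3) by (simp add: log_laplace_def add_divide_distrib)
      then show ?case using elim \<epsilon> by linarith
    qed
  qed
  then have "log_laplace Q Z s t \<longlonglongrightarrow> 0"
  proof (intro order_tendstoI)
    fix a :: real assume "a < 0"
    then show "\<forall>\<^sub>F k in sequentially. a < log_laplace Q Z s t k"
      using \<open>\<And>e. 0 < e \<Longrightarrow> \<forall>\<^sub>F k in sequentially. - e < log_laplace Q Z s t k\<close>[of "- a"] by simp
  next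
    fix a :: real assume "0 < a"
    then show "\<forall>\<^sub>F k in sequentially. log_laplace Q Z s t k < a"
      using le by (auto elim: eventually_mono)
  qed
  then show ?thesis using False p by (simp add: psi_def zero_less_mult_iff)
qed

lemma eln_ge: "exp (s k * a) \<le> q \<Longrightarrow> 0 < s k \<Longrightarrow> ereal a \<le> eln q / ereal (s k)"
proof -
  assume a: "exp (s k * a) \<le> q" "0 < s k"
  then have q: "0 < q" by (meson exp_gt_zero less_le_trans)
  have "s k * a \<le> ln q" using a q by (metis ln_exp ln_mono exp_gt_zero)
  then show ?thesis using a q by (simp add: eln_def field_simps)
qed

lemma eln_le: "q \<le> exp (s k * a) \<Longrightarrow> 0 < s k \<Longrightarrow> eln q / ereal (s k) \<le> ereal a"
proof -
  assume a: "q \<le> exp (s k * a)" "0 < s k"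
  show ?thesis
  proof (cases "q \<le> 0")
    case True
    then show ?thesis using a by (simp add: eln_def)
  next
    case False
    then have "ln q \<le> s k * a" using a by (metis ln_exp ln_mono not_le)
    then show ?thesis using a False by (simp add: eln_def field_simps)
  qed
qed

text \<open>The rate increases on the half line, so a closed set is represented by its least nonnegative element.\<close>
lemma LDP_upper:
  assumes F: "closed F"
  shows "limsup (\<lambda>k. eln (prob {\<omega> \<in> space Q. Z k \<omega> \<in> F}) / ereal (s k)) \<le> - (INF x\<in>F. rate_power \<alpha> p x)"
proof (cases "F \<inter> {0..} = {}")
  case True
  then have "{\<omega> \<in> space Q. Z k \<omega> \<in> F} = {}" for k using nonneg by fastforce
  then have "prob {\<omega> \<in> space Q. Z k \<omega> \<in> F} = 0" for k by (simp only: measure_empty)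
  then have "\<forall>\<^sub>F k in sequentially. eln (prob {\<omega> \<in> space Q. Z k \<omega> \<in> F}) / ereal (s k) \<le> - \<infinity>"
    using speed_pos by (simp add: eln_def eventually_mono)
  then have "limsup (\<lambda>k. eln (prob {\<omega> \<in> space Q. Z k \<omega> \<in> F}) / ereal (s k)) \<le> - \<infinity>"
    by (rule Limsup_bounded)
  then show ?thesis by (simp add: ereal_infty_less_eq)
next
  case False
  define x where "x = Inf (F \<inter> {0..})"
  have x: "x \<in> F" "0 \<le> x"
    using closed_contains_Inf[of "F \<inter> {0..}"] False F by (auto simp: x_def)
  have min: "x \<le> y" if "y \<in> F" "0 \<le> y" for y
    unfolding x_def using that by (intro cInf_lower) (auto intro: bdd_belowI[of _ 0])
  have le: "prob {\<omega> \<in> space Q. Z k \<omega> \<in> F} \<le> prob {\<omega> \<in> space Q. x \<le> Z k \<omega>}" for k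
    using min nonneg by (intro finite_measure_mono) auto
  have "limsup (\<lambda>k. eln (prob {\<omega> \<in> space Q. Z k \<omega> \<in> F}) / ereal (s k)) \<le> ereal (- legendre \<alpha> p x)"
  proof (cases "x = 0")
    case True
    have "\<forall>\<^sub>F k in sequentially. eln (prob {\<omega> \<in> space Q. Z k \<omega> \<in> F}) / ereal (s k) \<le> ereal 0"
      using speed_pos
    proof eventually_elim
      case (elim k)
      then show ?case by (intro eln_le) auto
    qed
    then have "limsup (\<lambda>k. eln (prob {\<omega> \<in> space Q. Z k \<omega> \<in> F}) / ereal (s k)) \<le> ereal 0"
      by (rule Limsup_bounded)
    then show ?thesis using True by (simp add: legendre_0)
  next
    case False
    then obtain t where t: "0 < t" "(p * t) powr (1 / \<alpha>) - t * x = - legendre \<alpha> p x"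
      using legendre_dual[OF \<alpha> p, of x] x by (metis less_le)
    have "(\<lambda>k. ereal (log_laplace Q Z s t k - t * x)) \<longlonglongrightarrow> ereal (- legendre \<alpha> p x)"
      using tendsto_diff[OF lim[OF t(1)] tendsto_const[of "t * x"]] t(2) by simp
    then have "limsup (\<lambda>k. ereal (log_laplace Q Z s t k - t * x)) = ereal (- legendre \<alpha> p x)"
      by (intro lim_imp_Limsup) auto
    moreover have "\<forall>\<^sub>F k in sequentially. eln (prob {\<omega> \<in> space Q. Z k \<omega> \<in> F}) / ereal (s k)
        \<le> ereal (log_laplace Q Z s t k - t * x)"
      using speed_pos
    proof eventually_elim
      case (elim k)
      then show ?case using order_trans[OF le upper_tail[OF elim t(1)]] by (intro eln_le)
    qed
    then have "limsup (\<lambda>k. eln (prob {\<omega> \<in> space Q. Z k \<omega> \<in> F}) / ereal (s k))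
        \<le> limsup (\<lambda>k. ereal (log_laplace Q Z s t k - t * x))"
      by (rule Limsup_mono)
    ultimately show ?thesis by simp
  qed
  also have "\<dots> \<le> - (INF x\<in>F. rate_power \<alpha> p x)"
  proof -
    have "(INF x\<in>F. rate_power \<alpha> p x) \<le> ereal (legendre \<alpha> p x)"
      using INF_lower[OF x(1), of "rate_power \<alpha> p"] x(2) by (simp add: rate_power_def)
    then show ?thesis
      using ereal_minus_le_minus[of "ereal (legendre \<alpha> p x)" "INF x\<in>F. rate_power \<alpha> p x"] by simp
  qed
  finally show ?thesis .
qed

text \<open>At \<open>x > 0\<close> this is the window bound, and at \<open>x = 0\<close> the rate is \<open>0\<close> and the mass does not vanish.\<close>
lemma LDP_lower:
  assumes G: "open G"
  shows "- (INF x\<in>G. rate_power \<alpha> p x) \<le> liminf (\<lambda>k. eln (prob {\<omega> \<in> space Q. Z k \<omega> \<in> G}) / ereal (s k))"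
    (is "_ \<le> ?L")
proof -
  have "- ?L \<le> rate_power \<alpha> p x" if x: "x \<in> G" for x
  proof (cases "0 \<le> x")
    case True
    obtain r where r: "0 < r" "\<And>y. \<bar>y - x\<bar> < r \<Longrightarrow> y \<in> G"
      using G x unfolding open_dist dist_real_def by blast
    have "ereal (- legendre \<alpha> p x) \<le> ?L"
    proof (cases "x = 0")
      case True
      have "(\<lambda>k. ereal (ln (1 / 2) / s k)) \<longlonglongrightarrow> ereal 0"
        using speed_top by (intro tendsto_intros tendsto_divide_0[OF tendsto_const] filterlim_at_top_imp_at_infinity)
      then have "liminf (\<lambda>k. ereal (ln (1 / 2) / s k)) = ereal 0"
        by (intro lim_imp_Liminf) auto
      moreover have "\<forall>\<^sub>F k in sequentially. ereal (ln (1 / 2) / s k)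
          \<le> eln (prob {\<omega> \<in> space Q. Z k \<omega> \<in> G}) / ereal (s k)"
        using bulk_eventually[OF r(1)] speed_pos
      proof eventually_elim
        case (elim k)
        have "prob {\<omega> \<in> space Q. Z k \<omega> < r} \<le> prob {\<omega> \<in> space Q. Z k \<omega> \<in> G}"
          using r(2) nonneg True measurable_sets[OF meas[of k] borel_open[OF G]]
          by (intro finite_measure_mono) (auto simp: vimage_def Int_def conj_commute)
        then show ?case using elim by (intro eln_ge) auto
      qed
      then have "liminf (\<lambda>k. ereal (ln (1 / 2) / s k)) \<le> ?L" by (rule Liminf_mono)
      ultimately show ?thesis using True by (simp add: legendre_0)
    next
      case False
      then obtain t where t: "0 < t" "((\<lambda>t. (p * t) powr (1 / \<alpha>)) has_real_derivative x) (at t)"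
        "(p * t) powr (1 / \<alpha>) - t * x = - legendre \<alpha> p x"
        using legendre_dual[OF \<alpha> p, of x] \<open>0 \<le> x\<close> by (metis less_le)
      show ?thesis
      proof (rule ereal_le_epsilon2)
        fix e :: real assume e: "0 < e"
        define \<delta> where "\<delta> = min r (e / (t + 1))"
        have "(t + 1) * \<delta> \<le> (t + 1) * (e / (t + 1))" using t by (intro mult_left_mono) (auto simp: \<delta>_def)
        then have \<delta>: "0 < \<delta>" "(t + 1) * \<delta> \<le> e" using r t e by (auto simp: \<delta>_def)
        have "\<forall>\<^sub>F k in sequentially. ereal (- legendre \<alpha> p x - e)
            \<le> eln (prob {\<omega> \<in> space Q. Z k \<omega> \<in> G}) / ereal (s k)"
          using window_lower_bound[OF t(1,2) \<delta>(1)] speed_pos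
        proof eventually_elim
          case (elim k)
          have "exp (s k * (- legendre \<alpha> p x - e)) \<le> exp (s k * (- legendre \<alpha> p x - (t + 1) * \<delta>))"
            using \<delta> elim by simp
          also have "\<dots> \<le> prob {\<omega> \<in> space Q. \<bar>Z k \<omega> - x\<bar> < \<delta>}" using elim t(3) by simp
          also have "\<dots> \<le> prob {\<omega> \<in> space Q. Z k \<omega> \<in> G}"
            using r(2) measurable_sets[OF meas[of k] borel_open[OF G]]
            by (intro finite_measure_mono) (auto simp: \<delta>_def vimage_def Int_def conj_commute)
          finally show ?case using elim by (intro eln_ge) auto
        qed
        then have "ereal (- legendre \<alpha> p x - e) \<le> ?L" by (rule Liminf_bounded)
        then show "ereal (- legendre \<alpha> p x) \<le> ?L + ereal e"
          using add_right_mono[of "ereal (- legendre \<alpha> p x - e)" ?L "ereal e"] by simp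
      qed
    qed
    then show ?thesis using True ereal_uminus_le_reorder[of ?L "ereal (legendre \<alpha> p x)"]
      by (simp add: rate_power_def)
  qed (simp add: rate_power_def)
  then have "- ?L \<le> (INF x\<in>G. rate_power \<alpha> p x)" by (rule INF_greatest)
  then show ?thesis by (subst ereal_uminus_le_reorder)
qed

theorem LDP_rate_power: "LDP Q Z s (rate_power \<alpha> p)"
  unfolding LDP_def using meas rate_function_rate_power[OF \<alpha> p] LDP_upper LDP_lower by blast

end

section \<open>Generating functions of the counts\<close>

lemma card_placements_const:
  "real (card (placements A {..<r} (\<lambda>_. l) c)) = falling (card {x \<in> set c - A. count_list c x = l}) r"
proof -
  let ?T = "{x \<in> set c - A. count_list c x = l}"
  have "placements A {..<r} (\<lambda>_. l) c = {t \<in> {..<r} \<rightarrow>\<^sub>E ?T. inj_on t {..<r}}"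
    by (auto simp: placements_def PiE_iff)
  then have "card (placements A {..<r} (\<lambda>_. l) c) = prod ((-) (card ?T)) {0..<r}"
    by (simp add: card_inj_on_subset_funcset)
  then show ?thesis by (simp add: falling_eq_prod)
qed

lemma num_new_freq_eq:
  "num_new_freq l (take n c) (drop n c) = card {x \<in> set c - set (take n c). count_list c x = l}"
proof -
  have "set (drop n c) - set (take n c) = set c - set (take n c)"
    by (metis append_take_drop_id set_append Un_Diff Diff_cancel sup_bot_left)
  moreover have "count_list c x = count_list (drop n c) x" if "x \<notin> set (take n c)" for x
  proof -
    have "count_list c x = count_list (take n c) x + count_list (drop n c) x"
      by (metis append_take_drop_id count_list_append)
    then show ?thesis using that by (simp add: count_list_0_iff)
  qed
  ultimately show ?thesis unfolding num_new_freq_def by (intro arg_cong[where f = card]) auto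
qed

context conditioned_model
begin

definition x\<^sub>0 where "x\<^sub>0 = real j + \<theta> / \<alpha>"
definition B\<^sub>0 where "B\<^sub>0 = \<theta> + real n"

lemma x0_pos: "0 < x\<^sub>0"
proof -
  have "- 1 < \<theta> / \<alpha>" using \<alpha> \<theta> by (simp add: field_simps)
  then show ?thesis using j by (simp add: x\<^sub>0_def)
qed

lemma B0_pos: "0 < B\<^sub>0" and B0_ge: "1 \<le> B\<^sub>0 + \<alpha>"
  using \<alpha> \<theta> n theta_pos[OF n] by (auto simp: B\<^sub>0_def)

lemma expectation_types:
  "(\<integral>\<omega>. pochhammer (real (num_types (sample X (n + m) \<omega>)) + \<theta> / \<alpha>) q \<partial>Q)
     = pochhammer x\<^sub>0 q * pochhammer (B\<^sub>0 + \<alpha> * real q) m / pochhammer B\<^sub>0 m"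
proof -
  have "placements A {} k c = {\<lambda>_. undefined}" for A k and c :: "nat list"
    by (auto simp: placements_def)
  then have "moment_fun \<alpha> \<theta> A {} k q c = pochhammer (real (num_types c) + \<theta> / \<alpha>) q" for A k c
    by (simp add: moment_fun_def)
  then show ?thesis
    using expectation_placements[of "{}" "\<lambda>_. 1" m q]
    by (simp add: num_types_code moment_def falling_def x\<^sub>0_def B\<^sub>0_def)
qed

lemma expectation_freq:
  assumes l: "1 \<le> l"
  shows "(\<integral>\<omega>. falling (num_new_freq l (sample X n \<omega>) (add_sample X n m \<omega>)) r \<partial>Q)
     = block_weight \<alpha> l ^ r * (fact r * freq_coeff \<alpha> x\<^sub>0 B\<^sub>0 l m r)"
proof -
  have "moment_fun \<alpha> \<theta> (set (take n c)) {..<r} (\<lambda>_. l) 0 c = falling (num_new_freq l (take n c) (drop n c)) r" for c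
    by (simp add: moment_fun_def card_placements_const num_new_freq_eq)
  moreover have "num_new_freq l (take n (code (sample X (n + m) \<omega>))) (drop n (code (sample X (n + m) \<omega>)))
      = num_new_freq l (sample X n \<omega>) (add_sample X n m \<omega>)" for \<omega>
    unfolding sample_add by (rule num_new_freq_code) simp
  ultimately have "(\<integral>\<omega>. falling (num_new_freq l (sample X n \<omega>) (add_sample X n m \<omega>)) r \<partial>Q)
      = moment \<alpha> x\<^sub>0 B\<^sub>0 {..<r} (\<lambda>_. l) 0 m"
    using expectation_placements[of "{..<r}" "\<lambda>_. l" m 0] l by (simp add: x\<^sub>0_def B\<^sub>0_def)
  also have "\<dots> = block_weight \<alpha> l ^ r * (fact r * freq_coeff \<alpha> x\<^sub>0 B\<^sub>0 l m r)"
    by (simp add: moment_def freq_coeff_def)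
  finally show ?thesis .
qed

text \<open>The codes of a fixed length take finitely many values, so the expectation is a finite
  weighted sum and is exchanged with the series term by term.\<close>
lemma expectation_sums:
  assumes h: "\<And>c. (\<lambda>r. h r c) sums H c"
  shows "(\<lambda>r. \<integral>\<omega>. h r (code (sample X k \<omega>)) \<partial>Q) sums (\<integral>\<omega>. H (code (sample X k \<omega>)) \<partial>Q :: real)"
proof -
  interpret Q: prob_space Q by (rule prob_space_Q)
  define R where "R = range (\<lambda>\<omega>. code (sample X k \<omega>))"
  have fin: "finite R" unfolding R_def by (rule finite_codes)
  have "(\<integral>\<omega>. g (code (sample X k \<omega>)) \<partial>Q) = (\<Sum>c\<in>R. (\<integral>\<omega>. of_bool (code (sample X k \<omega>) = c) \<partial>Q) * g c)" for g :: "nat list \<Rightarrow> real"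
  proof -
    have "g (code (sample X k \<omega>)) = (\<Sum>c\<in>R. of_bool (code (sample X k \<omega>) = c) * g c)" for \<omega>
    proof -
      have "(\<Sum>c\<in>R. of_bool (code (sample X k \<omega>) = c) * g c) = (\<Sum>c\<in>R. if code (sample X k \<omega>) = c then g c else 0)"
        by (rule sum.cong) auto
      also have "\<dots> = g (code (sample X k \<omega>))" using fin by (simp add: R_def)
      finally show ?thesis by simp
    qed
    then have "(\<integral>\<omega>. g (code (sample X k \<omega>)) \<partial>Q) = (\<integral>\<omega>. (\<Sum>c\<in>R. of_bool (code (sample X k \<omega>) = c) * g c) \<partial>Q)" by simp
    also have "\<dots> = (\<Sum>c\<in>R. (\<integral>\<omega>. of_bool (code (sample X k \<omega>) = c) * g c \<partial>Q))"
      by (rule Bochner_Integration.integral_sum) (rule integrable_Q[of "\<lambda>c'. of_bool (c' = _) * g _"])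
    finally show ?thesis by simp
  qed
  then show ?thesis using h by (simp only:) (intro sums_sum sums_mult)
qed

lemma types_generating:
  assumes u: "0 \<le> u" "u < 1"
  shows "(\<lambda>r. u ^ r * gcoeff \<alpha> x\<^sub>0 B\<^sub>0 m r) sums (\<integral>\<omega>. (1 - u) powr (- (real (num_types (sample X (n + m) \<omega>)) + \<theta> / \<alpha>)) \<partial>Q)"
proof -
  have "(\<lambda>r. pochhammer (real (num_types c) + \<theta> / \<alpha>) r / fact r * u ^ r) sums ((1 - u) powr (- (real (num_types c) + \<theta> / \<alpha>)))" for c :: "nat list"
    using u by (intro pochhammer_series_sums) auto
  then have "(\<lambda>r. \<integral>\<omega>. pochhammer (real (num_types (code (sample X (n + m) \<omega>))) + \<theta> / \<alpha>) r / fact r * u ^ r \<partial>Q)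
     sums (\<integral>\<omega>. (1 - u) powr (- (real (num_types (code (sample X (n + m) \<omega>))) + \<theta> / \<alpha>)) \<partial>Q)"
    by (rule expectation_sums)
  then have "(\<lambda>r. (\<integral>\<omega>. pochhammer (real (num_types (sample X (n + m) \<omega>)) + \<theta> / \<alpha>) r \<partial>Q) / fact r * u ^ r)
     sums (\<integral>\<omega>. (1 - u) powr (- (real (num_types (sample X (n + m) \<omega>)) + \<theta> / \<alpha>)) \<partial>Q)"
    by (simp add: num_types_code)
  then show ?thesis by (simp add: expectation_types gcoeff_def mult_ac)
qed

lemma freq_generating:
  assumes l: "1 \<le> l"
  shows "(\<lambda>r. (z * block_weight \<alpha> l) ^ r * freq_coeff \<alpha> x\<^sub>0 B\<^sub>0 l m r)
     sums (\<integral>\<omega>. (1 + z) ^ num_new_freq l (sample X n \<omega>) (add_sample X n m \<omega>) \<partial>Q)"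
proof -
  let ?N = "\<lambda>c. num_new_freq l (take n c) (drop n c)"
  have N: "?N (code (sample X (n + m) \<omega>)) = num_new_freq l (sample X n \<omega>) (add_sample X n m \<omega>)" for \<omega>
    unfolding sample_add by (rule num_new_freq_code) simp
  have "(\<lambda>r. falling (?N c) r / fact r * z ^ r) sums ((1 + z) ^ ?N c)" for c :: "nat list"
  proof -
    have "(\<lambda>r. falling (?N c) r / fact r * z ^ r) sums (\<Sum>r\<in>{..?N c}. falling (?N c) r / fact r * z ^ r)"
      by (rule sums_finite) (auto simp: falling_def binomial_eq_0)
    moreover have "(\<Sum>r\<in>{..?N c}. falling (?N c) r / fact r * z ^ r) = (1 + z) ^ ?N c"
      using binomial_ring[of z 1 "?N c"] by (simp add: falling_def add.commute)
    ultimately show ?thesis by simp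
  qed
  then have "(\<lambda>r. \<integral>\<omega>. falling (?N (code (sample X (n + m) \<omega>))) r / fact r * z ^ r \<partial>Q)
     sums (\<integral>\<omega>. (1 + z) ^ ?N (code (sample X (n + m) \<omega>)) \<partial>Q)"
    by (rule expectation_sums)
  then have "(\<lambda>r. (\<integral>\<omega>. falling (num_new_freq l (sample X n \<omega>) (add_sample X n m \<omega>)) r \<partial>Q) / fact r * z ^ r)
     sums (\<integral>\<omega>. (1 + z) ^ num_new_freq l (sample X n \<omega>) (add_sample X n m \<omega>) \<partial>Q)"
    by (simp add: N)
  then show ?thesis by (simp add: expectation_freq[OF l] power_mult_distrib mult_ac)
qed

end

section \<open>Moderate deviations\<close>

text \<open>A bounded change of the counts is negligible, because the factor \<open>a\<close> tends to \<open>0\<close> in the application.\<close>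
lemma (in prob_space) log_mgf_close:
  fixes U V :: "'a \<Rightarrow> real" and a C :: real
  assumes int: "integrable M (\<lambda>\<omega>. exp (a * U \<omega>))" "integrable M (\<lambda>\<omega>. exp (a * V \<omega>))"
    and a: "0 \<le> a" and close: "\<And>\<omega>. \<omega> \<in> space M \<Longrightarrow> \<bar>U \<omega> - V \<omega>\<bar> \<le> C"
  shows "\<bar>ln (\<integral>\<omega>. exp (a * U \<omega>) \<partial>M) - ln (\<integral>\<omega>. exp (a * V \<omega>) \<partial>M)\<bar> \<le> a * C"
proof -
  have one: "ln (\<integral>\<omega>. exp (a * U \<omega>) \<partial>M) \<le> a * C + ln (\<integral>\<omega>. exp (a * V \<omega>) \<partial>M)"
    if "integrable M (\<lambda>\<omega>. exp (a * U \<omega>))" "integrable M (\<lambda>\<omega>. exp (a * V \<omega>))"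
      "\<And>\<omega>. \<omega> \<in> space M \<Longrightarrow> \<bar>U \<omega> - V \<omega>\<bar> \<le> C" for U V
  proof -
    have "(\<integral>\<omega>. exp (a * U \<omega>) \<partial>M) \<le> (\<integral>\<omega>. exp (a * C) * exp (a * V \<omega>) \<partial>M)"
    proof (rule integral_mono)
      fix \<omega> assume "\<omega> \<in> space M"
      then have "a * U \<omega> \<le> a * (C + V \<omega>)" using that(3)[of \<omega>] a by (intro mult_left_mono) auto
      then show "exp (a * U \<omega>) \<le> exp (a * C) * exp (a * V \<omega>)" by (simp add: distrib_left flip: exp_add)
    qed (use that in auto)
    also have "\<dots> = exp (a * C) * (\<integral>\<omega>. exp (a * V \<omega>) \<partial>M)" by simp
    finally have "ln (\<integral>\<omega>. exp (a * U \<omega>) \<partial>M) \<le> ln (exp (a * C) * (\<integral>\<omega>. exp (a * V \<omega>) \<partial>M))"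
      using expectation_exp_pos[OF that(1)] by (intro ln_mono) auto
    also have "\<dots> = a * C + ln (\<integral>\<omega>. exp (a * V \<omega>) \<partial>M)"
      using expectation_exp_pos[OF that(2)] by (simp add: ln_mult_pos)
    finally show ?thesis .
  qed
  show ?thesis using one[OF int close] one[OF int(2,1)] close by (simp add: abs_minus_commute abs_le_iff)
qed

locale moderate_scaling =
  fixes \<alpha> :: real and \<beta> :: "nat \<Rightarrow> real"
  assumes \<alpha>: "0 < \<alpha>" "\<alpha> < 1"
    and \<beta>_pos: "\<forall>k\<ge>1. \<beta> k > 0" and \<beta>_top: "filterlim \<beta> at_top sequentially"
    and \<beta>_small: "(\<lambda>k. \<beta> k / real k powr (1 - \<alpha>)) \<longlonglongrightarrow> 0"
begin

abbreviation s where "s \<equiv> speed \<alpha> \<beta>"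

lemma speed_top: "filterlim s at_top sequentially"
proof -
  have "filterlim (\<lambda>k. exp (1 / (1 - \<alpha>) * ln (\<beta> k))) at_top sequentially"
    using \<alpha> by (intro filterlim_compose[OF exp_at_top] filterlim_tendsto_pos_mult_at_top[OF tendsto_const]
        filterlim_compose[OF ln_at_top \<beta>_top]) auto
  moreover have "\<forall>\<^sub>F k in sequentially. exp (1 / (1 - \<alpha>) * ln (\<beta> k)) = s k"
    using eventually_ge_at_top[of 1]
  proof eventually_elim
    case (elim k)
    then have "0 < \<beta> k" using \<beta>_pos by blast
    then show ?case by (simp add: speed_def powr_def)
  qed
  ultimately show ?thesis by (rule filterlim_cong[OF refl refl, THEN iffD1, rotated])
qed

lemma speed_small: "(\<lambda>k. s k / real k) \<longlonglongrightarrow> 0"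
proof -
  have "(\<lambda>k. (\<beta> k / real k powr (1 - \<alpha>)) powr (1 / (1 - \<alpha>))) \<longlonglongrightarrow> 0"
  proof (rule tendsto_zero_powrI[OF \<beta>_small tendsto_const])
    show "\<forall>\<^sub>F k in sequentially. 0 \<le> \<beta> k / real k powr (1 - \<alpha>)"
      using eventually_ge_at_top[of 1] by eventually_elim (use \<beta>_pos in \<open>simp add: less_imp_le\<close>)
  qed (use \<alpha> in simp)
  moreover have "\<forall>\<^sub>F k in sequentially. (\<beta> k / real k powr (1 - \<alpha>)) powr (1 / (1 - \<alpha>)) = s k / real k"
    using eventually_ge_at_top[of 1]
  proof eventually_elim
    case (elim k)
    then show ?case using \<alpha> by (simp add: speed_def powr_divide powr_powr)
  qed
  ultimately show ?thesis by (rule Lim_transform_eventually)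
qed

definition tilt where "tilt t k = t * (s k / real k) powr \<alpha>"

lemma tilt_0: "tilt t \<longlonglongrightarrow> 0"
proof -
  have "(\<lambda>k. (s k / real k) powr \<alpha>) \<longlonglongrightarrow> 0"
    using \<alpha> by (intro tendsto_zero_powrI[OF speed_small tendsto_const]) (auto simp: speed_def)
  from tendsto_mult[OF tendsto_const this, of t] show ?thesis by (simp add: tilt_def[abs_def])
qed

text \<open>The speed satisfies \<open>s k = \<beta> k * s k powr \<alpha>\<close>; the factor in front of the count is therefore a small
  tilt of order \<open>(s k / k) powr \<alpha>\<close>.\<close>
lemma speed_scaled:
  assumes "1 \<le> k"
  shows "t * s k * scaled \<alpha> \<beta> Y k \<omega> = tilt t k * real (Y k \<omega>)"
proof -
  have b: "0 < \<beta> k" using \<beta>_pos assms by blast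
  have "s k / \<beta> k = s k powr \<alpha>"
  proof -
    have "s k powr \<alpha> = \<beta> k powr (1 / (1 - \<alpha>) - 1)"
      using \<alpha> b by (simp add: speed_def powr_powr) (simp add: field_simps)
    also have "\<dots> = s k / \<beta> k" using b by (simp add: speed_def powr_diff)
    finally show ?thesis by simp
  qed
  then have "s k / \<beta> k / real k powr \<alpha> = (s k / real k) powr \<alpha>"
    by (simp only: powr_divide)
  then have "s k / (real k powr \<alpha> * \<beta> k) = (s k / real k) powr \<alpha>"
    by (simp add: mult.commute)
  moreover have "t * s k * scaled \<alpha> \<beta> Y k \<omega> = t * (s k / (real k powr \<alpha> * \<beta> k)) * real (Y k \<omega>)"
    by (simp add: scaled_def)
  ultimately show ?thesis by (simp only: tilt_def)
qed

end

locale conditioned_scaling = conditioned_model \<alpha> \<theta> \<nu> M X n j ns + moderate_scaling \<alpha> \<beta>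
  for \<alpha> \<theta> \<nu> and M :: "'w measure" and X n j ns \<beta>
begin

text \<open>It suffices to find the limit for a function \<open>W\<close> of the code at bounded distance from the count.\<close>
lemma power_laplace_limit_close:
  fixes N :: "nat \<Rightarrow> nat" and W :: "nat \<Rightarrow> nat list \<Rightarrow> real" and G :: "nat \<Rightarrow> nat list \<Rightarrow> nat"
  assumes p: "0 < p"
    and Y: "\<And>k \<omega>. Y k \<omega> = G k (code (sample X (N k) \<omega>))"
    and close: "\<And>k \<omega>. 1 \<le> k \<Longrightarrow> \<bar>real (G k (code (sample X (N k) \<omega>))) - W k (code (sample X (N k) \<omega>))\<bar> \<le> C"
    and W: "\<And>t. 0 < t \<Longrightarrow> (\<lambda>k. ln (\<integral>\<omega>. exp (tilt t k * W k (code (sample X (N k) \<omega>))) \<partial>Q) / s k) \<longlonglongrightarrow> (p * t) powr (1 / \<alpha>)"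
  shows "power_laplace_limit Q (scaled \<alpha> \<beta> Y) s p \<alpha>"
proof -
  interpret Q: prob_space Q by (rule prob_space_Q)
  have meas: "(\<lambda>\<omega>. g (code (sample X k \<omega>)) :: real) \<in> borel_measurable Q" for g k
    using code_fun_borel sets_Q measurable_cong_sets by blast
  show ?thesis
  proof
    show "scaled \<alpha> \<beta> Y k \<in> borel_measurable Q" for k
      unfolding scaled_def[abs_def] Y using meas[of "\<lambda>c. real (G k c) / (real k powr \<alpha> * \<beta> k)" "N k"] by simp
    show "0 \<le> scaled \<alpha> \<beta> Y k \<omega>" for k \<omega>
      using \<beta>_pos by (cases k) (auto simp: scaled_def less_imp_le)
    show "integrable Q (\<lambda>\<omega>. exp (t * s k * scaled \<alpha> \<beta> Y k \<omega>))" for k t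
      unfolding scaled_def Y using integrable_Q[of "\<lambda>c. exp (t * s k * (real (G k c) / (real k powr \<alpha> * \<beta> k)))" "N k"] by simp
    show "filterlim s at_top sequentially" by (rule speed_top)
    show "0 < \<alpha>" "\<alpha> < 1" "0 < p" using \<alpha> p by auto
    fix t :: real assume t: "0 < t"
    have sp: "\<forall>\<^sub>F k in sequentially. 0 < s k" using speed_top by (simp add: filterlim_at_top_dense)
    let ?D = "\<lambda>k. log_laplace Q (scaled \<alpha> \<beta> Y) s t k - ln (\<integral>\<omega>. exp (tilt t k * W k (code (sample X (N k) \<omega>))) \<partial>Q) / s k"
    have "?D \<longlonglongrightarrow> 0"
    proof (rule Lim_null_comparison)
      show "\<forall>\<^sub>F k in sequentially. norm (?D k) \<le> tilt t k * C * (1 / s k)"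
        using sp eventually_ge_at_top[of 1]
      proof eventually_elim
        case (elim k)
        have a: "0 \<le> tilt t k" using t by (simp add: tilt_def)
        have "\<bar>ln (\<integral>\<omega>. exp (tilt t k * real (G k (code (sample X (N k) \<omega>)))) \<partial>Q)
            - ln (\<integral>\<omega>. exp (tilt t k * W k (code (sample X (N k) \<omega>))) \<partial>Q)\<bar> \<le> tilt t k * C"
          using a close[OF elim(2)] integrable_Q[of "\<lambda>c. exp (tilt t k * real (G k c))" "N k"]
            integrable_Q[of "\<lambda>c. exp (tilt t k * W k c)" "N k"]
          by (intro Q.log_mgf_close) auto
        then have "\<bar>ln (\<integral>\<omega>. exp (tilt t k * real (G k (code (sample X (N k) \<omega>)))) \<partial>Q)
            - ln (\<integral>\<omega>. exp (tilt t k * W k (code (sample X (N k) \<omega>))) \<partial>Q)\<bar> / s k \<le> tilt t k * C / s k"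
          using elim by (intro divide_right_mono) auto
        moreover have "?D k = (ln (\<integral>\<omega>. exp (tilt t k * real (G k (code (sample X (N k) \<omega>)))) \<partial>Q)
            - ln (\<integral>\<omega>. exp (tilt t k * W k (code (sample X (N k) \<omega>))) \<partial>Q)) / s k"
          unfolding log_laplace_def speed_scaled[OF elim(2)] Y by (simp add: diff_divide_distrib)
        ultimately show ?case using elim by (simp add: abs_divide)
      qed
      have "(\<lambda>k. 1 / s k) \<longlonglongrightarrow> 0"
        using speed_top by (intro tendsto_divide_0[OF tendsto_const] filterlim_at_top_imp_at_infinity)
      from tendsto_mult[OF tendsto_mult[OF tilt_0 tendsto_const[of C]] this]
      show "(\<lambda>k. tilt t k * C * (1 / s k)) \<longlonglongrightarrow> 0" by simp
    qed
    from tendsto_add[OF this W[OF t]] show "log_laplace Q (scaled \<alpha> \<beta> Y) s t \<longlonglongrightarrow> (p * t) powr (1 / \<alpha>)" by simp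
  qed
qed

lemma regime:
  assumes \<tau>: "0 < \<tau>" and y: "(\<lambda>k. y k / (s k / real k) powr \<alpha>) \<longlonglongrightarrow> \<tau>"
  shows "moderate_regime \<alpha> x\<^sub>0 B\<^sub>0 \<tau> s y"
  using \<alpha> x0_pos B0_pos B0_ge \<tau> speed_top speed_small y by unfold_locales auto

lemma exp_tilt_ratio:
  assumes t: "0 < t" and d: "DERIV f 0 :> 1" "f 0 = 0"
  shows "(\<lambda>k. f (tilt t k) / (s k / real k) powr \<alpha>) \<longlonglongrightarrow> t"
proof -
  have pos: "\<forall>\<^sub>F k in sequentially. 0 < (s k / real k) powr \<alpha>"
  proof -
    have "\<forall>\<^sub>F k in sequentially. 0 < s k" using speed_top by (simp add: filterlim_at_top_dense)
    then show ?thesis using eventually_gt_at_top[of 0] by eventually_elim simp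
  qed
  have "((\<lambda>h. f h / h) \<longlongrightarrow> 1) (at 0)" using d by (simp add: DERIV_def)
  moreover have "filterlim (tilt t) (at 0) sequentially"
    unfolding filterlim_at
  proof
    show "\<forall>\<^sub>F k in sequentially. tilt t k \<in> UNIV \<and> tilt t k \<noteq> 0"
      using pos by eventually_elim (use t in \<open>simp add: tilt_def\<close>)
  qed (rule tilt_0)
  ultimately have "(\<lambda>k. f (tilt t k) / tilt t k) \<longlonglongrightarrow> 1" by (rule filterlim_compose)
  from tendsto_mult[OF this tendsto_const[of t]] have "(\<lambda>k. f (tilt t k) / tilt t k * t) \<longlonglongrightarrow> t" by simp
  moreover have "\<forall>\<^sub>F k in sequentially. f (tilt t k) / tilt t k * t = f (tilt t k) / (s k / real k) powr \<alpha>"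
    using pos by eventually_elim (use t in \<open>simp add: tilt_def\<close>)
  ultimately show ?thesis by (rule Lim_transform_eventually)
qed

lemma integral_exp_pos: "0 < (\<integral>\<omega>. exp (g (code (sample X k \<omega>)) :: real) \<partial>Q)"
  using prob_space.expectation_exp_pos[OF prob_space_Q integrable_Q[of "\<lambda>c. exp (g c)"]] .

text \<open>The choice \<open>u = 1 - exp (- a)\<close> turns \<open>(1 - u)\<close> to the power \<open>-(K + \<theta>/\<alpha>)\<close> into the exponential of \<open>a\<close> times \<open>K + \<theta>/\<alpha>\<close>.\<close>
lemma types_limit:
  assumes t: "0 < t"
  shows "(\<lambda>k. ln (\<integral>\<omega>. exp (tilt t k * (real (num_types (code (sample X (n + (k - e)) \<omega>))) + \<theta> / \<alpha>)) \<partial>Q) / s k)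
    \<longlonglongrightarrow> (1 * t) powr (1 / \<alpha>)"
proof -
  define y where "y = (\<lambda>k. 1 - exp (- tilt t k))"
  have "DERIV (\<lambda>h::real. 1 - exp (- h)) 0 :> 1" by (auto intro!: derivative_eq_intros)
  from exp_tilt_ratio[OF t this] have "(\<lambda>k. y k / (s k / real k) powr \<alpha>) \<longlonglongrightarrow> t" by (simp add: y_def)
  then interpret moderate_regime \<alpha> x\<^sub>0 B\<^sub>0 t s y e by (rule regime[OF t])
  have "(\<lambda>k. ln (\<integral>\<omega>. exp (tilt t k * (real (num_types (code (sample X (n + (k - e)) \<omega>))) + \<theta> / \<alpha>)) \<partial>Q) / s k)
    \<longlonglongrightarrow> t powr (1 / \<alpha>)"
  proof (rule gcoeff_limit)
    have "(\<lambda>r. y k ^ r * gcoeff \<alpha> x\<^sub>0 B\<^sub>0 (k - e) r) sums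
       (\<integral>\<omega>. exp (tilt t k * (real (num_types (code (sample X (n + (k - e)) \<omega>))) + \<theta> / \<alpha>)) \<partial>Q)" for k
    proof -
      have "0 \<le> y k" "y k < 1" using t by (auto simp: y_def tilt_def)
      moreover have "(1 - y k) powr (- z) = exp (tilt t k * z)" for z
        by (simp add: y_def powr_def mult.commute)
      ultimately show ?thesis using types_generating[of "y k" "k - e"] by (simp only: num_types_code)
    qed
    then show "\<forall>\<^sub>F k in sequentially. (\<lambda>r. y k ^ r * gcoeff \<alpha> x\<^sub>0 B\<^sub>0 (k - e) r) sums
       (\<integral>\<omega>. exp (tilt t k * (real (num_types (code (sample X (n + (k - e)) \<omega>))) + \<theta> / \<alpha>)) \<partial>Q)" by simp
    show "\<forall>\<^sub>F k in sequentially. 0 < (\<integral>\<omega>. exp (tilt t k * (real (num_types (code (sample X (n + (k - e)) \<omega>))) + \<theta> / \<alpha>)) \<partial>Q)"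
      by (intro always_eventually allI integral_exp_pos)
  qed
  then show ?thesis by simp
qed

lemma block_weight_pos: "0 < block_weight \<alpha> l"
  unfolding block_weight_def using \<alpha> by (intro divide_pos_pos mult_pos_pos pochhammer_pos) auto

lemma freq_limit:
  assumes t: "0 < t" and l: "1 \<le> l"
  shows "(\<lambda>k. ln (\<integral>\<omega>. exp (tilt t k * real (num_new_freq l (take n (code (sample X (n + (k - e)) \<omega>)))
      (drop n (code (sample X (n + (k - e)) \<omega>))))) \<partial>Q) / s k) \<longlonglongrightarrow> (block_weight \<alpha> l * t) powr (1 / \<alpha>)"
proof -
  let ?N = "\<lambda>k \<omega>. num_new_freq l (take n (code (sample X (n + (k - e)) \<omega>))) (drop n (code (sample X (n + (k - e)) \<omega>)))"
  have N: "?N k \<omega> = num_new_freq l (sample X n \<omega>) (add_sample X n (k - e) \<omega>)" for k \<omega>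
    unfolding sample_add by (rule num_new_freq_code) simp
  define y where "y = (\<lambda>k. (exp (tilt t k) - 1) * block_weight \<alpha> l)"
  have "DERIV (\<lambda>h::real. exp h - 1) 0 :> 1" by (auto intro!: derivative_eq_intros)
  from tendsto_mult[OF exp_tilt_ratio[OF t this] tendsto_const[of "block_weight \<alpha> l"]]
  have y: "(\<lambda>k. y k / (s k / real k) powr \<alpha>) \<longlonglongrightarrow> block_weight \<alpha> l * t" by (simp add: y_def mult_ac)
  have pos: "0 < block_weight \<alpha> l * t" using t block_weight_pos by simp
  interpret moderate_regime \<alpha> x\<^sub>0 B\<^sub>0 "block_weight \<alpha> l * t" s y e by (rule regime[OF pos y])
  show ?thesis
  proof (rule freq_coeff_limit)
    have "(\<lambda>r. y k ^ r * freq_coeff \<alpha> x\<^sub>0 B\<^sub>0 l (k - e) r) sums (\<integral>\<omega>. exp (tilt t k * real (?N k \<omega>)) \<partial>Q)" for k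
      using freq_generating[OF l, of "exp (tilt t k) - 1" "k - e"]
      by (simp add: y_def N mult.commute flip: exp_of_nat_mult)
    then show "\<forall>\<^sub>F k in sequentially. (\<lambda>r. y k ^ r * freq_coeff \<alpha> x\<^sub>0 B\<^sub>0 l (k - e) r) sums (\<integral>\<omega>. exp (tilt t k * real (?N k \<omega>)) \<partial>Q)"
      by simp
    show "\<forall>\<^sub>F k in sequentially. 0 < (\<integral>\<omega>. exp (tilt t k * real (?N k \<omega>)) \<partial>Q)"
      by (intro always_eventually allI integral_exp_pos)
  qed
qed

end

lemma rate_power_1: "0 < \<alpha> \<Longrightarrow> \<alpha> < 1 \<Longrightarrow> rate_power \<alpha> 1 = rate \<alpha>"
proof
  fix x assume \<alpha>: "0 < \<alpha>" "\<alpha> < 1"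
  have "1 / \<alpha> * \<alpha> powr (1 / (1 - \<alpha>)) = \<alpha> powr (1 / (1 - \<alpha>) - 1)" using \<alpha> by (simp add: powr_diff)
  also have "1 / (1 - \<alpha>) - 1 = \<alpha> / (1 - \<alpha>)" using \<alpha> by (simp add: field_simps)
  finally have "(1 - \<alpha>) / \<alpha> * (\<alpha> * x / 1) powr (1 / (1 - \<alpha>)) = (1 - \<alpha>) * \<alpha> powr (\<alpha> / (1 - \<alpha>)) * x powr (1 / (1 - \<alpha>))"
    if "0 \<le> x" using \<alpha> that by (simp add: powr_mult) (simp add: field_simps)
  then show "rate_power \<alpha> 1 x = rate \<alpha> x" by (simp add: rate_power_def rate_def legendre_def)
qed

lemma rate_power_block_weight: "0 < \<alpha> \<Longrightarrow> \<alpha> < 1 \<Longrightarrow> rate_power \<alpha> (block_weight \<alpha> l) = rate_freq \<alpha> l"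
proof
  fix x assume \<alpha>: "0 < \<alpha>" "\<alpha> < 1"
  have P: "0 < pochhammer (1 - \<alpha>) (l - 1)" using \<alpha> by (intro pochhammer_pos) auto
  have "\<alpha> * x / block_weight \<alpha> l = fact l / pochhammer (1 - \<alpha>) (l - 1) * x"
    using \<alpha> P by (simp add: block_weight_def)
  then have "(\<alpha> * x / block_weight \<alpha> l) powr (1 / (1 - \<alpha>))
      = (fact l / pochhammer (1 - \<alpha>) (l - 1)) powr (1 / (1 - \<alpha>)) * x powr (1 / (1 - \<alpha>))"
    by (simp only: powr_mult)
  then show "rate_power \<alpha> (block_weight \<alpha> l) x = rate_freq \<alpha> l x"
    by (simp add: rate_power_def rate_freq_def legendre_def)
qed

lemma psi_block_weight: "0 < \<alpha> \<Longrightarrow> \<alpha> < 1 \<Longrightarrow> psi \<alpha> (block_weight \<alpha> l * t) = psi_freq \<alpha> l t"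
proof -
  assume \<alpha>: "0 < \<alpha>" "\<alpha> < 1"
  have "0 < block_weight \<alpha> l" unfolding block_weight_def using \<alpha>
    by (intro divide_pos_pos mult_pos_pos pochhammer_pos) auto
  then have "0 < block_weight \<alpha> l * t \<longleftrightarrow> 0 < t" by (simp add: zero_less_mult_iff)
  then show ?thesis unfolding psi_def psi_freq_def by (simp add: block_weight_def)
qed

context conditioned_scaling
begin

lemma new_types_limit:
  "power_laplace_limit Q (scaled \<alpha> \<beta> (\<lambda>m \<omega>. num_new_types (sample X n \<omega>) (add_sample X n m \<omega>))) s 1 \<alpha>"
proof (rule power_laplace_limit_close[where N = "\<lambda>k. n + k" and G = "\<lambda>k c. num_new_types (take n c) (drop n c)"
      and W = "\<lambda>k c. real (num_new_types (take n c) (drop n c) + num_types (take n c)) + \<theta> / \<alpha>"])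
  show "num_new_types (sample X n \<omega>) (add_sample X n k \<omega>)
      = num_new_types (take n (code (sample X (n + k) \<omega>))) (drop n (code (sample X (n + k) \<omega>)))" for k \<omega>
    unfolding sample_add by (rule num_new_types_code[symmetric]) simp
  fix k \<omega>
  let ?c = "code (sample X (n + k) \<omega>)"
  have "num_types (take n ?c) \<le> n" unfolding num_types_def
    using card_length[of "take n ?c"] by simp
  then show "\<bar>real (num_new_types (take n ?c) (drop n ?c))
     - (real (num_new_types (take n ?c) (drop n ?c) + num_types (take n ?c)) + \<theta> / \<alpha>)\<bar> \<le> real n + \<bar>\<theta> / \<alpha>\<bar>"
    unfolding of_nat_add by linarith
next
  fix t :: real assume t: "0 < t"
  have "num_new_types (take n c) (drop n c) + num_types (take n c) = num_types c" for c :: "nat list"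
    using num_types_new[of "take n c" "drop n c"] by simp
  then show "(\<lambda>k. ln (\<integral>\<omega>. exp (tilt t k * (real (num_new_types (take n (code (sample X (n + k) \<omega>))) (drop n (code (sample X (n + k) \<omega>)))
        + num_types (take n (code (sample X (n + k) \<omega>)))) + \<theta> / \<alpha>)) \<partial>Q) / s k) \<longlonglongrightarrow> (1 * t) powr (1 / \<alpha>)"
    using types_limit[OF t, of 0] by simp
qed simp

lemma new_freq_limit:
  assumes l: "1 \<le> l"
  shows "power_laplace_limit Q (scaled \<alpha> \<beta> (\<lambda>m \<omega>. num_new_freq l (sample X n \<omega>) (add_sample X n m \<omega>))) s (block_weight \<alpha> l) \<alpha>"
proof (rule power_laplace_limit_close[where N = "\<lambda>k. n + k" and G = "\<lambda>k c. num_new_freq l (take n c) (drop n c)"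
      and W = "\<lambda>k c. real (num_new_freq l (take n c) (drop n c))" and C = 0])
  show "num_new_freq l (sample X n \<omega>) (add_sample X n k \<omega>)
      = num_new_freq l (take n (code (sample X (n + k) \<omega>))) (drop n (code (sample X (n + k) \<omega>)))" for k \<omega>
    unfolding sample_add by (rule num_new_freq_code[symmetric]) simp
  show "(\<lambda>k. ln (\<integral>\<omega>. exp (tilt t k * real (num_new_freq l (take n (code (sample X (n + k) \<omega>))) (drop n (code (sample X (n + k) \<omega>))))) \<partial>Q) / s k)
      \<longlonglongrightarrow> (block_weight \<alpha> l * t) powr (1 / \<alpha>)" if "0 < t" for t
    using freq_limit[OF that l, of 0] by simp
qed (simp_all add: block_weight_pos)

end

lemma num_freq_code: "num_freq l (code xs) = num_freq l xs"
proof -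
  have "num_new_freq l [] (map (pos xs) xs) = num_new_freq l [] xs"
    using num_new_freq_map[of "pos xs" "[]" xs l] inj_on_pos[of xs] by simp
  then show ?thesis by (simp add: num_freq_def num_new_freq_def code_def)
qed

text \<open>The first draw affects the frequency of one type only.\<close>
lemma num_freq_split:
  assumes "length xs = 1"
  shows "\<bar>real (num_freq l (xs @ ys)) - real (num_new_freq l xs ys)\<bar> \<le> 1"
proof -
  obtain a where a: "xs = [a]" using assms by (cases xs) auto
  let ?A = "{x \<in> set (xs @ ys). count_list (xs @ ys) x = l}" and ?B = "{y \<in> set ys - set xs. count_list ys y = l}"
  have "?B \<subseteq> ?A" "?A \<subseteq> insert a ?B" unfolding a by auto
  then have "card ?B \<le> card ?A" "card ?A \<le> card (insert a ?B)"
    by (intro card_mono; simp)+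
  moreover have "card (insert a ?B) \<le> card ?B + 1" by (simp add: card_insert_if)
  ultimately show ?thesis unfolding num_freq_def num_new_freq_def by linarith
qed

context conditioned_scaling
begin

text \<open>The sample of size \<open>k\<close> consists of the first draw and \<open>k - 1\<close> further ones; the case distinction covers
  the empty sample.\<close>
lemma all_types_limit:
  assumes "n = 1"
  shows "power_laplace_limit Q (scaled \<alpha> \<beta> (\<lambda>k \<omega>. num_types (sample X k \<omega>))) s 1 \<alpha>"
proof (rule power_laplace_limit_close[where N = "\<lambda>k. if k = 0 then 0 else n + (k - 1)" and G = "\<lambda>k. num_types"
      and W = "\<lambda>k c. real (num_types c) + \<theta> / \<alpha>" and C = "\<bar>\<theta> / \<alpha>\<bar>"])
  show "num_types (sample X k \<omega>) = num_types (code (sample X (if k = 0 then 0 else n + (k - 1)) \<omega>))" for k \<omega>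
    using assms by (simp add: num_types_code)
  fix t :: real assume t: "0 < t"
  show "(\<lambda>k. ln (\<integral>\<omega>. exp (tilt t k * (real (num_types (code (sample X (if k = 0 then 0 else n + (k - 1)) \<omega>))) + \<theta> / \<alpha>)) \<partial>Q) / s k)
      \<longlonglongrightarrow> (1 * t) powr (1 / \<alpha>)"
    by (rule Lim_transform_eventually[OF types_limit[OF t, of 1]])
       (rule eventually_sequentiallyI[of 1], simp)
qed auto

lemma all_freq_limit:
  assumes "n = 1" and l: "1 \<le> l"
  shows "power_laplace_limit Q (scaled \<alpha> \<beta> (\<lambda>k \<omega>. num_freq l (sample X k \<omega>))) s (block_weight \<alpha> l) \<alpha>"
proof (rule power_laplace_limit_close[where N = "\<lambda>k. if k = 0 then 0 else n + (k - 1)" and G = "\<lambda>k. num_freq l"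
      and W = "\<lambda>k c. real (num_new_freq l (take n c) (drop n c))" and C = 1])
  show "num_freq l (sample X k \<omega>) = num_freq l (code (sample X (if k = 0 then 0 else n + (k - 1)) \<omega>))" for k \<omega>
    using assms by (simp add: num_freq_code)
  show "\<bar>real (num_freq l (code (sample X (if k = 0 then 0 else n + (k - 1)) \<omega>)))
      - real (num_new_freq l (take n (code (sample X (if k = 0 then 0 else n + (k - 1)) \<omega>)))
          (drop n (code (sample X (if k = 0 then 0 else n + (k - 1)) \<omega>))))\<bar> \<le> 1" if "1 \<le> k" for k \<omega>
  proof -
    let ?c = "code (sample X (if k = 0 then 0 else n + (k - 1)) \<omega>)"
    have "length (take n ?c) = 1" using assms that by simp
    from num_freq_split[OF this, of l "drop n ?c"] show ?thesis by simp
  qed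
  fix t :: real assume t: "0 < t"
  show "(\<lambda>k. ln (\<integral>\<omega>. exp (tilt t k * real (num_new_freq l (take n (code (sample X (if k = 0 then 0 else n + (k - 1)) \<omega>)))
       (drop n (code (sample X (if k = 0 then 0 else n + (k - 1)) \<omega>))))) \<partial>Q) / s k) \<longlonglongrightarrow> (block_weight \<alpha> l * t) powr (1 / \<alpha>)"
    by (rule Lim_transform_eventually[OF freq_limit[OF t l, of 1]])
       (rule eventually_sequentiallyI[of 1], simp)
qed (simp_all add: block_weight_pos)

end

lemma (in ewens_pitman_model) given_freqs_first: "given_freqs M X 1 1 [1] = M"
proof -
  have "{\<omega> \<in> space M. num_types (sample X 1 \<omega>) = 1 \<and> freqs (sample X 1 \<omega>) = [1]} = space M"
    by (auto simp: sample_def num_types_def freqs_def types_def)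
  then have "given_freqs M X 1 1 [1] = uniform_measure M (space M)" by (simp add: given_freqs_def)
  also have "\<dots> = M"
  proof (rule measure_eqI)
    fix A assume "A \<in> sets (uniform_measure M (space M))"
    then have "A \<in> events" by simp
    then show "emeasure (uniform_measure M (space M)) A = emeasure M A"
      by (simp add: emeasure_space_1 sets.Int_space_eq1 divide_ennreal_def)
  qed simp
  finally show ?thesis .
qed

theorem theorem2p3:
  fixes \<alpha> \<theta> :: real and \<beta> :: "nat \<Rightarrow> real" and l n j :: nat and ns :: "nat list"
    and \<nu> :: "'a::polish_space measure" and M :: "'w measure" and X :: "nat \<Rightarrow> 'w \<Rightarrow> 'a"
  assumes "0 < \<alpha>" "\<alpha> < 1" "\<theta> > - \<alpha>"
    and "ewens_pitman \<alpha> \<theta> \<nu> M X"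
    and "l \<ge> 1"
    and "\<forall>k\<ge>1. \<beta> k > 0"
    and "filterlim \<beta> at_top sequentially"
    and "(\<lambda>k. \<beta> k / real k powr (1 - \<alpha>)) \<longlonglongrightarrow> 0"
    and "1 \<le> n" "1 \<le> j" "j \<le> n"
    and "length ns = j" "\<forall>i\<in>set ns. 1 \<le> i" "sum_list ns = n"
  defines "Q \<equiv> given_freqs M X n j ns"
    and "K \<equiv> scaled \<alpha> \<beta> (\<lambda>k \<omega>. num_types (sample X k \<omega>))"
    and "Ml \<equiv> scaled \<alpha> \<beta> (\<lambda>k \<omega>. num_freq l (sample X k \<omega>))"
    and "Kn \<equiv> scaled \<alpha> \<beta> (\<lambda>m \<omega>. num_new_types (sample X n \<omega>) (add_sample X n m \<omega>))"
    and "Mln \<equiv> scaled \<alpha> \<beta> (\<lambda>m \<omega>. num_new_freq l (sample X n \<omega>) (add_sample X n m \<omega>))"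
  shows "(\<theta> = 0 \<longrightarrow>
            (\<forall>t. log_laplace M K (speed \<alpha> \<beta>) t \<longlonglongrightarrow> psi \<alpha> t) \<and>
            (\<forall>t. log_laplace M Ml (speed \<alpha> \<beta>) t \<longlonglongrightarrow> psi_freq \<alpha> l t) \<and>
            (\<forall>t. log_laplace Q Kn (speed \<alpha> \<beta>) t \<longlonglongrightarrow> psi \<alpha> t) \<and>
            (\<forall>t. log_laplace Q Mln (speed \<alpha> \<beta>) t \<longlonglongrightarrow> psi_freq \<alpha> l t))
       \<and> LDP M K (speed \<alpha> \<beta>) (rate \<alpha>)
       \<and> LDP M Ml (speed \<alpha> \<beta>) (rate_freq \<alpha> l)
       \<and> LDP Q Kn (speed \<alpha> \<beta>) (rate \<alpha>)
       \<and> LDP Q Mln (speed \<alpha> \<beta>) (rate_freq \<alpha> l)"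
proof -
  interpret first: conditioned_scaling \<alpha> \<theta> \<nu> M X 1 1 "[1]" \<beta>
    by unfold_locales (use assms in auto)
  interpret cond: conditioned_scaling \<alpha> \<theta> \<nu> M X n j ns \<beta>
    by unfold_locales (use assms in auto)
  have K: "power_laplace_limit M K (speed \<alpha> \<beta>) 1 \<alpha>"
    using first.all_types_limit[OF refl] unfolding first.given_freqs_first K_def .
  have Ml: "power_laplace_limit M Ml (speed \<alpha> \<beta>) (block_weight \<alpha> l) \<alpha>"
    using first.all_freq_limit[OF refl \<open>l \<ge> 1\<close>] unfolding first.given_freqs_first Ml_def .
  have Kn: "power_laplace_limit Q Kn (speed \<alpha> \<beta>) 1 \<alpha>"
    unfolding Q_def Kn_def by (rule cond.new_types_limit)
  have Mln: "power_laplace_limit Q Mln (speed \<alpha> \<beta>) (block_weight \<alpha> l) \<alpha>"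
    unfolding Q_def Mln_def by (rule cond.new_freq_limit[OF \<open>l \<ge> 1\<close>])
  note psi_l = psi_block_weight[OF assms(1,2), of l]
  note rate_1 = rate_power_1[OF assms(1,2)] and rate_l = rate_power_block_weight[OF assms(1,2), of l]
  show ?thesis
    using power_laplace_limit.log_laplace_tendsto[OF K] power_laplace_limit.LDP_rate_power[OF K]
      power_laplace_limit.log_laplace_tendsto[OF Ml] power_laplace_limit.LDP_rate_power[OF Ml]
      power_laplace_limit.log_laplace_tendsto[OF Kn] power_laplace_limit.LDP_rate_power[OF Kn]
      power_laplace_limit.log_laplace_tendsto[OF Mln] power_laplace_limit.LDP_rate_power[OF Mln]
    by (simp add: psi_l rate_1 rate_l)
qed

end
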